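(* Let $k$ be a field, let $R=k[x,y,z]$ be the standard graded polynomial ring, and let $\varphi$ be an $n\times(n-1)$ matrix whose entries are linear forms of $R$. Assume that $\mathrm{ht}\, I_1(\varphi)=3$ and $\mathrm{ht}\, I_{n-1}(\varphi)=2$, and set $I=I_{n-1}(\varphi)$. Then: (a) The rational map $\mathfrak F:\mathbb P^2\dashrightarrow\mathbb P^{n-1}$ defined by the maximal minors of $\varphi$ is a birational map of $\mathbb P^2$ onto its image. In particular, $I$ has maximal analytic spread, i.e. $\ell(I)=3$. (b) The inverse map to $\mathfrak F$ in (a) is defined by forms of degree $2$. (c) $\mathrm{depth}(R/I^2)=0$.
   Context: $I_t(\varphi)$ denotes the ideal generated by the $t\times t$ minors of $\varphi$, and $\mathrm{ht}$ denotes height (codimension). The special fiber of a homogeneous ideal $I\subset R$ is $\mathcal F(I)=\mathcal R_R(I)/\mathfrak m\mathcal R_R(I)$, where $\mathcal R_R(I)=R[It]$ is the Rees algebra and $\mathfrak m=(x,y,z)$; the analytic spread is $\ell(I)=\dim\mathcal F(I)$. Statement (b) means that the inverse rational map from the image to $\mathbb P^2$ has a representative given by three forms of degree $2$ in the coordinates of $\mathbb P^{n-1}$. *)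

theory Defs
  imports
    "HOL-Library.Poly_Mapping"
    "HOL-Library.Extended_Nat"
    "HOL-Algebra.Ideal_Product"
    "HOL-Algebra.QuotRing"
    "HOL-Algebra.UnivPoly"
    "Jordan_Normal_Form.Determinant"
    "Jordan_Normal_Form.DL_Submatrix"
begin

section \<open>Polynomial rings\<close>

text \<open>A monomial is a finitely supported exponent vector, a polynomial a finitely supported
  family of coefficients indexed by monomials. All variables are indexed by natural numbers;
  the ring in \<open>n\<close> variables is the subring of polynomials in the variables \<open>0, ..., n - 1\<close>.\<close>

type_synonym 'k mpoly = "(nat \<Rightarrow>\<^sub>0 nat) \<Rightarrow>\<^sub>0 'k"

definition polyring :: "nat \<Rightarrow> ('k::field) mpoly ring" where
  "polyring n = \<lparr>carrier = {p. \<forall>m\<in>Poly_Mapping.keys p. Poly_Mapping.keys m \<subseteq> {..<n}},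
     monoid.mult = (*), one = 1, zero = 0, add = (+)\<rparr>"

definition pvar :: "nat \<Rightarrow> ('k::field) mpoly" where
  "pvar i = Poly_Mapping.single (Poly_Mapping.single i 1) 1"

definition form_of_degree :: "nat \<Rightarrow> ('k::field) mpoly \<Rightarrow> bool" where
  "form_of_degree d p \<longleftrightarrow>
     (\<forall>m\<in>Poly_Mapping.keys p. (\<Sum>i\<in>Poly_Mapping.keys m. Poly_Mapping.lookup m i) = d)"

definition psubst :: "('k::field) mpoly \<Rightarrow> (nat \<Rightarrow> 'k mpoly) \<Rightarrow> 'k mpoly" where
  "psubst p g = (\<Sum>m\<in>Poly_Mapping.keys p. Poly_Mapping.single 0 (Poly_Mapping.lookup p m) *
      (\<Prod>i\<in>Poly_Mapping.keys m. g i ^ Poly_Mapping.lookup m i))"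

definition irrelevant_ideal :: "nat \<Rightarrow> ('k::field) mpoly set" where
  "irrelevant_ideal n = Idl\<^bsub>polyring n\<^esub> (pvar ` {..<n})"


section \<open>Dimension, height, depth\<close>

definition prime_chain :: "('a, 'b) ring_scheme \<Rightarrow> nat \<Rightarrow> (nat \<Rightarrow> 'a set) \<Rightarrow> bool" where
  "prime_chain A n C \<longleftrightarrow> (\<forall>i\<le>n. primeideal (C i) A) \<and> (\<forall>i<n. C i \<subset> C (Suc i))"

definition krull_dim :: "('a, 'b) ring_scheme \<Rightarrow> enat" where
  "krull_dim A = Sup {enat n | n. \<exists>C. prime_chain A n C}"

definition prime_height :: "('a, 'b) ring_scheme \<Rightarrow> 'a set \<Rightarrow> enat" where
  "prime_height A P = Sup {enat n | n. \<exists>C. prime_chain A n C \<and> C n = P}"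

text \<open>The unit ideal has height \<open>\<infinity>\<close>.\<close>

definition ideal_height :: "('a, 'b) ring_scheme \<Rightarrow> 'a set \<Rightarrow> enat" where
  "ideal_height A I = Inf {prime_height A P | P. primeideal P A \<and> I \<subseteq> P}"

definition regular_seq :: "('a, 'b) ring_scheme \<Rightarrow> 'a list \<Rightarrow> bool" where
  "regular_seq A xs \<longleftrightarrow> set xs \<subseteq> carrier A \<and> Idl\<^bsub>A\<^esub> (set xs) \<noteq> carrier A \<and>
     (\<forall>i<length xs. \<forall>a\<in>carrier A.
        xs ! i \<otimes>\<^bsub>A\<^esub> a \<in> Idl\<^bsub>A\<^esub> (set (take i xs)) \<longrightarrow> a \<in> Idl\<^bsub>A\<^esub> (set (take i xs)))"

text \<open>The depth of \<open>A\<close> with respect to \<open>M\<close>; for a standard graded algebra over a field, \<open>M\<close> is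
  the homogeneous maximal ideal.\<close>

definition ring_depth :: "('a, 'b) ring_scheme \<Rightarrow> 'a set \<Rightarrow> enat" where
  "ring_depth A M = Sup {enat (length xs) | xs. set xs \<subseteq> M \<and> regular_seq A xs}"


section \<open>Rees algebra, special fiber and analytic spread\<close>

definition rees_algebra :: "('a, 'b) ring_scheme \<Rightarrow> 'a set \<Rightarrow> ('a, nat \<Rightarrow> 'a) up_ring" where
  "rees_algebra A I = (UP A)\<lparr>carrier :=
     {p \<in> carrier (UP A). \<forall>i. p i \<in> I [^]\<^bsub>ideals_set A\<^esub> i}\<rparr>"

definition special_fiber :: "('a, 'b) ring_scheme \<Rightarrow> 'a set \<Rightarrow> 'a set \<Rightarrow> (nat \<Rightarrow> 'a) set ring" where
  "special_fiber A M I = rees_algebra A I Quot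
     (Idl\<^bsub>rees_algebra A I\<^esub> ((\<lambda>a. up_ring.monom (UP A) a 0) ` M))"

definition analytic_spread :: "('a, 'b) ring_scheme \<Rightarrow> 'a set \<Rightarrow> 'a set \<Rightarrow> enat" where
  "analytic_spread A M I = krull_dim (special_fiber A M I)"


section \<open>Determinantal ideals\<close>

definition minors_ideal :: "nat \<Rightarrow> nat \<Rightarrow> ('k::field) mpoly mat \<Rightarrow> 'k mpoly set" where
  "minors_ideal n t \<phi> = Idl\<^bsub>polyring n\<^esub> {det (submatrix \<phi> U V) | U V.
     U \<subseteq> {..<dim_row \<phi>} \<and> V \<subseteq> {..<dim_col \<phi>} \<and> card U = t \<and> card V = t}"

text \<open>For a matrix with one more row than columns: the maximal minor omitting row \<open>i\<close>.\<close>

definition max_minor :: "('k::field) mpoly mat \<Rightarrow> nat \<Rightarrow> 'k mpoly" where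
  "max_minor \<phi> i = det (submatrix \<phi> ({..<dim_row \<phi>} - {i}) {..<dim_col \<phi>})"


section \<open>Rational maps\<close>

text \<open>A closed integral subscheme \<open>X\<close> of projective \<open>(n-1)\<close>-space over \<open>k\<close> is given by its
  homogeneous prime ideal \<open>P\<close> in \<open>polyring n\<close>. A rational map from \<open>X\<close> to projective
  \<open>(r-1)\<close>-space is represented by \<open>r\<close> forms \<open>g 0, ..., g (r-1)\<close> of a common degree in the
  coordinates of the ambient space, not all vanishing on \<open>X\<close>. (Working with forms rather than
  with \<open>k\<close>-rational points is needed since \<open>k\<close> is arbitrary.)\<close>

definition represents_rational_map ::
  "nat \<Rightarrow> ('k::field) mpoly set \<Rightarrow> nat \<Rightarrow> (nat \<Rightarrow> 'k mpoly) \<Rightarrow> bool" where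
  "represents_rational_map n P r g \<longleftrightarrow>
     (\<exists>d. \<forall>i<r. g i \<in> carrier (polyring n) \<and> form_of_degree d (g i)) \<and> (\<exists>i<r. g i \<notin> P)"

text \<open>Two tuples represent the same rational map iff they are proportional over the
  homogeneous coordinate ring of \<open>X\<close>.\<close>

definition same_rational_map ::
  "nat \<Rightarrow> ('k::field) mpoly set \<Rightarrow> nat \<Rightarrow> (nat \<Rightarrow> 'k mpoly) \<Rightarrow> (nat \<Rightarrow> 'k mpoly) \<Rightarrow> bool" where
  "same_rational_map n P r g h \<longleftrightarrow>
     represents_rational_map n P r g \<and> represents_rational_map n P r h \<and>
     (\<forall>i<r. \<forall>j<r. g i * h j - g j * h i \<in> P)"

text \<open>The homogeneous ideal of the (closed) image.\<close>

definition image_ideal ::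
  "('k::field) mpoly set \<Rightarrow> nat \<Rightarrow> (nat \<Rightarrow> 'k mpoly) \<Rightarrow> 'k mpoly set" where
  "image_ideal P r g = {q \<in> carrier (polyring r). psubst q g \<in> P}"

definition comp_tuple :: "(nat \<Rightarrow> ('k::field) mpoly) \<Rightarrow> (nat \<Rightarrow> 'k mpoly) \<Rightarrow> nat \<Rightarrow> 'k mpoly" where
  "comp_tuple h g = (\<lambda>i. psubst (h i) g)"

text \<open>\<open>h\<close> represents a rational map from the image \<open>Y\<close> of \<open>g\<close> to \<open>X\<close> such that both composites
  with \<open>g\<close> are the identity, as rational maps on \<open>X\<close> and on \<open>Y\<close>. The tuple of coordinates
  \<open>pvar\<close> represents the identity.\<close>

definition inverse_onto_image ::
  "nat \<Rightarrow> ('k::field) mpoly set \<Rightarrow> nat \<Rightarrow> (nat \<Rightarrow> 'k mpoly) \<Rightarrow> (nat \<Rightarrow> 'k mpoly) \<Rightarrow> bool" where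
  "inverse_onto_image n P r g h \<longleftrightarrow>
     represents_rational_map n P r g \<and>
     represents_rational_map r (image_ideal P r g) n h \<and>
     (\<forall>p\<in>P. psubst p h \<in> image_ideal P r g) \<and>
     same_rational_map n P n (comp_tuple h g) pvar \<and>
     same_rational_map r (image_ideal P r g) r (comp_tuple g h) pvar"

definition birational_onto_image ::
  "nat \<Rightarrow> ('k::field) mpoly set \<Rightarrow> nat \<Rightarrow> (nat \<Rightarrow> 'k mpoly) \<Rightarrow> bool" where
  "birational_onto_image n P r g \<longleftrightarrow> (\<exists>h. inverse_onto_image n P r g h)"

end

theory Submission
  imports
    Defs
    "HOL-Algebra.Subrings"
    "Berlekamp_Zassenhaus.Unique_Factorization_Poly"
begin

text \<open>Write the relations \<open>f \<phi> = 0\<close> between the signed maximal minors as \<open>x B(f) = 0\<close>, where \<open>B\<close> is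
  the Jacobian dual, a \<open>3 \<times> (n - 1)\<close> matrix of linear forms in the coordinates of the target. If
  \<open>B(f)\<close> has rank two, the cross product of two independent columns is a multiple \<open>D x\<close> of the
  vector of variables: its components are the quadrics \<open>h\<close> defining the inverse map, any inverse
  is proportional to \<open>h\<close>, and \<open>D\<close>, of degree one less than the generators of \<open>I\<^sup>2\<close>, is a socle
  element of \<open>R / I\<^sup>2\<close>. If \<open>B(f)\<close> had rank one, the map would contract the lines orthogonal to a
  column; since two such lines can only meet in the finite base locus, they would all pass through
  one rational point, and linear independence of the minors would force all entries of \<open>\<phi>\<close> to
  vanish there, contrary to \<open>ht I\<^sub>1(\<phi>) = 3\<close>.

  The dimension theory rests on one step: if \<open>Q \<subset> P\<close> are primes, elements algebraically independent
  modulo \<open>P\<close> stay independent modulo \<open>Q\<close> when an element of \<open>P - Q\<close> is added to them, while any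
  four polynomials in three variables are dependent. This bounds heights and the dimension of the
  special fiber from above.\<close>

section \<open>Polynomials and substitution\<close>

text \<open>The field is arbitrary, possibly finite, so no argument may pick a general rational
  point or a general line. The variables themselves, and substitutions into them, take the place of
  generic points, and nonvanishing is mostly decided by leading monomials. Height two enters in two
  ways. Modulo a prime containing all minors at most one element is algebraically independent, which
  makes the base locus finite. And the minors have no common prime factor, because a principal prime
  has height at most one; this yields their linear independence, on which the rank argument rests.
  Since all minors have the same degree \<open>n - 1\<close>, the special fiber is the subalgebra
  they generate. The lower bound for its dimension is an explicit chain of four primes. It can be
  written down because the products of \<open>D\<close> with the variables lie in this subalgebra
  and supply elements separating the primes.\<close>

abbreviation supp :: "('a \<Rightarrow>\<^sub>0 'b::zero) \<Rightarrow> 'a set" where "supp \<equiv> Poly_Mapping.keys"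
abbreviation coef :: "('a \<Rightarrow>\<^sub>0 'b::zero) \<Rightarrow> 'a \<Rightarrow> 'b" where "coef \<equiv> Poly_Mapping.lookup"
abbreviation PConst :: "'k::field \<Rightarrow> 'k mpoly" where "PConst c \<equiv> Poly_Mapping.single 0 c"
abbreviation PR :: "nat \<Rightarrow> ('k::field) mpoly set" where "PR n \<equiv> carrier (polyring n)"

lemma poly_mapping_eq_sum_single: "p = (\<Sum>m\<in>supp p. Poly_Mapping.single m (coef p m))"
proof (rule poly_mapping_eqI)
  fix k
  have "coef (\<Sum>m\<in>supp p. Poly_Mapping.single m (coef p m)) k
      = (\<Sum>m\<in>supp p. coef p m when m = k)"
    by (simp add: lookup_sum lookup_single)
  also have "\<dots> = coef p k"
    by (cases "k \<in> supp p") (auto simp: when_def in_keys_iff)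
  finally show "coef p k = coef (\<Sum>m\<in>supp p. Poly_Mapping.single m (coef p m)) k" ..
qed

lemma poly_mapping_single_induct [case_names single zero add]:
  fixes p :: "'a \<Rightarrow>\<^sub>0 'b::comm_monoid_add"
  assumes single: "\<And>m. m \<in> supp p \<Longrightarrow> P (Poly_Mapping.single m (coef p m))" "P 0"
    and add: "\<And>q r. P q \<Longrightarrow> P r \<Longrightarrow> P (q + r)"
  shows "P p"
proof -
  have "P (\<Sum>m\<in>A. Poly_Mapping.single m (coef p m))" if "finite A" "A \<subseteq> supp p" for A
    using that by (induction A rule: finite_induct) (auto intro: assms)
  from this[of "supp p"] show ?thesis by (simp add: poly_mapping_eq_sum_single[symmetric])
qed

lemma supp_add_nat: "supp (m + m' :: 'a \<Rightarrow>\<^sub>0 nat) = supp m \<union> supp m'"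
  by (auto simp: in_keys_iff lookup_add)

definition mon_eval :: "(nat \<Rightarrow> 'b::comm_ring_1) \<Rightarrow> (nat \<Rightarrow>\<^sub>0 nat) \<Rightarrow> 'b" where
  "mon_eval g m = (\<Prod>i\<in>supp m. g i ^ coef m i)"

lemma mon_eval_superset:
  "finite A \<Longrightarrow> supp m \<subseteq> A \<Longrightarrow> mon_eval g m = (\<Prod>i\<in>A. g i ^ coef m i)"
  unfolding mon_eval_def by (rule prod.mono_neutral_left) (auto simp: in_keys_iff)

lemma mon_eval_add: "mon_eval g (m + m') = mon_eval g m * mon_eval g m'"
  by (simp add: mon_eval_superset[of "supp m \<union> supp m'"] supp_add_nat lookup_add power_add
      prod.distrib)

lemma mon_eval_zero [simp]: "mon_eval g 0 = 1"
  by (simp add: mon_eval_def)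

lemma mon_eval_single: "mon_eval g (Poly_Mapping.single i e) = g i ^ e"
  by (subst mon_eval_superset[of "{i}"]) auto

text \<open>The coefficient map \<open>c\<close> has an arbitrary target so that one evaluation
  serves both substitution (\<open>c = PConst\<close>) and the passage to iterated univariate
  polynomials (\<open>to_poly3\<close>).\<close>

definition aeval :: "('k::field \<Rightarrow> 'b::comm_ring_1) \<Rightarrow> (nat \<Rightarrow> 'b) \<Rightarrow> 'k mpoly \<Rightarrow> 'b" where
  "aeval c g p = (\<Sum>m\<in>supp p. c (coef p m) * mon_eval g m)"

lemma psubst_eq_aeval: "psubst p g = aeval PConst g p"
  by (simp add: psubst_def aeval_def mon_eval_def)

locale coeff_hom = comm_ring_hom c for c :: "'k::field \<Rightarrow> 'b::comm_ring_1"
begin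

lemma aeval_superset:
  "finite A \<Longrightarrow> supp p \<subseteq> A \<Longrightarrow> aeval c g p = (\<Sum>m\<in>A. c (coef p m) * mon_eval g m)"
  unfolding aeval_def by (rule sum.mono_neutral_left) (auto simp: in_keys_iff)

lemma aeval_add: "aeval c g (p + q) = aeval c g p + aeval c g q"
proof -
  have "supp (p + q) \<subseteq> supp p \<union> supp q" by (rule keys_add)
  then show ?thesis
    by (simp add: aeval_superset[of "supp p \<union> supp q"] lookup_add hom_add distrib_right sum.distrib)
qed

lemma aeval_zero: "aeval c g 0 = 0" by (simp add: aeval_def)

lemma aeval_single: "aeval c g (Poly_Mapping.single m x) = c x * mon_eval g m"
  by (subst aeval_superset[of "{m}"]) auto

lemma aeval_mult: "aeval c g (p * q) = aeval c g p * aeval c g q"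
proof (induction p rule: poly_mapping_single_induct)
  case (single m)
  let ?s = "Poly_Mapping.single m (coef p m)"
  show ?case
  proof (induction q rule: poly_mapping_single_induct)
    case (single m')
    show ?case by (simp add: mult_single aeval_single hom_mult mon_eval_add)
  qed (simp_all add: aeval_zero aeval_add distrib_left)
qed (simp_all add: aeval_zero aeval_add distrib_right)

lemma aeval_PConst: "aeval c g (PConst x) = c x"
  by (simp add: aeval_single)

lemma aeval_pvar: "aeval c g (pvar i) = g i"
  by (simp add: aeval_single pvar_def mon_eval_single)

lemma aeval_one: "aeval c g 1 = 1"
  using aeval_PConst[of g 1] by simp

lemma comm_ring_hom_aeval: "comm_ring_hom (aeval c g)"
  by unfold_locales (simp_all add: aeval_zero aeval_add aeval_one aeval_mult)

end

lemma coeff_hom_PConst: "coeff_hom PConst"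
  by unfold_locales (simp_all add: single_add mult_single)

lemma comm_ring_hom_psubst: "comm_ring_hom (\<lambda>p. psubst p g)"
  using coeff_hom.comm_ring_hom_aeval[OF coeff_hom_PConst] by (simp add: psubst_eq_aeval)

interpretation psubst: comm_ring_hom "\<lambda>p. psubst p g" for g
  by (rule comm_ring_hom_psubst)

lemma psubst_pvar [simp]: "psubst (pvar i) g = g i"
  by (simp add: psubst_eq_aeval coeff_hom.aeval_pvar[OF coeff_hom_PConst])

lemma psubst_PConst [simp]: "psubst (PConst c) g = PConst c"
  by (simp add: psubst_eq_aeval coeff_hom.aeval_PConst[OF coeff_hom_PConst])

lemma psubst_single: "psubst (Poly_Mapping.single m c) g = PConst c * mon_eval g m"
  by (simp add: psubst_eq_aeval coeff_hom.aeval_single[OF coeff_hom_PConst])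

lemma psubst_eq_sum: "psubst p g = (\<Sum>m\<in>supp p. PConst (coef p m) * mon_eval g m)"
  by (simp add: psubst_eq_aeval aeval_def)

lemma polyring_simps [simp]:
  "monoid.mult (polyring n) = (*)" "one (polyring n) = 1" "zero (polyring n) = 0"
  "add (polyring n) = (+)"
  by (simp_all add: polyring_def)

lemma PR_iff: "p \<in> PR n \<longleftrightarrow> (\<forall>m\<in>supp p. supp m \<subseteq> {..<n})"
  by (simp add: polyring_def)

lemma PR_zero [simp]: "0 \<in> PR n" by (simp add: PR_iff)
lemma PR_single: "supp m \<subseteq> {..<n} \<Longrightarrow> Poly_Mapping.single m c \<in> PR n" by (auto simp: PR_iff)
lemma PR_PConst [simp]: "PConst c \<in> PR n" by (simp add: PR_single)
lemma PR_one [simp]: "1 \<in> PR n" using PR_PConst[of 1] by simp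
lemma PR_pvar: "i < n \<Longrightarrow> pvar i \<in> PR n" by (auto simp: PR_iff pvar_def)
lemma PR_add: "p \<in> PR n \<Longrightarrow> q \<in> PR n \<Longrightarrow> p + q \<in> PR n"
  using keys_add[of p q] unfolding PR_iff by blast
lemma PR_mult: "p \<in> PR n \<Longrightarrow> q \<in> PR n \<Longrightarrow> p * q \<in> PR n"
  using keys_mult[of p q] by (fastforce simp: PR_iff supp_add_nat)
lemma PR_uminus: "p \<in> PR n \<Longrightarrow> - p \<in> PR n" by (simp add: PR_iff in_keys_iff)
lemma PR_diff: "p \<in> PR n \<Longrightarrow> q \<in> PR n \<Longrightarrow> p - q \<in> PR n"
  using PR_add[of p n "- q"] PR_uminus by auto
lemma PR_power: "p \<in> PR n \<Longrightarrow> p ^ e \<in> PR n" by (induction e) (auto intro: PR_mult)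
lemma PR_sum: "(\<And>i. i \<in> A \<Longrightarrow> f i \<in> PR n) \<Longrightarrow> sum f A \<in> PR n"
  by (induction A rule: infinite_finite_induct) (auto intro: PR_add)
lemma PR_prod: "(\<And>i. i \<in> A \<Longrightarrow> f i \<in> PR n) \<Longrightarrow> prod f A \<in> PR n"
  by (induction A rule: infinite_finite_induct) (auto intro: PR_mult)
lemma PR_mono: "n \<le> r \<Longrightarrow> PR n \<subseteq> PR r" by (fastforce simp: PR_iff)

lemmas PR_intros = PR_add PR_mult PR_uminus PR_diff PR_power PR_sum PR_prod PR_pvar

lemma single_eq_PConst_mult_mon_eval:
  fixes c :: "'k::field"
  shows "Poly_Mapping.single m c = PConst c * mon_eval pvar m"
proof -
  have "Poly_Mapping.single m (1::'k) = mon_eval pvar m"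
  proof (induction m rule: poly_mapping_single_induct)
    case (single i)
    have "Poly_Mapping.single (Poly_Mapping.single i e) (1::'k) = pvar i ^ e" for e
    proof (induction e)
      case (Suc e)
      have "Poly_Mapping.single (Poly_Mapping.single i (Suc e)) (1::'k)
          = pvar i * Poly_Mapping.single (Poly_Mapping.single i e) 1"
        by (simp add: pvar_def mult_single flip: single_add)
      with Suc show ?case by simp
    qed simp
    then show ?case by (simp add: mon_eval_single)
  next
    case (add q r)
    then show ?case by (metis mon_eval_add mult.right_neutral mult_single)
  qed simp
  then show ?thesis by (metis add_0 mult.right_neutral mult_single)
qed

lemma psubst_pvar_id [simp]: "psubst p pvar = p"
  unfolding psubst_eq_sum single_eq_PConst_mult_mon_eval[symmetric]
  by (rule poly_mapping_eq_sum_single[symmetric])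

text \<open>Generation of \<open>PR n\<close> as an algebra by constants and variables; it reduces
  identities between substitutions to their values on variables.\<close>

lemma PR_induct [consumes 1, case_names const var add mult]:
  assumes p: "p \<in> PR n" and const: "\<And>c. P (PConst c)" and var: "\<And>i. i < n \<Longrightarrow> P (pvar i)"
    and add: "\<And>p q. p \<in> PR n \<Longrightarrow> q \<in> PR n \<Longrightarrow> P p \<Longrightarrow> P q \<Longrightarrow> P (p + q)"
    and mult: "\<And>p q. p \<in> PR n \<Longrightarrow> q \<in> PR n \<Longrightarrow> P p \<Longrightarrow> P q \<Longrightarrow> P (p * q)"
  shows "P p"
proof -
  have power: "P (pvar i ^ e)" if "i < n" for i e
  proof (induction e)
    case 0
    show ?case using const[of 1] by simp
  next
    case (Suc e)
    with mult[OF _ _ var[OF that], of "pvar i ^ e"] show ?case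
      by (simp add: PR_pvar PR_power that)
  qed
  have prod: "P (\<Prod>i\<in>A. pvar i ^ e i)" if "finite A" "A \<subseteq> {..<n}" for A e
    using that
  proof (induction A rule: finite_induct)
    case empty
    show ?case using const[of 1] by simp
  next
    case (insert x A)
    then have "x < n" "\<And>i. i \<in> A \<Longrightarrow> i < n" by auto
    with insert show ?case
      by (simp add: mult power PR_power PR_prod PR_pvar)
  qed
  have mono: "P (mon_eval pvar m)" "mon_eval pvar m \<in> PR n" if "m \<in> supp p" for m
  proof -
    have m: "supp m \<subseteq> {..<n}" using that p by (auto simp: PR_iff)
    then show "P (mon_eval pvar m)" unfolding mon_eval_def by (intro prod) auto
    show "mon_eval pvar m \<in> PR n"
      unfolding mon_eval_def by (intro PR_prod PR_power PR_pvar) (use m in auto)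
  qed
  have "P (\<Sum>m\<in>A. PConst (coef p m) * mon_eval pvar m)" if "finite A" "A \<subseteq> supp p" for A
    using that
  proof (induction A rule: finite_induct)
    case empty
    show ?case using const[of 0] by simp
  next
    case (insert x A)
    then have "x \<in> supp p" "\<And>i. i \<in> A \<Longrightarrow> i \<in> supp p" by auto
    with insert show ?case
      by (simp add: add mult mono const PR_mult PR_sum)
  qed
  from this[of "supp p"] show ?thesis by (simp flip: psubst_eq_sum)
qed

lemma psubst_in:
  assumes "p \<in> PR n" "\<And>c. PConst c \<in> S" "\<And>i. i < n \<Longrightarrow> g i \<in> S"
    "\<And>a b. a \<in> S \<Longrightarrow> b \<in> S \<Longrightarrow> a + b \<in> S" "\<And>a b. a \<in> S \<Longrightarrow> b \<in> S \<Longrightarrow> a * b \<in> S"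
  shows "psubst p g \<in> S"
  using assms(1)
  by (induction p rule: PR_induct) (auto simp: assms psubst.hom_add psubst.hom_mult)

lemma psubst_PR: "p \<in> PR n \<Longrightarrow> (\<And>i. i < n \<Longrightarrow> g i \<in> PR r) \<Longrightarrow> psubst p g \<in> PR r"
  by (rule psubst_in) (auto intro: PR_intros)

lemma psubst_cong: "p \<in> PR n \<Longrightarrow> (\<And>i. i < n \<Longrightarrow> g i = h i) \<Longrightarrow> psubst p g = psubst p h"
  by (induction p rule: PR_induct) (auto simp: psubst.hom_add psubst.hom_mult)

lemma psubst_psubst: "p \<in> PR n \<Longrightarrow> psubst (psubst p g) h = psubst p (\<lambda>i. psubst (g i) h)"
  by (induction p rule: PR_induct) (auto simp: psubst.hom_add psubst.hom_mult)

section \<open>Gradings and leading monomials\<close>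

text \<open>Weights are integers because the weight \<open>L\<close> in
  \<open>fiber_ring_chain\<close> is negative on some monomials; the total degree is another
  instance.\<close>

definition wpart :: "((nat \<Rightarrow>\<^sub>0 nat) \<Rightarrow> int) \<Rightarrow> int \<Rightarrow> ('k::field) mpoly \<Rightarrow> 'k mpoly" where
  "wpart L e p = (\<Sum>m | m \<in> supp p \<and> L m = e. Poly_Mapping.single m (coef p m))"

lemma coef_wpart: "coef (wpart L e p) m = (if L m = e then coef p m else 0)"
proof -
  have "coef (wpart L e p) m = (\<Sum>m' | m' \<in> supp p \<and> L m' = e. coef p m' when m' = m)"
    by (simp add: wpart_def lookup_sum lookup_single)
  also have "\<dots> = (if L m = e then coef p m else 0)"
    by (cases "m \<in> supp p") (auto simp: when_def in_keys_iff)
  finally show ?thesis .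
qed

lemma supp_wpart: "supp (wpart L e p) = {m \<in> supp p. L m = e}"
  by (auto simp: in_keys_iff coef_wpart split: if_splits)

lemma wpart_PR: "p \<in> PR n \<Longrightarrow> wpart L e p \<in> PR n"
  by (auto simp: PR_iff supp_wpart)

lemma wpart_add: "wpart L e (p + q) = wpart L e p + wpart L e q"
  by (rule poly_mapping_eqI) (simp add: coef_wpart lookup_add)

lemma wpart_zero [simp]: "wpart L e 0 = 0"
  by (rule poly_mapping_eqI) (simp add: coef_wpart)

lemma wpart_sum: "wpart L e (sum f A) = (\<Sum>i\<in>A. wpart L e (f i))"
  by (induction A rule: infinite_finite_induct) (auto simp: wpart_add)

lemma wpart_id: "(\<And>m. m \<in> supp p \<Longrightarrow> L m = e) \<Longrightarrow> wpart L e p = p"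
  by (rule poly_mapping_eqI) (auto simp: coef_wpart in_keys_iff)

lemma wpart_eq_0: "(\<And>m. m \<in> supp p \<Longrightarrow> L m \<noteq> e) \<Longrightarrow> wpart L e p = 0"
  by (rule poly_mapping_eqI) (auto simp: coef_wpart in_keys_iff)

locale weight =
  fixes L :: "(nat \<Rightarrow>\<^sub>0 nat) \<Rightarrow> int"
  assumes L_add: "L (m + m') = L m + L m'"
begin

lemma L_zero [simp]: "L 0 = 0" using L_add[of 0 0] by simp

lemma supp_mult_ge:
  "(\<And>m. m \<in> supp p \<Longrightarrow> a \<le> L m) \<Longrightarrow> (\<And>m. m \<in> supp q \<Longrightarrow> b \<le> L m) \<Longrightarrow> m \<in> supp (p * q) \<Longrightarrow> a + b \<le> L m"
  using keys_mult[of p q] by (force simp: L_add add_mono)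

text \<open>Here \<open>a\<close> and \<open>b\<close> are only lower bounds, so either part may
  vanish. A product of two monomials reaches weight \<open>a + b\<close> only if both factors have
  the least admissible weight.\<close>

lemma wpart_mult:
  assumes p: "\<And>m. m \<in> supp p \<Longrightarrow> a \<le> L m" and q: "\<And>m. m \<in> supp q \<Longrightarrow> b \<le> L m"
  shows "wpart L (a + b) (p * q) = wpart L a p * wpart L b q"
proof -
  define p' q' where "p' = p - wpart L a p" and "q' = q - wpart L b q"
  have p': "a < L m" if "m \<in> supp p'" for m
    using that p[of m] by (fastforce simp: p'_def in_keys_iff lookup_minus coef_wpart split: if_splits)
  have q': "b < L m" if "m \<in> supp q'" for m
    using that q[of m] by (fastforce simp: q'_def in_keys_iff lookup_minus coef_wpart split: if_splits)
  have 1: "wpart L (a + b) (wpart L a p * wpart L b q) = wpart L a p * wpart L b q"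
    by (rule wpart_id) (use keys_mult[of "wpart L a p" "wpart L b q"] in \<open>force simp: supp_wpart L_add\<close>)
  have 2: "wpart L (a + b) (wpart L a p * q') = 0"
    by (rule wpart_eq_0) (use keys_mult[of "wpart L a p" q'] q' in \<open>force simp: supp_wpart L_add\<close>)
  have 3: "wpart L (a + b) (p' * q) = 0"
    by (rule wpart_eq_0) (use keys_mult[of p' q] p' q in \<open>force simp: L_add\<close>)
  have "p * q = wpart L a p * wpart L b q + wpart L a p * q' + p' * q"
    by (simp add: p'_def q'_def algebra_simps)
  then show ?thesis by (simp add: wpart_add 1 2 3)
qed

end

definition tdeg :: "(nat \<Rightarrow>\<^sub>0 nat) \<Rightarrow> nat" where "tdeg m = (\<Sum>i\<in>supp m. coef m i)"

lemma tdeg_superset: "finite A \<Longrightarrow> supp m \<subseteq> A \<Longrightarrow> tdeg m = (\<Sum>i\<in>A. coef m i)"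
  unfolding tdeg_def by (rule sum.mono_neutral_left) (auto simp: in_keys_iff)

lemma tdeg_add: "tdeg (m + m') = tdeg m + tdeg m'"
  by (simp add: tdeg_superset[of "supp m \<union> supp m'"] supp_add_nat lookup_add sum.distrib)

lemma tdeg_zero [simp]: "tdeg 0 = 0" by (simp add: tdeg_def)
lemma tdeg_single [simp]: "tdeg (Poly_Mapping.single i e) = e"
  by (subst tdeg_superset[of "{i}"]) auto
lemma tdeg_eq_0_iff: "tdeg m = 0 \<longleftrightarrow> m = 0"
  by (auto simp: tdeg_def in_keys_iff intro: poly_mapping_eqI)

lemma form_iff: "form_of_degree d p \<longleftrightarrow> (\<forall>m\<in>supp p. tdeg m = d)"
  by (simp add: form_of_degree_def tdeg_def)

lemma form_zero [simp]: "form_of_degree d 0" by (simp add: form_iff)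
lemma form_PConst [simp]: "form_of_degree 0 (PConst c)" by (simp add: form_iff)
lemma form_one [simp]: "form_of_degree 0 1" by (simp add: form_iff)
lemma form_pvar [simp]: "form_of_degree 1 (pvar i)" by (simp add: form_iff pvar_def)
lemma form_add: "form_of_degree d p \<Longrightarrow> form_of_degree d q \<Longrightarrow> form_of_degree d (p + q)"
  using keys_add[of p q] by (auto simp: form_iff)
lemma form_uminus: "form_of_degree d p \<Longrightarrow> form_of_degree d (- p)"
  by (auto simp: form_iff in_keys_iff)
lemma form_diff: "form_of_degree d p \<Longrightarrow> form_of_degree d q \<Longrightarrow> form_of_degree d (p - q)"
  using form_add[of d p "- q"] form_uminus by auto
lemma form_sum: "(\<And>i. i \<in> A \<Longrightarrow> form_of_degree d (f i)) \<Longrightarrow> form_of_degree d (sum f A)"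
  by (induction A rule: infinite_finite_induct) (auto intro: form_add)
lemma form_mult: "form_of_degree a p \<Longrightarrow> form_of_degree b q \<Longrightarrow> form_of_degree (a + b) (p * q)"
  using keys_mult[of p q] by (fastforce simp: form_iff tdeg_add)
lemma form_PConst_mult: "form_of_degree b q \<Longrightarrow> form_of_degree b (PConst c * q)"
  using form_mult[of 0 "PConst c" b q] by simp
lemma form_power: "form_of_degree a p \<Longrightarrow> form_of_degree (e * a) (p ^ e)"
  by (induction e) (auto dest: form_mult)
lemma form_prod:
  "(\<And>i. i \<in> A \<Longrightarrow> form_of_degree (d i) (f i)) \<Longrightarrow> form_of_degree (sum d A) (prod f A)"
  by (induction A rule: infinite_finite_induct) (auto intro: form_mult)

lemma form_psubst:
  assumes "form_of_degree e p" "p \<in> PR n" "\<And>i. i < n \<Longrightarrow> form_of_degree d (g i)"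
  shows "form_of_degree (e * d) (psubst p g)"
  unfolding psubst_eq_sum
proof (intro form_sum form_PConst_mult)
  fix m assume m: "m \<in> supp p"
  have "form_of_degree (\<Sum>i\<in>supp m. coef m i * d) (mon_eval g m)"
    unfolding mon_eval_def using m assms by (intro form_prod form_power) (auto simp: PR_iff)
  moreover have "(\<Sum>i\<in>supp m. coef m i * d) = e * d"
    using m assms(1) by (simp add: form_iff tdeg_def flip: sum_distrib_right)
  ultimately show "form_of_degree (e * d) (mon_eval g m)" by simp
qed

definition dpart :: "nat \<Rightarrow> ('k::field) mpoly \<Rightarrow> 'k mpoly" where
  "dpart d = wpart (\<lambda>m. int (tdeg m)) (int d)"

lemma form_dpart: "form_of_degree d (dpart d p)"
  by (auto simp: form_iff dpart_def supp_wpart)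

lemma dpart_form: "form_of_degree d p \<Longrightarrow> dpart e p = (if e = d then p else 0)"
  by (auto simp: form_iff dpart_def intro: wpart_id wpart_eq_0)

lemma dpart_PR: "p \<in> PR n \<Longrightarrow> dpart d p \<in> PR n"
  unfolding dpart_def by (rule wpart_PR)

lemma dpart_zero [simp]: "dpart d 0 = 0"
  by (simp add: dpart_def)

lemma dpart_add: "dpart d (p + q) = dpart d p + dpart d q"
  by (simp add: dpart_def wpart_add)

lemma dpart_sum: "dpart d (sum g A) = (\<Sum>i\<in>A. dpart d (g i))"
  by (simp add: dpart_def wpart_sum)

lemma dpart_0: "dpart 0 p = PConst (coef p 0)"
  by (rule poly_mapping_eqI)
    (auto simp: dpart_def coef_wpart tdeg_eq_0_iff lookup_single when_def)

lemma dpart_mult: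
  "(\<And>m. m \<in> supp p \<Longrightarrow> a \<le> tdeg m) \<Longrightarrow> (\<And>m. m \<in> supp q \<Longrightarrow> b \<le> tdeg m)
    \<Longrightarrow> dpart (a + b) (p * q) = dpart a p * dpart b q"
  using weight.wpart_mult[of "\<lambda>m. int (tdeg m)" p "int a" q "int b"]
  by (simp add: weight_def tdeg_add dpart_def)

lemma coef_mult_0: "coef (p * q) 0 = coef p 0 * coef q (0::nat \<Rightarrow>\<^sub>0 nat)" for p q :: "('k::field) mpoly"
proof -
  have "PConst (coef (p * q) 0) = PConst (coef p 0 * coef q 0)"
    using dpart_mult[of p 0 q 0] by (simp add: dpart_0 mult_single)
  then show ?thesis by (metis lookup_single_eq)
qed

text \<open>The order is the lexicographic one on exponent vectors, total and compatible with
  addition. For the zero polynomial the maximum is taken over the empty set, whence the nonzero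
  hypotheses below.\<close>

definition lm :: "('k::field) mpoly \<Rightarrow> nat \<Rightarrow>\<^sub>0 nat" where "lm p = Max (supp p)"

lemma lm_in: "p \<noteq> 0 \<Longrightarrow> lm p \<in> supp p" unfolding lm_def by (rule Max_in) auto
lemma lm_ge: "m \<in> supp p \<Longrightarrow> m \<le> lm p" unfolding lm_def by (rule Max_ge) auto
lemma lm_eqI: "m \<in> supp p \<Longrightarrow> (\<And>m'. m' \<in> supp p \<Longrightarrow> m' \<le> m) \<Longrightarrow> lm p = m"
  unfolding lm_def by (rule Max_eqI) auto

text \<open>After splitting off both leading terms, every other product of monomials is strictly
  smaller, so the coefficient at \<open>lm p + lm q\<close> is the product of the two leading
  coefficients.\<close>

lemma lm_mult:
  fixes p q :: "('k::field) mpoly"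
  assumes "p \<noteq> 0" "q \<noteq> 0"
  shows "lm (p * q) = lm p + lm q"
proof (rule lm_eqI)
  let ?p = "Poly_Mapping.single (lm p) (coef p (lm p))" and ?q = "Poly_Mapping.single (lm q) (coef q (lm q))"
  define p' q' where "p' = p - ?p" and "q' = q - ?q"
  have p': "m < lm p" if "m \<in> supp p'" for m
    using that lm_ge[of m p]
    by (fastforce simp: p'_def in_keys_iff lookup_minus lookup_single when_def split: if_splits)
  have q': "m < lm q" if "m \<in> supp q'" for m
    using that lm_ge[of m q]
    by (fastforce simp: q'_def in_keys_iff lookup_minus lookup_single when_def split: if_splits)
  have "lm p + lm q \<notin> supp (?p * q')"
  proof
    assume "lm p + lm q \<in> supp (?p * q')"
    then obtain b where "b \<in> supp q'" "lm p + lm q = lm p + b"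
      using keys_mult[of ?p q'] by (auto split: if_splits)
    with q' show False by fastforce
  qed
  moreover have "lm p + lm q \<notin> supp (p' * q)"
  proof
    assume "lm p + lm q \<in> supp (p' * q)"
    then obtain a b where "a \<in> supp p'" "b \<in> supp q" "lm p + lm q = a + b"
      using keys_mult[of p' q] by auto
    with p'[of a] lm_ge[of b q] add_less_le_mono[of a "lm p" b "lm q"] show False by simp
  qed
  moreover have "p * q = ?p * ?q + ?p * q' + p' * q"
    by (simp add: p'_def q'_def algebra_simps)
  ultimately have "coef (p * q) (lm p + lm q) = coef (?p * ?q) (lm p + lm q)"
    by (simp add: lookup_add in_keys_iff)
  then show "lm p + lm q \<in> supp (p * q)"
    using assms lm_in[of p] lm_in[of q] by (simp add: mult_single in_keys_iff)
next
  fix m assume "m \<in> supp (p * q)"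
  then show "m \<le> lm p + lm q"
    using keys_mult[of p q] lm_ge by (fastforce intro: add_mono)
qed

lemma monomial_ge_0: "(0::nat \<Rightarrow>\<^sub>0 nat) \<le> m"
proof (cases "m = 0")
  case False
  then have "\<exists>k. coef m k \<noteq> 0" by (metis lookup_zero poly_mapping_eqI)
  define k where "k = (LEAST k. coef m k \<noteq> 0)"
  have "coef m k \<noteq> 0" unfolding k_def by (rule LeastI_ex) fact
  moreover have "coef m k' = 0" if "k' < k" for k'
    using not_less_Least[of k' "\<lambda>k. coef m k \<noteq> 0"] that by (simp add: k_def)
  ultimately have "0 < m" by (auto simp: less_poly_mapping.rep_eq less_fun_def)
  then show ?thesis by simp
qed simp

lemma lm_eq_0:
  assumes "lm p = 0"
  shows "p = PConst (coef p 0)"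
proof (rule poly_mapping_eqI)
  fix m
  have "m = 0" if "m \<in> supp p"
    using lm_ge[OF that] monomial_ge_0[of m] assms by simp
  then show "coef p m = coef (PConst (coef p 0)) m"
    by (auto simp: in_keys_iff lookup_single when_def)
qed

section \<open>Chains of primes and algebraic independence\<close>

text \<open>Independence is meant in the quotient by \<open>P\<close>. For \<open>q = 0\<close> it
  says that \<open>P\<close> contains no nonzero constant, which is where the dimension bound for
  the fiber ring starts.\<close>

definition alg_indep :: "nat \<Rightarrow> (nat \<Rightarrow> ('k::field) mpoly) \<Rightarrow> 'k mpoly set \<Rightarrow> bool" where
  "alg_indep q w P \<longleftrightarrow> (\<forall>Q\<in>PR q. psubst Q w \<in> P \<longrightarrow> Q = 0)"

text \<open>Subalgebras stay subsets of one ambient type, so the chain argument treats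
  \<open>polyring 3\<close> and the fiber ring alike.\<close>

definition subalg :: "nat \<Rightarrow> ('k::field) mpoly set \<Rightarrow> bool" where
  "subalg n S \<longleftrightarrow> S \<subseteq> PR n \<and> range PConst \<subseteq> S \<and> (\<forall>a\<in>S. \<forall>b\<in>S. a + b \<in> S \<and> a * b \<in> S)"

lemma subalgD:
  assumes "subalg n S"
  shows "PConst c \<in> S" "0 \<in> S" "1 \<in> S" "a \<in> S \<Longrightarrow> a \<in> PR n" "a \<in> S \<Longrightarrow> b \<in> S \<Longrightarrow> a + b \<in> S"
    "a \<in> S \<Longrightarrow> b \<in> S \<Longrightarrow> a * b \<in> S"
proof -
  have c: "PConst c \<in> S" for c using assms by (auto simp: subalg_def)
  from c[of 0] c[of 1] show "0 \<in> S" "1 \<in> S" by simp_all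
qed (use assms in \<open>auto simp: subalg_def\<close>)

lemma subalg_PR: "subalg n (PR n)"
  by (auto simp: subalg_def intro: PR_intros)

lemma subalg_psubst:
  "subalg n S \<Longrightarrow> p \<in> PR r \<Longrightarrow> (\<And>i. i < r \<Longrightarrow> g i \<in> S) \<Longrightarrow> psubst p g \<in> S"
  by (rule psubst_in[of p r]) (auto simp: subalg_def)

lemma PConst_minus_one: "PConst (- 1) = - 1"
  by (simp add: single_uminus)

lemma subalg_closed:
  assumes S: "subalg r S"
  shows "a \<in> S \<Longrightarrow> b \<in> S \<Longrightarrow> a - b \<in> S" "a \<in> S \<Longrightarrow> a ^ e \<in> S"
proof -
  show "a - b \<in> S" if "a \<in> S" "b \<in> S"
    using subalgD(5)[OF S that(1) subalgD(6)[OF S subalgD(1)[OF S, of "- 1"] that(2)]]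
    by (simp add: PConst_minus_one)
  show "a ^ e \<in> S" if "a \<in> S" for e
    by (induction e) (use that subalgD[OF S] in auto)
qed

lemma PR_Suc_split:
  assumes "G \<in> PR (Suc q)"
  shows "\<exists>G1\<in>PR (Suc q). \<exists>G0\<in>PR q. G = pvar q * G1 + G0"
  using assms
proof (induction G rule: PR_induct)
  case (const c)
  show ?case by (intro bexI[of _ 0] bexI[of _ "PConst c"]) auto
next
  case (var i)
  show ?case
  proof (cases "i = q")
    case True
    then show ?thesis by (intro bexI[of _ 1] bexI[of _ 0]) auto
  next
    case False
    with var show ?thesis by (intro bexI[of _ 0] bexI[of _ "pvar i"]) (auto intro: PR_pvar)
  qed
next
  case (add p r)
  then obtain p1 p0 r1 r0 where "p1 \<in> PR (Suc q)" "p0 \<in> PR q" "p = pvar q * p1 + p0"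
    "r1 \<in> PR (Suc q)" "r0 \<in> PR q" "r = pvar q * r1 + r0" by metis
  then show ?case
    by (intro bexI[of _ "p1 + r1"] bexI[of _ "p0 + r0"]) (auto simp: algebra_simps intro: PR_intros)
next
  case (mult p r)
  then obtain p1 p0 r1 r0 where pr: "p1 \<in> PR (Suc q)" "p0 \<in> PR q" "p = pvar q * p1 + p0"
    "r1 \<in> PR (Suc q)" "r0 \<in> PR q" "r = pvar q * r1 + r0" by metis
  moreover have "p0 \<in> PR (Suc q)" "r0 \<in> PR (Suc q)"
    using PR_mono[of q "Suc q"] pr by auto
  ultimately show ?case
    by (intro bexI[of _ "p1 * r + p0 * r1"] bexI[of _ "p0 * r0"])
      (auto simp: algebra_simps intro!: PR_intros)
qed

text \<open>Infinite descent: a relation modulo \<open>Q\<close> is divisible by the new variable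
  and the quotient is again a relation, so all powers of that variable divide it and it is
  zero.\<close>

lemma alg_indep_step:
  fixes S :: "('k::field) mpoly set"
  assumes S: "subalg n S" and P: "ideal P ((polyring n)\<lparr>carrier := S\<rparr>)"
    and Q: "primeideal Q ((polyring n)\<lparr>carrier := S\<rparr>)" and QP: "Q \<subseteq> P"
    and x: "x \<in> P" "x \<notin> Q" and w: "\<And>i. i < q \<Longrightarrow> w i \<in> S" and ind: "alg_indep q w P"
  shows "alg_indep (Suc q) (w(q := x)) Q"
proof -
  let ?A = "(polyring n)\<lparr>carrier := S\<rparr>"
  define W where "W = w(q := x)"
  have W: "W q = x" "\<And>i. i < q \<Longrightarrow> W i = w i" by (simp_all add: W_def)
  interpret P: ideal P ?A by fact
  interpret Q: primeideal Q ?A by fact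
  have PS: "P \<subseteq> S" using P.a_subset by simp
  have w': "W i \<in> S" if "i < Suc q" for i using that w x PS by (auto simp: less_Suc_eq W)
  \<comment> \<open>Modulo \<open>P\<close> the element \<open>x\<close> vanishes, so the part
    \<open>H0\<close> free of the new variable is a relation between the \<open>w i\<close> and
    hence zero. As \<open>x\<close> is outside the prime \<open>Q\<close>, the cofactor
    \<open>H1\<close> is again a relation.\<close>
  have split: "\<exists>H'\<in>PR (Suc q). H = pvar q * H' \<and> psubst H' W \<in> Q"
    if H: "H \<in> PR (Suc q)" "psubst H W \<in> Q" for H
  proof -
    obtain H1 H0 where H10: "H1 \<in> PR (Suc q)" "H0 \<in> PR q" "H = pvar q * H1 + H0"
      using PR_Suc_split[OF H(1)] by blast
    have e1: "psubst H W = x * psubst H1 W + psubst H0 w"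
      using psubst_cong[OF H10(2), of W w] W by (simp add: H10(3) psubst.hom_add psubst.hom_mult)
    have H1S: "psubst H1 W \<in> S" and H0S: "psubst H0 w \<in> S"
      using subalg_psubst[OF S H10(1)] subalg_psubst[OF S H10(2)] w w' by auto
    have "x * (PConst (-1) * psubst H1 W) \<in> P"
      using P.I_r_closed[of x "PConst (-1) * psubst H1 W"] x H1S S by (auto simp: subalg_def)
    moreover have "psubst H W \<in> P" using H QP by auto
    ultimately have "psubst H W + x * (PConst (-1) * psubst H1 W) \<in> P"
      using additive_subgroup.a_closed[OF P.additive_subgroup_axioms] by simp
    moreover have "psubst H W + x * (PConst (-1) * psubst H1 W) = psubst H0 w"
      by (simp add: e1 PConst_minus_one)
    ultimately have "H0 = 0" using ind H10 by (simp add: alg_indep_def)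
    with e1 H have "x * psubst H1 W \<in> Q" by simp
    with Q.I_prime[of x "psubst H1 W"] x H1S PS have "psubst H1 W \<in> Q" by auto
    with H10 \<open>H0 = 0\<close> show ?thesis by auto
  qed
  have "G = 0" if G: "G \<in> PR (Suc q)" "psubst G W \<in> Q" for G
  proof -
    have pow: "\<exists>H\<in>PR (Suc q). G = pvar q ^ N * H \<and> psubst H W \<in> Q" for N
    proof (induction N)
      case 0
      show ?case using G by auto
    next
      case (Suc N)
      then obtain H where H: "H \<in> PR (Suc q)" "G = pvar q ^ N * H" "psubst H W \<in> Q" by auto
      then obtain H' where "H' \<in> PR (Suc q)" "H = pvar q * H'" "psubst H' W \<in> Q"
        using split by metis
      with H show ?case by (auto simp: mult_ac)
    qed
    show ?thesis
    proof (rule ccontr)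
      assume "G \<noteq> 0"
      then obtain m where m: "m \<in> supp G" by (metis ex_in_conv keys_eq_empty)
      obtain H where H: "G = pvar q ^ Suc (coef m q) * H" using pow by blast
      have "pvar q ^ Suc (coef m q) = Poly_Mapping.single (Poly_Mapping.single q (Suc (coef m q))) (1::'k)"
        using single_eq_PConst_mult_mon_eval[of "Poly_Mapping.single q (Suc (coef m q))" "1::'k"]
        by (simp add: mon_eval_single)
      with m H have "m \<in> supp (Poly_Mapping.single (Poly_Mapping.single q (Suc (coef m q))) (1::'k) * H)"
        by metis
      then obtain b where "m = Poly_Mapping.single q (Suc (coef m q)) + b"
        using keys_mult[of "Poly_Mapping.single (Poly_Mapping.single q (Suc (coef m q))) (1::'k)" H]
        by auto
      then have "coef m q = Suc (coef m q) + coef b q" by (metis lookup_add lookup_single_eq)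
      then show False by simp
    qed
  qed
  then show ?thesis by (simp add: alg_indep_def W_def)
qed

text \<open>The chain is descended from its top; each strict inclusion supplies one more element
  through \<open>alg_indep_step\<close>.\<close>

lemma prime_chain_alg_indep:
  assumes S: "subalg n S" and "prime_chain ((polyring n)\<lparr>carrier := S\<rparr>) r C"
    and "\<And>i. i < s \<Longrightarrow> w i \<in> S" and "alg_indep s w (C r)"
  shows "\<exists>w'. (\<forall>i<s + r. w' i \<in> S) \<and> alg_indep (s + r) w' (C 0)"
  using assms(2-)
proof (induction r arbitrary: s w)
  case 0
  then show ?case by auto
next
  case (Suc r)
  let ?A = "(polyring n)\<lparr>carrier := S\<rparr>"
  from Suc.prems(1) have C: "primeideal (C r) ?A" "primeideal (C (Suc r)) ?A" "C r \<subset> C (Suc r)"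
    "prime_chain ?A r C" by (auto simp: prime_chain_def)
  then obtain x where x: "x \<in> C (Suc r)" "x \<notin> C r" by auto
  have I: "ideal (C (Suc r)) ?A" using C(2) by (simp add: primeideal_def)
  interpret I: ideal "C (Suc r)" ?A by fact
  have "x \<in> S" using x I.a_subset by auto
  have "alg_indep (Suc s) (w(s := x)) (C r)"
    using alg_indep_step[OF S I C(1) _ x Suc.prems(2,3)] C(3) by auto
  moreover have "(w(s := x)) i \<in> S" if "i < Suc s" for i
    using that Suc.prems(2) \<open>x \<in> S\<close> by (auto simp: less_Suc_eq)
  ultimately show ?case
    using Suc.IH[OF C(4), of "Suc s" "w(s := x)"] by (simp del: fun_upd_apply)
qed

section \<open>Algebraic dependence by counting monomials\<close>

interpretation mpoly: vector_space "\<lambda>c (p::('k::field) mpoly). PConst c * p"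
  by unfold_locales (simp_all add: distrib_left distrib_right single_add mult_single flip: mult.assoc)

text \<open>Each exponent is bounded separately instead of the total degree, which makes the number
  of monomials a plain power.\<close>

definition mon_box :: "nat \<Rightarrow> nat \<Rightarrow> (nat \<Rightarrow>\<^sub>0 nat) set" where
  "mon_box r N = {m. supp m \<subseteq> {..<r} \<and> (\<forall>i. coef m i \<le> N)}"

lemma mon_box_card: "finite (mon_box r N)" "card (mon_box r N) = (N + 1) ^ r"
proof -
  define G :: "(nat \<Rightarrow> nat) \<Rightarrow> nat \<Rightarrow>\<^sub>0 nat" where
    "G f = Abs_poly_mapping (\<lambda>i. if i < r then f i else 0)" for f
  have "finite {i. (if i < r then f i else 0) \<noteq> (0::nat)}" for f
    by (rule finite_subset[of _ "{..<r}"]) (auto split: if_splits)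
  then have G: "coef (G f) i = (if i < r then f i else 0)" for f i
    unfolding G_def by (subst lookup_Abs_poly_mapping) auto
  have "bij_betw (\<lambda>m. restrict (coef m) {..<r}) (mon_box r N) (PiE {..<r} (\<lambda>_. {..N}))"
  proof (rule bij_betwI[where g = G])
    show "(\<lambda>m. restrict (coef m) {..<r}) \<in> mon_box r N \<rightarrow> PiE {..<r} (\<lambda>_. {..N})"
      by (auto simp: mon_box_def)
    have "f i \<le> N" if "f \<in> PiE {..<r} (\<lambda>_. {..N})" "i < r" for f i
      using PiE_mem[OF that(1), of i] that(2) by simp
    then show "G \<in> PiE {..<r} (\<lambda>_. {..N}) \<rightarrow> mon_box r N"
      by (auto simp: mon_box_def in_keys_iff G split: if_splits)
    show "G (restrict (coef m) {..<r}) = m" if "m \<in> mon_box r N" for m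
    proof (rule poly_mapping_eqI)
      fix i
      have "i < r \<or> coef m i = 0"
        using that in_keys_iff[of i m] by (auto simp: mon_box_def)
      then show "coef (G (restrict (coef m) {..<r})) i = coef m i" by (auto simp: G)
    qed
    show "restrict (coef (G f)) {..<r} = f" if "f \<in> PiE {..<r} (\<lambda>_. {..N})" for f
    proof
      fix i show "restrict (coef (G f)) {..<r} i = f i"
        using PiE_arb[OF that, of i] by (auto simp: G)
    qed
  qed
  from bij_betw_finite[OF this] bij_betw_same_card[OF this]
  show "finite (mon_box r N)" "card (mon_box r N) = (N + 1) ^ r"
    by (simp_all add: card_PiE finite_PiE)
qed

lemma mon_box_mono: "a \<le> b \<Longrightarrow> mon_box r a \<subseteq> mon_box r b"
  by (auto simp: mon_box_def intro: order.trans)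

lemma mon_box_mult:
  "supp p \<subseteq> mon_box r a \<Longrightarrow> supp q \<subseteq> mon_box r b \<Longrightarrow> supp (p * q) \<subseteq> mon_box r (a + b)"
proof
  fix m
  assume pq: "supp p \<subseteq> mon_box r a" "supp q \<subseteq> mon_box r b" and "m \<in> supp (p * q)"
  then obtain u v where "u \<in> supp p" "v \<in> supp q" "m = u + v" using keys_mult[of p q] by auto
  with pq have "u \<in> mon_box r a" "v \<in> mon_box r b" "m = u + v" by auto
  then show "m \<in> mon_box r (a + b)"
    by (auto simp: mon_box_def supp_add_nat lookup_add intro: add_mono)
qed

lemma mon_box_one: "supp (1::('k::field) mpoly) \<subseteq> mon_box r 0"
  by (auto simp: mon_box_def)

lemma mon_box_power: "supp p \<subseteq> mon_box r a \<Longrightarrow> supp (p ^ e) \<subseteq> mon_box r (e * a)"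
  by (induction e) (use mon_box_one in \<open>auto dest: mon_box_mult\<close>)

lemma mon_box_prod:
  assumes "finite A" "\<And>i. i \<in> A \<Longrightarrow> supp (f i) \<subseteq> mon_box r (a i)"
  shows "supp (prod f A) \<subseteq> mon_box r (sum a A)"
  using assms
proof (induction A rule: finite_induct)
  case (insert x F)
  then show ?case using mon_box_mult[of "f x" r "a x" "prod f F" "sum a F"] by simp
qed (use mon_box_one in simp)

lemma PR_mon_box: "p \<in> PR r \<Longrightarrow> \<exists>D. supp p \<subseteq> mon_box r D"
proof -
  assume p: "p \<in> PR r"
  define D where "D = Max (insert 0 ((\<lambda>m. tdeg m) ` supp p))"
  have "coef m i \<le> D" if "m \<in> supp p" for m i
  proof -
    have "coef m i \<le> tdeg m"
      by (cases "i \<in> supp m") (auto simp: tdeg_def in_keys_iff intro: member_le_sum)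
    also have "tdeg m \<le> D" unfolding D_def by (rule Max_ge) (use that in auto)
    finally show ?thesis .
  qed
  with p show ?thesis by (intro exI[of _ D]) (auto simp: mon_box_def PR_iff)
qed

lemma in_span_mon_box:
  fixes p :: "('k::field) mpoly"
  assumes "supp p \<subseteq> B"
  shows "p \<in> mpoly.span ((\<lambda>m. Poly_Mapping.single m 1) ` B)"
proof -
  have "(\<Sum>m\<in>supp p. PConst (coef p m) * Poly_Mapping.single m 1)
      \<in> mpoly.span ((\<lambda>m. Poly_Mapping.single m 1) ` B)"
    using assms by (intro mpoly.span_sum mpoly.span_scale mpoly.span_base) auto
  then show ?thesis by (simp add: mult_single flip: poly_mapping_eq_sum_single)
qed

text \<open>The products of the four polynomials with exponents up to \<open>N\<close> number
  \<open>(N + 1) ^ 4\<close>, while they lie in a space whose dimension grows like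
  \<open>N ^ 3\<close>.\<close>

lemma four_alg_dependent:
  fixes w :: "nat \<Rightarrow> ('k::field) mpoly"
  assumes w: "\<And>i. i < 4 \<Longrightarrow> w i \<in> PR 3"
  shows "\<exists>Q\<in>PR 4. Q \<noteq> 0 \<and> psubst Q w = 0"
proof -
  obtain D' where D': "\<And>i. i < 4 \<Longrightarrow> supp (w i) \<subseteq> mon_box 3 (D' i)"
    using PR_mon_box[OF w] by metis
  define D where "D = Max (D' ` {..<4})"
  have D: "supp (w i) \<subseteq> mon_box 3 D" if "i < 4" for i
    using D'[OF that] mon_box_mono[of "D' i" D 3] that by (fastforce simp: D_def)
  \<comment> \<open>Chosen so that
    \<open>(4 * (N * D) + 1) ^ 3 \<le> N ^ 3 * (4 * D + 1) ^ 3 = N ^ 4\<close>, which is below the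
    number \<open>(N + 1) ^ 4\<close> of products.\<close>
  define N where "N = (4 * D + 1) ^ 3"
  let ?M = "mon_box 4 N" and ?B = "(\<lambda>m. Poly_Mapping.single m (1::'k)) ` mon_box 3 (4 * (N * D))"
  have span: "mon_eval w m \<in> mpoly.span ?B" if m: "m \<in> ?M" for m
  proof (rule in_span_mon_box)
    have m4: "supp m \<subseteq> {..<4}" and mN: "coef m i \<le> N" for i using m by (auto simp: mon_box_def)
    have "supp (mon_eval w m) \<subseteq> mon_box 3 (\<Sum>i\<in>supp m. coef m i * D)"
      unfolding mon_eval_def using m4 by (intro mon_box_prod mon_box_power D) auto
    also have "(\<Sum>i\<in>supp m. coef m i * D) \<le> (\<Sum>i\<in>{..<4::nat}. N * D)"
      using m4 mN by (intro order.trans[OF sum_mono2 sum_mono]) auto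
    then have "mon_box 3 (\<Sum>i\<in>supp m. coef m i * D) \<subseteq> mon_box 3 (4 * (N * D))"
      by (intro mon_box_mono) simp
    finally show "supp (mon_eval w m) \<subseteq> mon_box 3 (4 * (N * D))" .
  qed
  have N1: "1 \<le> N" by (simp add: N_def)
  have "4 * (N * D) + 1 \<le> N * (4 * D + 1)" using N1 by (simp add: algebra_simps)
  then have "(4 * (N * D) + 1) ^ 3 \<le> (N * (4 * D + 1)) ^ 3" by (rule power_mono) simp
  also have "\<dots> = N ^ 3 * N" unfolding power_mult_distrib by (simp add: N_def)
  also have "\<dots> = N ^ 4" by (simp add: power3_eq_cube power4_eq_xxxx)
  also have "\<dots> < (N + 1) ^ 4" by (rule power_strict_mono) auto
  finally have card: "card (mon_box 3 (4 * (N * D))) < card ?M" by (simp add: mon_box_card)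
  have single4: "Poly_Mapping.single m c \<in> PR 4" if "m \<in> ?M" for m and c :: 'k
    using that by (intro PR_single) (auto simp: mon_box_def)
  show ?thesis
  \<comment> \<open>Linear dependence speaks of sets, so two exponent vectors with the same value
    are treated apart: their difference is already a relation.\<close>
  proof (cases "inj_on (mon_eval w) ?M")
    case False
    then obtain m m' where m: "m \<in> ?M" "m' \<in> ?M" "m \<noteq> m'" "mon_eval w m = mon_eval w m'"
      by (auto simp: inj_on_def)
    let ?Q = "Poly_Mapping.single m (1::'k) - Poly_Mapping.single m' 1"
    have "coef ?Q m = 1" using m by (simp add: lookup_minus lookup_single)
    then have "?Q \<noteq> 0" by auto
    moreover have "psubst ?Q w = 0"
      using m by (simp add: psubst.hom_minus psubst_single)
    ultimately show ?thesis using single4 m by (auto intro!: bexI[of _ ?Q] PR_diff)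
  next
    case True
    let ?A = "mon_eval w ` ?M"
    have "finite ?A" by (simp add: mon_box_card)
    have "mpoly.dependent ?A"
    proof (rule ccontr)
      assume "mpoly.independent ?A"
      then have "card ?A \<le> card ?B"
        using mpoly.independent_span_bound[of ?B ?A] span by (auto simp: mon_box_card)
      also have "\<dots> \<le> card (mon_box 3 (4 * (N * D)))" by (rule card_image_le) (simp add: mon_box_card)
      finally show False using card True by (simp add: card_image)
    qed
    then obtain u v where u: "v \<in> ?A" "u v \<noteq> 0" "(\<Sum>v\<in>?A. PConst (u v) * v) = 0"
      using mpoly.dependent_finite[OF \<open>finite ?A\<close>] by blast
    define Q where "Q = (\<Sum>m\<in>?M. Poly_Mapping.single m (u (mon_eval w m)))"
    obtain m where m: "m \<in> ?M" "v = mon_eval w m" using u by auto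
    have "coef Q m = (\<Sum>m'\<in>?M. if m' = m then u (mon_eval w m') else 0)"
      unfolding Q_def lookup_sum by (rule sum.cong) (auto simp: lookup_single when_def)
    with m u have "coef Q m \<noteq> 0" by (simp add: mon_box_card)
    then have "Q \<noteq> 0" by auto
    moreover have "psubst Q w = 0"
      using u(3) True by (simp add: Q_def psubst.hom_sum psubst_single sum.reindex)
    moreover have "Q \<in> PR 4" unfolding Q_def by (intro PR_sum single4)
    ultimately show ?thesis by blast
  qed
qed

lemma alg_indep_le_3:
  assumes "alg_indep r w P" "\<And>i. i < r \<Longrightarrow> w i \<in> PR 3" "0 \<in> P"
  shows "r \<le> 3"
proof (rule ccontr)
  assume "\<not> r \<le> 3"
  then have "4 \<le> r" by simp
  then obtain Q where "Q \<in> PR 4" "Q \<noteq> 0" "psubst Q w = 0"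
    using four_alg_dependent[of w] assms(2) by force
  with assms PR_mono[OF \<open>4 \<le> r\<close>] show False by (auto simp: alg_indep_def)
qed

text \<open>The number of elements independent modulo the top prime plus the length of the chain is
  at most three. With \<open>s = 0\<close> this bounds dimensions, with \<open>s > 0\<close> the
  height of a prime modulo which \<open>s\<close> elements are independent.\<close>

lemma prime_chain_bound:
  assumes S: "subalg 3 S" and C: "prime_chain ((polyring 3)\<lparr>carrier := S\<rparr>) r C"
    and w: "\<And>i. i < s \<Longrightarrow> w i \<in> S" and ind: "alg_indep s w (C r)"
  shows "s + r \<le> 3"
proof -
  let ?A = "(polyring 3)\<lparr>carrier := S\<rparr>"
  obtain w' where w': "\<And>i. i < s + r \<Longrightarrow> w' i \<in> S" "alg_indep (s + r) w' (C 0)"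
    using prime_chain_alg_indep[OF S C w ind] by blast
  have "primeideal (C 0) ?A" using C by (simp add: prime_chain_def)
  then interpret primeideal "C 0" ?A .
  have "0 \<in> C 0" using additive_subgroup.zero_closed[OF additive_subgroup_axioms] by simp
  with w' S show ?thesis by (intro alg_indep_le_3[of _ w' "C 0"]) (auto simp: subalg_def)
qed

section \<open>Prime ideals and height\<close>

lemma cring_subalg:
  assumes "subalg n S"
  shows "cring ((polyring n)\<lparr>carrier := S\<rparr>)"
proof (intro cringI abelian_groupI comm_monoidI)
  let ?A = "(polyring n)\<lparr>carrier := S\<rparr>"
  have 0: "PConst c \<in> S" for c using assms by (auto simp: subalg_def)
  from 0[of 0] 0[of 1] have 01: "0 \<in> S" "1 \<in> S" by simp_all
  show "\<exists>y\<in>carrier ?A. y \<oplus>\<^bsub>?A\<^esub> x = \<zero>\<^bsub>?A\<^esub>" if "x \<in> carrier ?A" for x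
    using that assms 0[of "- 1"] by (intro bexI[of _ "PConst (- 1) * x"])
      (auto simp: subalg_def PConst_minus_one)
qed (use subalgD[OF assms] in \<open>auto simp: algebra_simps\<close>)

lemma polyring_update [simp]: "(polyring n)\<lparr>carrier := PR n\<rparr> = polyring n"
  by simp

lemma cring_polyring: "cring (polyring n)"
  using cring_subalg[OF subalg_PR] by simp

lemma subalg_idealI:
  assumes S: "subalg n S" and P: "P \<subseteq> S" "0 \<in> P" "\<And>a b. a \<in> P \<Longrightarrow> b \<in> P \<Longrightarrow> a + b \<in> P"
    and mult: "\<And>s a. s \<in> S \<Longrightarrow> a \<in> P \<Longrightarrow> s * a \<in> P"
  shows "ideal P ((polyring n)\<lparr>carrier := S\<rparr>)"
proof -
  let ?A = "(polyring n)\<lparr>carrier := S\<rparr>"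
  interpret A: cring ?A by (rule cring_subalg[OF S])
  have c: "PConst c \<in> S" for c using S by (auto simp: subalg_def)
  have "subgroup P (add_monoid ?A)"
  proof (rule group.subgroupI[OF A.a_group])
    fix a assume a: "a \<in> P"
    have "inv\<^bsub>add_monoid ?A\<^esub> a = PConst (- 1) * a"
      using a P mult[OF c[of "- 1"] a]
      by (intro group.inv_equality[OF A.a_group]) (auto simp: PConst_minus_one)
    then show "inv\<^bsub>add_monoid ?A\<^esub> a \<in> P" using mult[OF c a] by metis
  qed (use P in auto)
  then show "ideal P ?A"
  proof (intro idealI A.ring_axioms)
    show "x \<otimes>\<^bsub>?A\<^esub> a \<in> P" "a \<otimes>\<^bsub>?A\<^esub> x \<in> P" if "a \<in> P" "x \<in> carrier ?A" for a x
      using mult[of x a] that by (simp_all add: mult.commute)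
  qed
qed

lemma PR_idealI:
  assumes "P \<subseteq> PR n" "0 \<in> P" "\<And>a b. a \<in> P \<Longrightarrow> b \<in> P \<Longrightarrow> a + b \<in> P"
    "\<And>s a. s \<in> PR n \<Longrightarrow> a \<in> P \<Longrightarrow> s * a \<in> P"
  shows "ideal P (polyring n)"
  using subalg_idealI[OF subalg_PR assms] by simp

lemma subalg_primeidealI:
  assumes S: "subalg n S" and P: "P \<subseteq> S" "0 \<in> P" "\<And>a b. a \<in> P \<Longrightarrow> b \<in> P \<Longrightarrow> a + b \<in> P"
    and mult: "\<And>s a. s \<in> S \<Longrightarrow> a \<in> P \<Longrightarrow> s * a \<in> P" and one: "1 \<notin> P"
    and prime: "\<And>a b. a \<in> S \<Longrightarrow> b \<in> S \<Longrightarrow> a * b \<in> P \<Longrightarrow> a \<in> P \<or> b \<in> P"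
  shows "primeideal P ((polyring n)\<lparr>carrier := S\<rparr>)"
proof (rule primeidealI)
  show "ideal P ((polyring n)\<lparr>carrier := S\<rparr>)" by (rule subalg_idealI[OF S P mult])
  show "carrier ((polyring n)\<lparr>carrier := S\<rparr>) \<noteq> P" using subalgD(3)[OF S] one by auto
qed (use cring_subalg[OF S] prime in auto)

text \<open>The map is a homomorphism on \<open>S\<close> only. This matters for the lowest weight
  part in \<open>fiber_ring_chain\<close>, whose multiplicativity relies on the weights being
  nonnegative on the fiber ring.\<close>

lemma kernel_primeideal:
  fixes h :: "('k::field) mpoly \<Rightarrow> 'b::idom"
  assumes S: "subalg n S" and h: "\<And>a b. a \<in> S \<Longrightarrow> b \<in> S \<Longrightarrow> h (a + b) = h a + h b"
    "\<And>a b. a \<in> S \<Longrightarrow> b \<in> S \<Longrightarrow> h (a * b) = h a * h b" "h 0 = 0" "h 1 \<noteq> 0"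
  shows "primeideal {s \<in> S. h s = 0} ((polyring n)\<lparr>carrier := S\<rparr>)"
proof (rule subalg_primeidealI[OF S])
  show "0 \<in> {s \<in> S. h s = 0}" using subalgD[OF S] h by auto
qed (use S h in \<open>auto simp: subalg_def\<close>)

lemma psubst_kernel_primeideal: "primeideal {p \<in> PR n. psubst p g = 0} (polyring n)"
  using kernel_primeideal[OF subalg_PR, where h = "\<lambda>p. psubst p g"]
  by (simp add: psubst.hom_add psubst.hom_mult)

lemma prime_chain_suffix:
  assumes "prime_chain A n C" "h \<le> n"
  shows "prime_chain A h (\<lambda>i. C (i + (n - h)))"
proof -
  have "C (i + (n - h)) \<subset> C (Suc i + (n - h))" if "i < h" for i
    using assms that by (simp add: prime_chain_def del: psubset_eq)
  moreover have "primeideal (C (i + (n - h))) A" if "i \<le> h" for i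
    using assms that by (auto simp: prime_chain_def)
  ultimately show ?thesis by (auto simp: prime_chain_def)
qed

lemma ideal_height_chain:
  assumes "ideal_height A I = enat h" "primeideal P A" "I \<subseteq> P"
  shows "\<exists>C. prime_chain A h C \<and> C h = P"
proof -
  let ?X = "{enat n | n. \<exists>C. prime_chain A n C \<and> C n = P}"
  have "enat h \<le> Sup ?X"
    using assms unfolding ideal_height_def prime_height_def
    by (metis (mono_tags, lifting) Inf_lower mem_Collect_eq)
  \<comment> \<open>The supremum may be infinite, so first a chain of length at least
    \<open>h\<close> is found; \<open>prime_chain_suffix\<close> then drops its lowest primes and
    keeps \<open>P\<close> on top.\<close>
  have "\<exists>n\<ge>h. \<exists>C. prime_chain A n C \<and> C n = P"
  proof (rule ccontr)
    assume neg: "\<not> ?thesis"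
    have "\<exists>C. prime_chain A 0 C \<and> C 0 = P"
      using assms(2) by (intro exI[of _ "\<lambda>_. P"]) (simp add: prime_chain_def)
    with neg have "0 < h" by (metis gr0I le_refl)
    have "Sup ?X \<le> enat (h - 1)"
    proof (rule Sup_least)
      fix x assume "x \<in> ?X"
      then obtain n C where "x = enat n" "prime_chain A n C \<and> C n = P" by blast
      with neg have "x = enat n" "\<not> h \<le> n" by blast+
      then show "x \<le> enat (h - 1)" by simp
    qed
    with \<open>enat h \<le> Sup ?X\<close> have "enat h \<le> enat (h - 1)" by (rule order.trans)
    with \<open>0 < h\<close> show False by simp
  qed
  then obtain n C where "h \<le> n" "prime_chain A n C" "C n = P" by auto
  then show ?thesis
    using prime_chain_suffix[of A n C h] by (intro exI[of _ "\<lambda>i. C (i + (n - h))"]) auto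
qed

lemma prime_chain_bound_PR:
  "prime_chain (polyring 3) r C \<Longrightarrow> (\<And>i. i < s \<Longrightarrow> w i \<in> PR 3) \<Longrightarrow> alg_indep s w (C r) \<Longrightarrow> s + r \<le> 3"
  using prime_chain_bound[OF subalg_PR, of r C s w] by simp

section \<open>Unique factorization\<close>

text \<open>Induction on the factorization of \<open>a\<close>: each prime factor misses some
  \<open>f j\<close>, hence divides \<open>w\<close>, and is cancelled on both sides.\<close>

lemma ufd_dvd_of_coprime_family:
  fixes a w :: "'a::ufd"
  assumes "a \<noteq> 0" and fw: "\<And>j. j \<in> J \<Longrightarrow> a dvd f j * w"
    and prime: "\<And>p. prime_elem p \<Longrightarrow> \<exists>j\<in>J. \<not> p dvd f j"
  shows "a dvd w"
proof (cases "a dvd 1")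
  case True
  then show ?thesis by (rule dvd_trans) simp
next
  case False
  then obtain F where F: "mset_factors F a" using mset_factors_exist[OF \<open>a \<noteq> 0\<close>] by blast
  have "(\<forall>p\<in>#F. irreducible p) \<Longrightarrow> (\<forall>j\<in>J. prod_mset F dvd f j * w) \<Longrightarrow> prod_mset F dvd w"
  proof (induction F arbitrary: w)
    case (add p F)
    from add.prems have p: "prime_elem p" by simp
    from prime[OF p] obtain j where j: "j \<in> J" "\<not> p dvd f j" by auto
    have "p dvd f j * w" using add.prems(2) j by (auto intro: dvd_trans[of p "p * prod_mset F"])
    with p j obtain w' where w': "w = p * w'" by (auto simp: prime_elem_dvd_mult_iff)
    have "prod_mset F dvd w'"
    proof (rule add.IH)
      have "p \<noteq> 0" using p by auto
      then show "\<forall>j\<in>J. prod_mset F dvd f j * w'"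
        using add.prems(2) by (auto simp: w' mult.left_commute)
    qed (use add.prems in auto)
    then show ?case by (simp add: w' mult_dvd_mono)
  qed simp
  with F fw show ?thesis by (auto simp: mset_factors_def)
qed

type_synonym 'k poly3 = "'k poly poly poly"

text \<open>Factoriality is transported: iterated univariate polynomials over a field form a
  \<open>ufd\<close>, whereas \<open>PR 3\<close> is a set inside a type with infinitely many
  variables. The innermost variable is \<open>pvar 0\<close>, the outermost
  \<open>pvar 2\<close>.\<close>

definition to_poly3 :: "('k::field) mpoly \<Rightarrow> 'k poly3" where
  "to_poly3 = aeval (\<lambda>c. [:[:[:c:]:]:])
     (\<lambda>i. if i = 0 then [:[:[:0, 1:]:]:] else if i = 1 then [:[:0, 1:]:] else [:0, 1:])"

abbreviation poly_eval :: "('a::comm_ring_1 \<Rightarrow> 'b::comm_ring_1) \<Rightarrow> 'b \<Rightarrow> 'a poly \<Rightarrow> 'b" where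
  "poly_eval h x p \<equiv> poly (map_poly h p) x"

definition of_poly1 :: "('k::field) poly \<Rightarrow> 'k mpoly" where
  "of_poly1 = poly_eval PConst (pvar 0)"
definition of_poly2 :: "('k::field) poly poly \<Rightarrow> 'k mpoly" where
  "of_poly2 = poly_eval of_poly1 (pvar (Suc 0))"
definition of_poly3 :: "('k::field) poly3 \<Rightarrow> 'k mpoly" where
  "of_poly3 = poly_eval of_poly2 (pvar 2)"

lemma comm_ring_hom_poly_eval:
  assumes "comm_ring_hom h"
  shows "comm_ring_hom (poly_eval h x)"
proof -
  interpret h: comm_ring_hom h by fact
  interpret mp: map_poly_comm_ring_hom h ..
  show ?thesis by unfold_locales (simp_all add: mp.hom_add mp.hom_mult)
qed

lemma coeff_hom_poly3: "coeff_hom (\<lambda>c::'k::field. [:[:[:c:]:]:])"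
  by unfold_locales simp_all

interpretation to_poly3: comm_ring_hom "to_poly3 :: ('k::field) mpoly \<Rightarrow> 'k poly3"
  unfolding to_poly3_def by (rule coeff_hom.comm_ring_hom_aeval[OF coeff_hom_poly3])

interpretation of_poly1: comm_ring_hom "of_poly1 :: ('k::field) poly \<Rightarrow> _"
  unfolding of_poly1_def
  using coeff_hom_PConst by (intro comm_ring_hom_poly_eval) (simp add: coeff_hom_def)

interpretation of_poly2: comm_ring_hom "of_poly2 :: ('k::field) poly poly \<Rightarrow> _"
  unfolding of_poly2_def by (intro comm_ring_hom_poly_eval of_poly1.comm_ring_hom_axioms)

interpretation of_poly3: comm_ring_hom "of_poly3 :: ('k::field) poly3 \<Rightarrow> _"
  unfolding of_poly3_def by (intro comm_ring_hom_poly_eval of_poly2.comm_ring_hom_axioms)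

lemma of_poly1_pCons: "of_poly1 (pCons a p) = PConst a + pvar 0 * of_poly1 p"
  by (simp add: of_poly1_def Polynomial.map_poly_pCons)
lemma of_poly2_pCons: "of_poly2 (pCons a p) = of_poly1 a + pvar (Suc 0) * of_poly2 p"
  by (simp add: of_poly2_def Polynomial.map_poly_pCons)
lemma of_poly3_pCons: "of_poly3 (pCons a p) = of_poly2 a + pvar 2 * of_poly3 p"
  by (simp add: of_poly3_def Polynomial.map_poly_pCons)

lemma of_poly1_PR: "of_poly1 p \<in> PR 3"
  by (induction p) (auto simp: of_poly1_pCons intro!: PR_intros)
lemma of_poly2_PR: "of_poly2 p \<in> PR 3"
  by (induction p) (auto simp: of_poly2_pCons intro!: PR_intros of_poly1_PR)
lemma of_poly3_PR: "of_poly3 p \<in> PR 3"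
  by (induction p) (auto simp: of_poly3_pCons intro!: PR_intros of_poly2_PR)

lemma to_poly3_PConst: "to_poly3 (PConst c) = [:[:[:c:]:]:]"
  by (simp add: to_poly3_def coeff_hom.aeval_PConst[OF coeff_hom_poly3])

lemma to_poly3_pvar: "to_poly3 (pvar 0) = [:[:[:0, 1:]:]:]" "to_poly3 (pvar (Suc 0)) = [:[:0, 1:]:]"
    "to_poly3 (pvar 2) = [:0, 1:]"
  by (simp_all add: to_poly3_def coeff_hom.aeval_pvar[OF coeff_hom_poly3])

lemma to_of_poly3 [simp]: "to_poly3 (of_poly3 r) = r"
proof -
  have 1: "to_poly3 (of_poly1 p) = [:[:p:]:]" for p :: "'a poly"
  proof (induction p)
    case (pCons a p)
    then show ?case
      by (simp add: of_poly1_pCons to_poly3.hom_add to_poly3.hom_mult to_poly3_PConst to_poly3_pvar)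
  qed simp
  have 2: "to_poly3 (of_poly2 p) = [:p:]" for p :: "'a poly poly"
  proof (induction p)
    case (pCons a p)
    then show ?case
      by (simp add: of_poly2_pCons to_poly3.hom_add to_poly3.hom_mult 1 to_poly3_pvar)
  qed simp
  show ?thesis
  proof (induction r)
    case (pCons a p)
    then show ?case
      by (simp add: of_poly3_pCons to_poly3.hom_add to_poly3.hom_mult 2 to_poly3_pvar)
  qed simp
qed

lemma of_to_poly3: "p \<in> PR 3 \<Longrightarrow> of_poly3 (to_poly3 p) = p"
proof (induction p rule: PR_induct)
  case (const c)
  show ?case by (simp add: to_poly3_PConst of_poly3_pCons of_poly2_pCons of_poly1_pCons)
next
  case (var i)
  then consider "i = 0" | "i = 1" | "i = 2" by linarith
  then show ?case
    by cases (simp_all add: to_poly3_pvar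
        of_poly3_pCons of_poly2_pCons of_poly1_pCons)
qed (simp_all add: to_poly3.hom_add to_poly3.hom_mult of_poly3.hom_add of_poly3.hom_mult)

lemma dvd_poly3_iff:
  assumes "p \<in> PR 3"
  shows "g dvd to_poly3 p \<longleftrightarrow> (\<exists>v\<in>PR 3. p = of_poly3 g * v)"
proof
  assume "g dvd to_poly3 p"
  then obtain v where "to_poly3 p = g * v" by (elim dvdE)
  then have "p = of_poly3 g * of_poly3 v"
    using of_to_poly3[OF assms] by (simp add: of_poly3.hom_mult)
  then show "\<exists>v\<in>PR 3. p = of_poly3 g * v" using of_poly3_PR by auto
qed (auto simp: to_poly3.hom_mult)

lemma principal_prime:
  fixes g :: "('k::field) poly3"
  assumes "prime_elem g"
  shows "primeideal {p \<in> PR 3. g dvd to_poly3 p} (polyring 3)"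
proof -
  have "primeideal {p \<in> PR 3. g dvd to_poly3 p} ((polyring 3)\<lparr>carrier := PR 3\<rparr>)"
    using assms
    by (intro subalg_primeidealI subalg_PR)
      (auto simp: to_poly3.hom_add to_poly3.hom_mult prime_elem_dvd_mult_iff intro: PR_intros
        dest: prime_elem_not_unit)
  then show ?thesis by simp
qed

text \<open>Descent on leading monomials: a prime strictly inside \<open>(g)\<close> would contain, with every
  element, its quotient by \<open>g\<close>.\<close>

lemma principal_prime_chain:
  fixes g :: "('k::field) poly3"
  assumes g: "prime_elem g" and C: "prime_chain (polyring 3) r C"
    and Cr: "C r = {p \<in> PR 3. g dvd to_poly3 p}"
  shows "r \<le> 1"
proof (rule ccontr)
  assume "\<not> r \<le> 1"
  then obtain t where r: "r = Suc (Suc t)" by (metis One_nat_def Suc_le_mono le0 not0_implies_Suc)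
  let ?Q = "C (Suc t)"
  have Q: "primeideal ?Q (polyring 3)" "?Q \<subset> C r" and Ct: "C t \<subset> ?Q" "primeideal (C t) (polyring 3)"
    using C by (simp_all add: prime_chain_def r)
  \<comment> \<open>The prime strictly below \<open>?Q\<close> shows that \<open>?Q\<close> is
    nonzero.\<close>
  have "0 \<in> C t"
    using Ct(2) additive_subgroup.zero_closed[of "C t" "polyring 3"]
    by (simp add: primeideal_def ideal_def)
  moreover obtain q where "q \<in> ?Q" "q \<notin> C t" using psubset_imp_ex_mem[OF Ct(1)] by auto
  ultimately have Q0: "\<exists>q\<in>?Q. q \<noteq> 0" by metis
  let ?g = "of_poly3 g"
  interpret Q: primeideal ?Q "polyring 3" by fact
  have gC: "?g \<in> C r" by (simp add: Cr of_poly3_PR)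
  have "?g \<notin> ?Q"
  proof
    assume "?g \<in> ?Q"
    then have "?g * v \<in> ?Q" if "v \<in> PR 3" for v using Q.I_r_closed that by simp
    then have "C r \<subseteq> ?Q" by (auto simp: Cr dvd_poly3_iff)
    with Q show False by auto
  qed
  have "g \<noteq> 0" using g unfolding prime_elem_def by blast
  then have g0: "?g \<noteq> 0" by (metis to_of_poly3 to_poly3.hom_zero)
  \<comment> \<open>A constant leading monomial would make \<open>g\<close> a unit; so division by
    \<open>?g\<close> lowers the degree of the leading monomial and the descent terminates.\<close>
  have lm0: "lm ?g \<noteq> 0"
  proof
    assume "lm ?g = 0"
    then have e: "?g = PConst (coef ?g 0)" by (rule lm_eq_0)
    with g0 have "coef ?g 0 \<noteq> 0" by auto
    then have "PConst (inverse (coef ?g 0)) * ?g = 1"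
      by (subst (2) e) (simp add: mult_single)
    then have "to_poly3 (PConst (inverse (coef ?g 0))) * g = 1"
      using to_of_poly3[of g] by (metis to_poly3.hom_mult to_poly3.hom_one)
    then have "g dvd 1" by (metis dvd_triv_right)
    with g show False by (auto dest: prime_elem_not_unit)
  qed
  have "\<forall>q\<in>?Q. tdeg (lm q) = N \<longrightarrow> q = 0" for N
  proof (induction N rule: less_induct)
    case (less N)
    show ?case
    proof (intro ballI impI, rule ccontr)
      fix q assume q: "q \<in> ?Q" "tdeg (lm q) = N" "q \<noteq> 0"
      then have "q \<in> PR 3" "g dvd to_poly3 q" using Q(2) by (auto simp: Cr)
      then obtain v where v: "v \<in> PR 3" "q = ?g * v" by (auto simp: dvd_poly3_iff)
      with q Q.I_prime[of ?g v] \<open>?g \<notin> ?Q\<close> have "v \<in> ?Q" by (auto simp: of_poly3_PR)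
      moreover have "lm q = lm ?g + lm v" using v q g0 by (intro lm_mult[of ?g v, folded v(2)]) auto
      then have "tdeg (lm v) < N"
        using q lm0 tdeg_eq_0_iff[of "lm ?g"] by (simp add: tdeg_add)
      ultimately have "v = 0" using less.IH by blast
      with v q show False by simp
    qed
  qed
  with Q0 show False by blast
qed

text \<open>A prime element dividing every \<open>f j\<close> would put the ideal into a principal
  prime, which has no chain of length two below it. So the family has no common prime
  factor.\<close>

lemma height_two_dvd:
  fixes f :: "'i \<Rightarrow> ('k::field) mpoly"
  assumes f: "\<And>j. j \<in> J \<Longrightarrow> f j \<in> PR 3"
    and ht: "ideal_height (polyring 3) (Idl\<^bsub>polyring 3\<^esub> (f ` J)) = 2"
    and a: "a \<in> PR 3" "a \<noteq> 0" and w: "w \<in> PR 3"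
    and fw: "\<And>j. j \<in> J \<Longrightarrow> \<exists>v\<in>PR 3. f j * w = a * v"
  shows "\<exists>v\<in>PR 3. w = a * v"
proof -
  interpret R: cring "polyring 3" by (rule cring_polyring)
  have "to_poly3 a dvd to_poly3 w"
  proof (rule ufd_dvd_of_coprime_family)
    show "to_poly3 a \<noteq> 0" using of_to_poly3[OF a(1)] a(2) by auto
    show "to_poly3 a dvd to_poly3 (f j) * to_poly3 w" if "j \<in> J" for j
    proof -
      obtain v where "f j * w = a * v" using fw \<open>j \<in> J\<close> by blast
      then have "to_poly3 (f j) * to_poly3 w = to_poly3 a * to_poly3 v"
        by (metis to_poly3.hom_mult)
      then show ?thesis by simp
    qed
    fix g :: "'k poly3" assume g: "prime_elem g"
    show "\<exists>j\<in>J. \<not> g dvd to_poly3 (f j)"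
    proof (rule ccontr)
      assume neg: "\<not> ?thesis"
      let ?P = "{p \<in> PR 3. g dvd to_poly3 p}"
      have P: "primeideal ?P (polyring 3)" by (rule principal_prime[OF g])
      then have sub: "Idl\<^bsub>polyring 3\<^esub> (f ` J) \<subseteq> ?P"
        using neg f by (intro R.genideal_minimal) (auto simp: primeideal_def)
      have "ideal_height (polyring 3) (Idl\<^bsub>polyring 3\<^esub> (f ` J)) = enat 2"
        by (simp add: ht numeral_eq_enat)
      from ideal_height_chain[OF this P sub]
      obtain C where "prime_chain (polyring 3) 2 C" "C 2 = ?P" by (elim exE conjE)
      from principal_prime_chain[OF g this] show False by simp
    qed
  qed
  then obtain v where "to_poly3 w = to_poly3 a * v" by (elim dvdE)
  then have "w = a * of_poly3 v"
    using of_to_poly3 a w by (metis of_poly3.hom_mult)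
  then show ?thesis using of_poly3_PR by blast
qed

section \<open>Leading monomials and proportionality\<close>

lemma lm_power: "(p::('k::field) mpoly) \<noteq> 0 \<Longrightarrow> coef (lm (p ^ e)) i = e * coef (lm p) i"
proof (induction e)
  case 0
  have "lm (1::'k mpoly) = 0" by (rule lm_eqI) auto
  then show ?case by simp
qed (simp add: lm_mult lookup_add)

lemma lm_PConst_mult: "c \<noteq> 0 \<Longrightarrow> p \<noteq> 0 \<Longrightarrow> lm (PConst c * p) = lm p"
proof -
  assume "c \<noteq> 0" "p \<noteq> 0"
  moreover have "lm (PConst c) = 0" by (rule lm_eqI) (use \<open>c \<noteq> 0\<close> in auto)
  moreover have "PConst c \<noteq> 0" using \<open>c \<noteq> 0\<close> by (metis lookup_single_eq lookup_zero)
  ultimately show ?thesis by (simp add: lm_mult)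
qed

lemma PConst_eq_0_iff [simp]: "PConst c = 0 \<longleftrightarrow> c = 0"
  by (metis lookup_single_eq lookup_zero single_zero)

lemma coef_PConst_mult: "coef (PConst c * p) m = c * coef p m"
proof -
  have "PConst c * p = Poly_Mapping.map ((*) c) p" by (simp add: mult_map_scale_conv_mult)
  then show ?thesis by (simp add: map.rep_eq when_def)
qed

lemma coef_lm_nonzero: "p \<noteq> 0 \<Longrightarrow> coef p (lm p) \<noteq> 0"
  using lm_in by (simp add: in_keys_iff)

lemma lm_neqI: "coef p m = 0 \<Longrightarrow> p \<noteq> 0 \<Longrightarrow> lm p \<noteq> m"
  using coef_lm_nonzero by blast

text \<open>The largest of the leading monomials occurs in just one summand and cannot
  cancel.\<close>

lemma sum_distinct_lm_nonzero:
  assumes "finite A" "A \<noteq> {}" "\<And>i. i \<in> A \<Longrightarrow> g i \<noteq> 0" "inj_on (\<lambda>i. lm (g i)) A"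
  shows "sum g A \<noteq> 0"
proof -
  have "Max ((\<lambda>i. lm (g i)) ` A) \<in> (\<lambda>i. lm (g i)) ` A"
    by (rule Max_in) (use assms in auto)
  then obtain i where i: "i \<in> A" "lm (g i) = Max ((\<lambda>i. lm (g i)) ` A)" by (metis imageE)
  have "coef (g j) (lm (g i)) = 0" if "j \<in> A - {i}" for j
  proof -
    have "lm (g j) \<le> lm (g i)" unfolding i(2) using that assms by auto
    moreover have "lm (g j) \<noteq> lm (g i)" using inj_onD[OF assms(4), of j i] that i(1) by blast
    ultimately have "\<not> lm (g i) \<le> lm (g j)" by simp
    then show ?thesis using lm_ge[of "lm (g i)" "g j"] by (auto simp: in_keys_iff)
  qed
  then have "coef (sum g A) (lm (g i)) = coef (g i) (lm (g i))"
    using i(1) assms(1) by (simp add: lookup_add lookup_sum sum.remove[of A i])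
  then show ?thesis using coef_lm_nonzero[OF assms(3)[OF i(1)]] by auto
qed

lemma int_line_inject:
  fixes a a' b b' x y :: int
  assumes "a * x + a' * y = b * x + b' * y" "a + a' = b + b'"
  shows "(a - b) * (x - y) = 0"
proof -
  have "(a - b) * (x - y) = (a * x + a' * y) - (b * x + b' * y) - ((a + a') - (b + b')) * y"
    by (simp add: algebra_simps)
  then show ?thesis using assms by simp
qed

text \<open>Two non-proportional forms of the same degree have, after subtracting a multiple of one from
  the other, different leading monomials; then all monomials in them have different leading
  monomials.\<close>

lemma forms_lm_neq_independent:
  assumes u: "form_of_degree e u" "u \<noteq> 0" and v: "form_of_degree e v" "v \<noteq> 0" and "0 < e"
    and lm: "lm u \<noteq> lm v" and Q: "Q \<in> PR 2" "Q \<noteq> 0"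
  shows "psubst Q (\<lambda>i. if i = 0 then u else v) \<noteq> 0"
proof -
  let ?g = "\<lambda>i::nat. if i = 0 then u else v"
  let ?t = "\<lambda>m. PConst (coef Q m) * mon_eval ?g m"
  obtain i where i: "coef (lm u) i \<noteq> coef (lm v) i" using lm by (auto intro: poly_mapping_eqI)
  have tdeg: "tdeg (lm u) = e" "tdeg (lm v) = e" using u v lm_in by (auto simp: form_iff)
  have m: "mon_eval ?g m = u ^ coef m 0 * v ^ coef m 1" if "m \<in> supp Q" for m
    using that Q by (subst mon_eval_superset[of "{..<2}"]) (auto simp: PR_iff numeral_2_eq_2)
  have nz: "mon_eval ?g m \<noteq> 0" if "m \<in> supp Q" for m using u v by (simp add: m that)
  have lmt: "coef (lm (?t m)) j = coef m 0 * coef (lm u) j + coef m 1 * coef (lm v) j"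
    if "m \<in> supp Q" for m j
    using that u v nz[OF that] by (simp add: lm_PConst_mult in_keys_iff)
      (simp add: m that in_keys_iff lm_mult lookup_add lm_power)
  have tdt: "tdeg (lm (?t m)) = (coef m 0 + coef m 1) * e" if "m \<in> supp Q" for m
  proof -
    have "tdeg (lm (?t m)) = tdeg (lm (u ^ coef m 0)) + tdeg (lm (v ^ coef m 1))"
      using that u v nz[OF that] by (simp add: lm_PConst_mult in_keys_iff)
        (simp add: m that in_keys_iff lm_mult tdeg_add)
    moreover have "tdeg (lm (u ^ a)) = a * e" "tdeg (lm (v ^ a)) = a * e" for a
      using form_power[OF u(1), of a] form_power[OF v(1), of a] u v lm_in[of "u ^ a"] lm_in[of "v ^ a"]
      by (auto simp: form_iff)
    ultimately show ?thesis by (simp add: distrib_right)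
  qed
  have "inj_on (\<lambda>m. lm (?t m)) (supp Q)"
  proof (rule inj_onI)
    fix a b assume ab: "a \<in> supp Q" "b \<in> supp Q" "lm (?t a) = lm (?t b)"
    let ?x = "coef (lm u) i" and ?y = "coef (lm v) i"
    \<comment> \<open>Two equations for the two exponents: the total degree gives their sum, and the
      variable \<open>i\<close>, in which the leading monomials differ, gives an independent
      one.\<close>
    have s: "coef a 0 + coef a 1 = coef b 0 + coef b 1"
      using tdt[OF ab(1)] tdt[OF ab(2)] ab(3) \<open>0 < e\<close> by simp
    have "coef a 0 * ?x + coef a 1 * ?y = coef b 0 * ?x + coef b 1 * ?y"
      using lmt[OF ab(1), of i] lmt[OF ab(2), of i] ab(3) by simp
    from arg_cong[OF this, of int]
    have "int (coef a 0) * int ?x + int (coef a 1) * int ?y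
        = int (coef b 0) * int ?x + int (coef b 1) * int ?y"
      by (simp only: of_nat_add of_nat_mult)
    moreover have "int (coef a 0) + int (coef a 1) = int (coef b 0) + int (coef b 1)"
      using s by linarith
    ultimately have "(int (coef a 0) - int (coef b 0)) * (int ?x - int ?y) = 0"
      by (rule int_line_inject)
    then have a0: "coef a 0 = coef b 0" using i by simp
    with s have a1: "coef a 1 = coef b 1" by simp
    have sab: "supp a \<subseteq> {..<2}" "supp b \<subseteq> {..<2}" using ab Q by (auto simp: PR_iff)
    show "a = b"
    proof (rule poly_mapping_eqI)
      fix j
      consider "j = 0" | "j = 1" | "j \<notin> {..<2::nat}" by fastforce
      then show "coef a j = coef b j"
      proof cases
        case 3
        with sab have "j \<notin> supp a" "j \<notin> supp b" by blast+
        then show ?thesis by (simp add: in_keys_iff)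
      qed (use a0 a1 in simp_all)
    qed
  qed
  then have "sum ?t (supp Q) \<noteq> 0"
    using Q nz by (intro sum_distinct_lm_nonzero) (auto simp: in_keys_iff)
  then show ?thesis by (simp add: psubst_eq_sum)
qed

lemma forms_dependent_proportional:
  fixes u v :: "('k::field) mpoly"
  assumes u: "form_of_degree e u" and v: "form_of_degree e v" "v \<noteq> 0" and "0 < e"
    and Q: "Q \<in> PR 2" "Q \<noteq> 0" "psubst Q (\<lambda>i. if i = 0 then u else v) = 0"
  shows "\<exists>c. u = PConst c * v"
proof -
  define c where "c = coef u (lm v) / coef v (lm v)"
  define r where "r = u - PConst c * v"
  have "coef r (lm v) = 0"
    using coef_lm_nonzero[OF v(2)] by (simp add: r_def lookup_minus coef_PConst_mult c_def)
  have "r = 0"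
  proof (rule ccontr)
    assume "r \<noteq> 0"
    with \<open>coef r (lm v) = 0\<close> have lm: "lm r \<noteq> lm v" by (intro lm_neqI)
    have fr: "form_of_degree e r" unfolding r_def by (intro form_diff form_PConst_mult u v)
    \<comment> \<open>Passing from \<open>u\<close> to \<open>r\<close> is an invertible linear
      substitution in the relation, with inverse given by \<open>- c\<close>, so the new relation
      \<open>Q'\<close> is still nonzero.\<close>
    let ?s = "\<lambda>d i. if i = 0 then pvar 0 + PConst d * pvar 1 else pvar i :: 'k mpoly"
    define Q' where "Q' = psubst Q (?s c)"
    have Q': "Q' \<in> PR 2"
      unfolding Q'_def by (intro psubst_PR[OF Q(1)]) (auto intro!: PR_intros)
    have "psubst Q' (?s (- c)) = psubst Q pvar"
      unfolding Q'_def psubst_psubst[OF Q(1)]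
      by (rule psubst_cong[OF Q(1)])
        (auto simp: psubst.hom_add psubst.hom_mult single_uminus)
    then have "Q' \<noteq> 0" using Q(2) by auto
    moreover have "psubst Q' (\<lambda>i. if i = 0 then r else v) = psubst Q (\<lambda>i. if i = 0 then u else v)"
      unfolding Q'_def psubst_psubst[OF Q(1)]
      by (rule psubst_cong[OF Q(1)]) (auto simp: psubst.hom_add psubst.hom_mult r_def)
    ultimately show False
      using forms_lm_neq_independent[OF fr \<open>r \<noteq> 0\<close> v \<open>0 < e\<close> lm Q'] Q(3) by simp
  qed
  then show ?thesis by (auto simp: r_def)
qed

text \<open>This is \<open>p\<close> at the squares of the variables, not the square of
  \<open>p\<close>; it is additive in every characteristic and doubles exponent vectors.\<close>

abbreviation sq :: "('k::field) mpoly \<Rightarrow> 'k mpoly" where "sq p \<equiv> psubst p (\<lambda>l. pvar l ^ 2)"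

lemma sq_eq_sum: "sq p = (\<Sum>m\<in>supp p. Poly_Mapping.single (m + m) (coef p m))"
proof -
  have "mon_eval (\<lambda>l. pvar l ^ 2) m = Poly_Mapping.single (m + m) (1::'a)" for m
  proof -
    have "mon_eval (\<lambda>l. pvar l ^ 2 :: 'a mpoly) m = mon_eval pvar m * mon_eval pvar m"
      by (simp add: mon_eval_def power2_eq_square power_mult_distrib prod.distrib)
    moreover have "mon_eval pvar m = Poly_Mapping.single m (1::'a)"
      using single_eq_PConst_mult_mon_eval[of m "1::'a"] by simp
    ultimately show ?thesis by (simp add: mult_single)
  qed
  then show ?thesis by (simp add: psubst_eq_sum mult_single)
qed

lemma monomial_double_inject: "m + m = m' + (m' :: nat \<Rightarrow>\<^sub>0 nat) \<Longrightarrow> m = m'"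
proof (rule poly_mapping_eqI)
  fix i assume "m + m = m' + m'"
  then have "coef (m + m) i = coef (m' + m') i" by simp
  then show "coef m i = coef m' i" by (simp add: lookup_add)
qed

lemma coef_sq: "coef (sq p) (m + m) = coef p m"
proof -
  have "coef (sq p) (m + m) = (\<Sum>m'\<in>supp p. if m' = m then coef p m' else 0)"
    unfolding sq_eq_sum lookup_sum
    by (intro sum.cong) (auto simp: lookup_single when_def dest: monomial_double_inject)
  then show ?thesis by (simp add: in_keys_iff)
qed

lemma supp_sq: "supp (sq p) \<subseteq> (\<lambda>m. m + m) ` supp p"
proof
  fix x assume "x \<in> supp (sq p)"
  then have "(\<Sum>m\<in>supp p. coef (Poly_Mapping.single (m + m) (coef p m)) x) \<noteq> 0"
    by (simp add: in_keys_iff sq_eq_sum lookup_sum)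
  then obtain m where "m \<in> supp p" "coef (Poly_Mapping.single (m + m) (coef p m)) x \<noteq> 0"
    by (elim sum.not_neutral_contains_not_neutral)
  then show "x \<in> (\<lambda>m. m + m) ` supp p" by (auto simp: lookup_single when_def split: if_splits)
qed

lemma sq_eq_0_iff [simp]: "sq p = 0 \<longleftrightarrow> p = 0"
  by (metis coef_sq lookup_zero poly_mapping_eqI psubst.hom_zero)

lemma lm_sq: "p \<noteq> 0 \<Longrightarrow> lm (sq p) = lm p + lm p"
proof (rule lm_eqI)
  assume "p \<noteq> 0"
  then show "lm p + lm p \<in> supp (sq p)" using coef_lm_nonzero by (simp add: in_keys_iff coef_sq)
  fix m assume "m \<in> supp (sq p)"
  then show "m \<le> lm p + lm p" using supp_sq[of p] lm_ge by (force intro: add_mono)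
qed

text \<open>Subtracting a multiple of \<open>q\<close> clears the coefficient at
  \<open>lm q\<close>. If the difference \<open>r\<close> were nonzero, comparing leading monomials
  in \<open>r * sq q = q * sq r\<close> would give \<open>lm r = lm q\<close>.\<close>

lemma proportional_of_sq:
  fixes p q :: "('k::field) mpoly"
  assumes "p * sq q = q * sq p" "q \<noteq> 0"
  shows "\<exists>c. p = PConst c * q"
proof -
  define c where "c = coef p (lm q) / coef q (lm q)"
  define r where "r = p - PConst c * q"
  have r0: "coef r (lm q) = 0"
    using coef_lm_nonzero[OF assms(2)] by (simp add: r_def lookup_minus coef_PConst_mult c_def)
  have e: "r * sq q = q * sq r"
    using assms(1) by (simp add: r_def psubst.hom_minus psubst.hom_mult algebra_simps)
  have "r = 0"
  proof (rule ccontr)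
    assume "r \<noteq> 0"
    with e assms(2) have "lm r + (lm q + lm q) = lm q + (lm r + lm r)"
      by (metis lm_mult lm_sq sq_eq_0_iff)
    then have "lm r = lm q" by (metis add.assoc add.commute add_left_cancel)
    with r0 \<open>r \<noteq> 0\<close> show False using lm_neqI by blast
  qed
  then show ?thesis by (auto simp: r_def)
qed

lemma form_dvd_degree:
  assumes "form_of_degree a p" "form_of_degree b q" "p = q * v" "a < b"
  shows "p = 0"
proof (rule ccontr)
  assume "p \<noteq> 0"
  with assms have "q \<noteq> 0" "v \<noteq> 0" by auto
  with assms have "lm p = lm q + lm v" by (simp add: lm_mult)
  moreover have "tdeg (lm p) = a" "tdeg (lm q) = b"
    using assms(1,2) lm_in[OF \<open>p \<noteq> 0\<close>] lm_in[OF \<open>q \<noteq> 0\<close>] by (simp_all add: form_iff)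
  ultimately show False using \<open>a < b\<close> by (simp add: tdeg_add)
qed

lemma linear_form_eq:
  fixes p :: "('k::field) mpoly"
  assumes "p \<in> PR n" "form_of_degree 1 p"
  shows "p = (\<Sum>l<n. PConst (coef p (Poly_Mapping.single l 1)) * pvar l)"
proof (rule poly_mapping_eqI)
  fix m
  let ?s = "\<lambda>l. Poly_Mapping.single l (1::nat)"
  have *: "coef (\<Sum>l<n. PConst (coef p (?s l)) * pvar l) m
      = (\<Sum>l<n. coef p (?s l) * (1 when ?s l = m))"
    by (simp add: lookup_sum coef_PConst_mult pvar_def lookup_single)
  show "coef p m = coef (\<Sum>l<n. PConst (coef p (?s l)) * pvar l) m"
  proof (cases "\<exists>l<n. m = ?s l")
    case True
    then obtain l where l: "l < n" "m = ?s l" by auto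
    have "?s l' = ?s l \<longleftrightarrow> l' = l" for l'
      by (metis lookup_single_eq lookup_single_not_eq zero_neq_one)
    then have "(\<Sum>l'<n. coef p (?s l') * (1 when ?s l' = m)) = (\<Sum>l'<n. if l' = l then coef p (?s l') else 0)"
      unfolding l by (intro sum.cong) (auto simp: when_def)
    with l show ?thesis unfolding * by simp
  next
    case False
    have "m \<notin> supp p"
    proof
      assume m: "m \<in> supp p"
      with assms have t: "tdeg m = 1" and s: "supp m \<subseteq> {..<n}" by (auto simp: form_iff PR_iff)
      from t have "m \<noteq> 0" by auto
      then obtain l where l: "l \<in> supp m" by (metis ex_in_conv keys_eq_empty)
      then have "m = ?s l + (m - ?s l)"
        by (intro poly_mapping_eqI) (auto simp: lookup_add lookup_minus lookup_single when_def in_keys_iff)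
      then have "tdeg m = 1 + tdeg (m - ?s l)" by (metis tdeg_add tdeg_single)
      with t have "m - ?s l = 0" by (simp add: tdeg_eq_0_iff)
      with \<open>m = ?s l + (m - ?s l)\<close> have "m = ?s l" by simp
      with False l s show False by auto
    qed
    moreover have "(\<Sum>l<n. coef p (?s l) * (1 when ?s l = m)) = 0"
      using False by (intro sum.neutral) (auto simp: when_def)
    ultimately show ?thesis unfolding * by (simp add: in_keys_iff)
  qed
qed

section \<open>Linear Hilbert--Burch matrices\<close>

declare One_nat_def [simp del]

text \<open>Degrees are prescribed per column, since each Leibniz term takes one entry from every
  column. This covers the bordered matrix below, which has one column of constants.\<close>

lemma form_sum_degrees_det:
  fixes A :: "('k::field) mpoly mat"
  assumes A: "A \<in> carrier_mat m m"
    and e: "\<And>i j. i < m \<Longrightarrow> j < m \<Longrightarrow> A $$ (i, j) \<in> PR r \<and> form_of_degree (e j) (A $$ (i, j))"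
  shows "det A \<in> PR r" "form_of_degree (\<Sum>j<m. e j) (det A)"
proof -
  have perm: "p i < m" if "p permutes {0..<m}" "i < m" for p i
    using that permutes_in_image[of p "{0..<m}" i] by auto
  have s: "signof p \<in> {1, - 1 :: 'k mpoly}" for p by (simp add: sign_def)
  show "det A \<in> PR r"
    unfolding det_def'[OF A] using perm e s
    by (intro PR_sum PR_mult PR_prod) (auto simp: sign_def intro: PR_uminus)
  have sf: "form_of_degree 0 (signof p :: 'k mpoly)" for p
    by (simp add: sign_def form_uminus)
  show "form_of_degree (\<Sum>j<m. e j) (det A)"
    unfolding det_def'[OF A]
  proof (rule form_sum)
    fix p assume "p \<in> {p. p permutes {0..<m}}"
    then have p: "p permutes {0..<m}" by simp
    have "form_of_degree (\<Sum>i = 0..<m. e (p i)) (\<Prod>i = 0..<m. A $$ (i, p i))"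
      using perm[OF p] e by (intro form_prod) auto
    moreover have "(\<Sum>i = 0..<m. e (p i)) = (\<Sum>j<m. e j)"
      using sum.permute[OF p, of e] by (simp add: atLeast0LessThan)
    ultimately have "form_of_degree (\<Sum>j<m. e j) (\<Prod>i = 0..<m. A $$ (i, p i))" by simp
    from form_mult[OF sf[of p] this]
    show "form_of_degree (\<Sum>j<m. e j) (signof p * (\<Prod>i = 0..<m. A $$ (i, p i)))" by simp
  qed
qed

text \<open>The increasing enumeration of the indices other than \<open>i\<close>, as
  \<open>pick\<close> produces it on the complement of \<open>i\<close>.\<close>

definition skip :: "nat \<Rightarrow> nat \<Rightarrow> nat" where "skip i r = (if r < i then r else Suc r)"

lemma bij_betw_skip: "i < n \<Longrightarrow> bij_betw (skip i) {..<n - 1} ({..<n} - {i})"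
  by (rule bij_betwI[where g = "\<lambda>r. if r < i then r else r - 1"])
    (auto simp: skip_def split: if_splits)

lemma sum_skip: "i < n \<Longrightarrow> (\<Sum>r<n - 1. g (skip i r)) = sum g ({..<n} - {i})"
  using sum.reindex_bij_betw[OF bij_betw_skip] .

lemma pick_skip:
  assumes "i < n" "r < n - 1"
  shows "pick ({..<n} - {i}) r = skip i r"
proof -
  have "{a \<in> {..<n} - {i}. a < skip i r} = (if r < i then {..<r} else {..<Suc r} - {i})"
    using assms by (auto simp: skip_def)
  then have "card {a \<in> {..<n} - {i}. a < skip i r} = r"
    by (auto simp: card_Diff_singleton_if)
  moreover have "skip i r \<in> {..<n} - {i}" using assms by (auto simp: skip_def)
  ultimately show ?thesis using pick_card_in_set by metis
qed

lemma pick_lessThan: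
  assumes "c < m"
  shows "pick {..<m} c = c"
proof -
  have "{a \<in> {..<m}. a < c} = {..<c}" using assms by auto
  then have "card {a \<in> {..<m}. a < c} = c" by simp
  then show ?thesis using pick_card_in_set[of c "{..<m}"] assms by simp
qed

text \<open>Built from an entry function instead of a matrix, so that the same deletion applies
  after a substitution in the entries.\<close>

definition delrow :: "nat \<Rightarrow> nat \<Rightarrow> (nat \<Rightarrow> nat \<Rightarrow> 'a) \<Rightarrow> 'a mat" where
  "delrow n i M = mat (n - 1) (n - 1) (\<lambda>(r, c). M (skip i r) c)"

lemma delrow_carrier [simp]: "delrow n i M \<in> carrier_mat (n - 1) (n - 1)"
  by (simp add: delrow_def)

lemma delrow_dim [simp]: "dim_row (delrow n i M) = n - 1" "dim_col (delrow n i M) = n - 1"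
  by (simp_all add: delrow_def)

text \<open>Because \<open>u\<close> is zero at \<open>i\<close>, deleting row \<open>i\<close>
  leaves the relation between the rows intact, and \<open>u r0\<close> keeps it nontrivial.\<close>

lemma det_delrow_left_kernel:
  fixes M :: "nat \<Rightarrow> nat \<Rightarrow> 'a::idom"
  assumes u: "\<And>c. c < n - 1 \<Longrightarrow> (\<Sum>r<n. u r * M r c) = 0"
    and i: "i < n" "u i = 0" and r0: "r0 < n" "u r0 \<noteq> 0"
  shows "det (delrow n i M) = 0"
proof -
  let ?A = "transpose_mat (delrow n i M)" and ?v = "vec (n - 1) (\<lambda>r. u (skip i r))"
  have A: "?A \<in> carrier_mat (n - 1) (n - 1)" by simp
  have "?A *\<^sub>v ?v = 0\<^sub>v (n - 1)"
  proof (rule eq_vecI)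
    fix c assume "c < dim_vec (0\<^sub>v (n - 1))"
    then have c: "c < n - 1" by simp
    have "(?A *\<^sub>v ?v) $ c = (\<Sum>r<n - 1. M (skip i r) c * u (skip i r))"
      using c by (simp add: delrow_def scalar_prod_def atLeast0LessThan)
    also have "\<dots> = (\<Sum>r\<in>{..<n} - {i}. M r c * u r)"
      using sum_skip[OF i(1), of "\<lambda>r. M r c * u r"] .
    also have "\<dots> = (\<Sum>r<n. u r * M r c)"
      using i by (simp add: sum.remove[of "{..<n}" i] mult.commute)
    finally show "(?A *\<^sub>v ?v) $ c = 0\<^sub>v (n - 1) $ c" using u[OF c] c by simp
  qed simp
  moreover have "?v \<noteq> 0\<^sub>v (n - 1)"
  proof
    assume v: "?v = 0\<^sub>v (n - 1)"
    have "r0 \<in> skip i ` {..<n - 1}"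
      using bij_betw_skip[OF i(1)] i r0 by (auto simp: bij_betw_def)
    then obtain r where r: "r < n - 1" "r0 = skip i r" by auto
    then have "u r0 = ?v $ r" by simp
    also have "\<dots> = 0" unfolding v using r by simp
    finally show False using r0 by simp
  qed
  ultimately have "det ?A = 0"
    using det_0_iff_vec_prod_zero[OF A] vec_carrier by blast
  then show ?thesis using det_transpose[of "delrow n i M" "n - 1"] by simp
qed

text \<open>Full column rank, read off from a single nonzero maximal minor.\<close>

lemma det_delrow_right_kernel:
  fixes M :: "nat \<Rightarrow> nat \<Rightarrow> 'a::idom"
  assumes det: "det (delrow n i M) \<noteq> 0" and "i < n"
    and u: "\<And>r. r < n \<Longrightarrow> (\<Sum>c<n - 1. M r c * u c) = 0" and c: "c < n - 1"
  shows "u c = 0"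
proof (rule ccontr)
  assume "u c \<noteq> 0"
  let ?v = "vec (n - 1) u"
  have "delrow n i M *\<^sub>v ?v = 0\<^sub>v (n - 1)"
  proof (rule eq_vecI)
    fix r assume "r < dim_vec (0\<^sub>v (n - 1))"
    then have r: "r < n - 1" by simp
    then have "skip i r < n" by (auto simp: skip_def)
    then show "(delrow n i M *\<^sub>v ?v) $ r = 0\<^sub>v (n - 1) $ r"
      using u[of "skip i r"] r by (simp add: delrow_def scalar_prod_def atLeast0LessThan)
  qed (simp add: delrow_def)
  moreover have "?v \<noteq> 0\<^sub>v (n - 1)"
    using \<open>u c \<noteq> 0\<close> c by (metis index_vec index_zero_vec(1))
  ultimately show False
    using det det_0_iff_vec_prod_zero[OF delrow_carrier[of n i M]] vec_carrier by blast
qed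

abbreviation sg :: "nat \<Rightarrow> ('k::field) mpoly" where "sg i \<equiv> (- 1) ^ i"

lemma sg_sq [simp]: "sg i * (sg i * p) = p"
  by (metis left_minus_one_mult_self)

lemma sg_PConst: "sg i = PConst ((- 1) ^ i)"
proof (induction i)
  case (Suc i)
  have "PConst ((- 1) ^ Suc i :: 'a) = PConst (- 1) * PConst ((- 1) ^ i)" by (simp add: mult_single)
  with Suc show ?case by (simp add: PConst_minus_one)
qed simp

lemma psubst_sg [simp]: "psubst (sg i) g = sg i"
  by (simp add: sg_PConst)

lemma form_sg_mult: "form_of_degree d p \<Longrightarrow> form_of_degree d (sg i * p)"
  by (simp add: sg_PConst form_PConst_mult)

lemma PR_sg [simp]: "sg i \<in> PR r" by (simp add: sg_PConst)

locale hb =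
  fixes n :: nat and \<phi> :: "('k::field) mpoly mat"
  assumes dims: "\<phi> \<in> carrier_mat n (n - 1)"
    and linear: "\<And>i j. i < n \<Longrightarrow> j < n - 1 \<Longrightarrow>
       \<phi> $$ (i, j) \<in> PR 3 \<and> form_of_degree 1 (\<phi> $$ (i, j))"
    and ht1: "ideal_height (polyring 3) (minors_ideal 3 1 \<phi>) = 3"
    and ht2: "ideal_height (polyring 3) (minors_ideal 3 (n - 1) \<phi>) = 2"
begin

sublocale R: cring "polyring 3 :: 'k mpoly ring" by (rule cring_polyring)

abbreviation f :: "nat \<Rightarrow> 'k mpoly" where "f \<equiv> max_minor \<phi>"
abbreviation ent :: "nat \<Rightarrow> nat \<Rightarrow> 'k mpoly" where "ent i j \<equiv> \<phi> $$ (i, j)"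

text \<open>A rational point \<open>p\<close> killing all entries would put the ideal of entries
  into the prime of the line through the origin and \<open>p\<close>, parametrized by
  \<open>pvar 0\<close>. The quotient by that prime has dimension one, so no chain of length three
  ends there.\<close>

lemma no_common_zero:
  fixes p :: "nat \<Rightarrow> 'k"
  assumes "l0 < 3" "p l0 \<noteq> 0"
  shows "\<exists>i<n. \<exists>j<n - 1. psubst (ent i j) (\<lambda>l. PConst (p l) * pvar 0) \<noteq> 0"
proof (rule ccontr)
  let ?g = "\<lambda>l. PConst (p l) * pvar 0 :: 'k mpoly"
  let ?P = "{q \<in> PR 3. psubst q ?g = 0}"
  assume neg: "\<not> ?thesis"
  have P: "primeideal ?P (polyring 3)" by (rule psubst_kernel_primeideal)
  have sub: "minors_ideal 3 1 \<phi> \<subseteq> ?P"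
    unfolding minors_ideal_def
  proof (rule R.genideal_minimal)
    show "ideal ?P (polyring 3)" using P by (simp add: primeideal_def)
    show "{det (submatrix \<phi> U V) |U V. U \<subseteq> {..<dim_row \<phi>} \<and> V \<subseteq> {..<dim_col \<phi>} \<and> card U = 1 \<and> card V = 1} \<subseteq> ?P"
    proof clarify
      fix U V assume U: "U \<subseteq> {..<dim_row \<phi>}" "V \<subseteq> {..<dim_col \<phi>}" "card U = 1" "card V = 1"
      then obtain u v where uv: "U = {u}" "V = {v}" by (metis card_1_singletonE)
      with U dims have lt: "u < n" "v < n - 1" by auto
      have "{i. i < dim_row \<phi> \<and> i \<in> U} = {u}" "{i. i < dim_col \<phi> \<and> i \<in> V} = {v}"
        using U uv by auto
      then have c: "card {i. i < dim_row \<phi> \<and> i \<in> U} = 1" "card {i. i < dim_col \<phi> \<and> i \<in> V} = 1"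
        by simp_all
      have pick: "pick {a} 0 = a" for a by (auto intro: Least_equality)
      have "submatrix \<phi> U V \<in> carrier_mat 1 1"
        by (intro carrier_matI) (simp_all only: dim_submatrix c)
      then have "det (submatrix \<phi> U V) = submatrix \<phi> U V $$ (0, 0)" by (rule det_single)
      also have "\<dots> = ent (pick U 0) (pick V 0)" by (rule submatrix_index) (simp_all only: c zero_less_one)
      also have "\<dots> = ent u v" unfolding uv pick ..
      finally show "det (submatrix \<phi> U V) \<in> PR 3 \<and> psubst (det (submatrix \<phi> U V)) ?g = 0"
        using neg lt linear by simp
    qed
  qed
  have "ideal_height (polyring 3) (minors_ideal 3 1 \<phi>) = enat 3"
    by (simp add: ht1 numeral_eq_enat)
  from ideal_height_chain[OF this P sub]
  obtain C where C: "prime_chain (polyring 3) 3 C" "C 3 = ?P" by (elim exE conjE)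
  \<comment> \<open>On this line the coordinate \<open>l0\<close> is a nonzero multiple of the
    parameter, hence transcendental; \<open>?h\<close> removes the factor
    \<open>p l0\<close>.\<close>
  have "alg_indep 1 (\<lambda>_. pvar l0) ?P"
    unfolding alg_indep_def
  proof (intro ballI impI)
    fix Q :: "'k mpoly" assume Q: "Q \<in> PR 1" "psubst Q (\<lambda>_. pvar l0) \<in> ?P"
    let ?h = "\<lambda>_. PConst (inverse (p l0)) * pvar 0 :: 'k mpoly"
    have "psubst (psubst (psubst Q (\<lambda>_. pvar l0)) ?g) ?h = psubst Q pvar"
      unfolding psubst_psubst[OF Q(1)]
      by (rule psubst_cong[OF Q(1)])
        (use assms in \<open>simp add: psubst.hom_mult mult_single flip: mult.assoc\<close>)
    with Q(2) show "Q = 0" by simp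
  qed
  then show False
    using prime_chain_bound_PR[of 3 C 1 "\<lambda>_. pvar l0"] C assms by (auto intro: PR_pvar)
qed

text \<open>For smaller \<open>n\<close> the matrix has no entries, so every point would be a common
  zero.\<close>

lemma n_ge_2: "2 \<le> n"
proof -
  obtain i j where "i < n" "j < n - 1" using no_common_zero[of 0 "\<lambda>_. 1"] by auto
  then show ?thesis by simp
qed

lemma submatrix_eq_delrow:
  assumes "i < n"
  shows "submatrix \<phi> ({..<n} - {i}) {..<n - 1} = delrow n i ent"
proof (rule eq_matI)
  have 1: "{r. r < dim_row \<phi> \<and> r \<in> {..<n} - {i}} = {..<n} - {i}"
    and 2: "{c. c < dim_col \<phi> \<and> c \<in> {..<n - 1}} = {..<n - 1}" using dims by auto
  show "dim_row (submatrix \<phi> ({..<n} - {i}) {..<n - 1}) = dim_row (delrow n i ent)"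
    "dim_col (submatrix \<phi> ({..<n} - {i}) {..<n - 1}) = dim_col (delrow n i ent)"
    using assms by (simp_all only: dim_submatrix 1 2) (simp_all add: delrow_def)
  fix r c assume "r < dim_row (delrow n i ent)" "c < dim_col (delrow n i ent)"
  then have rc: "r < n - 1" "c < n - 1" by (auto simp: delrow_def)
  then show "submatrix \<phi> ({..<n} - {i}) {..<n - 1} $$ (r, c) = delrow n i ent $$ (r, c)"
    by (subst submatrix_index, unfold 1 2)
      (use assms in \<open>simp_all add: pick_skip pick_lessThan delrow_def\<close>)
qed

lemma f_eq: "i < n \<Longrightarrow> f i = det (delrow n i ent)"
  using dims submatrix_eq_delrow by (simp add: max_minor_def)

lemma psubst_f_eq: "i < n \<Longrightarrow> psubst (f i) g = det (delrow n i (\<lambda>r c. psubst (ent r c) g))"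
proof -
  assume i: "i < n"
  have "delrow n i (\<lambda>r c. psubst (ent r c) g) = map_mat (\<lambda>p. psubst p g) (delrow n i ent)"
    by (auto simp: delrow_def)
  then show ?thesis by (simp add: f_eq[OF i] psubst.hom_det)
qed

lemma f_PR: "i < n \<Longrightarrow> f i \<in> PR 3" and f_form: "i < n \<Longrightarrow> form_of_degree (n - 1) (f i)"
proof -
  assume i: "i < n"
  have "delrow n i ent $$ (r, c) \<in> PR 3 \<and> form_of_degree 1 (delrow n i ent $$ (r, c))"
    if "r < n - 1" "c < n - 1" for r c
    using that i linear[of "skip i r" c] by (auto simp: delrow_def skip_def split: if_splits)
  note * = form_sum_degrees_det[OF delrow_carrier[of n i ent], of 3 "\<lambda>_. 1", OF this]
  show "f i \<in> PR 3" "form_of_degree (n - 1) (f i)" using * by (simp_all add: f_eq[OF i])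
qed

lemma minors_ideal_eq: "minors_ideal 3 (n - 1) \<phi> = Idl\<^bsub>polyring 3\<^esub> (f ` {..<n})"
proof -
  have "{det (submatrix \<phi> U V) |U V. U \<subseteq> {..<dim_row \<phi>} \<and> V \<subseteq> {..<dim_col \<phi>} \<and> card U = n - 1 \<and> card V = n - 1}
      = f ` {..<n}" (is "?X = _")
  proof (intro subset_antisym subsetI)
    fix x assume "x \<in> ?X"
    then obtain U V where UV: "x = det (submatrix \<phi> U V)" "U \<subseteq> {..<n}" "V \<subseteq> {..<n - 1}"
      "card U = n - 1" "card V = n - 1" using dims by auto
    have V: "V = {..<n - 1}" using UV by (intro card_subset_eq) auto
    have "card ({..<n} - U) = 1" using UV n_ge_2 by (subst card_Diff_subset) (auto intro: finite_subset)
    then obtain i where i: "{..<n} - U = {i}" by (metis card_1_singletonE)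
    then have "i < n" "U = {..<n} - {i}" using UV(2) by auto
    then have "x = f i"
      unfolding UV(1) V max_minor_def carrier_matD[OF dims] by (simp only:)
    then show "x \<in> f ` {..<n}" using \<open>i < n\<close> by simp
  next
    fix x assume "x \<in> f ` {..<n}"
    then obtain i where "i < n" "x = f i" by auto
    then have "x = det (submatrix \<phi> ({..<n} - {i}) {..<n - 1})" using dims by (simp add: max_minor_def)
    moreover have "card ({..<n} - {i}) = n - 1" using \<open>i < n\<close> by simp
    ultimately have "x = det (submatrix \<phi> ({..<n} - {i}) {..<n - 1}) \<and> {..<n} - {i} \<subseteq> {..<dim_row \<phi>}
        \<and> {..<n - 1} \<subseteq> {..<dim_col \<phi>} \<and> card ({..<n} - {i}) = n - 1 \<and> card {..<n - 1} = n - 1"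
      using dims by auto
    then show "x \<in> ?X" by blast
  qed
  then show ?thesis by (simp add: minors_ideal_def)
qed

lemma ht2': "ideal_height (polyring 3) (Idl\<^bsub>polyring 3\<^esub> (f ` {..<n})) = 2"
  using ht2 by (simp add: minors_ideal_eq)

lemma Idl_f_subset: "primeideal P (polyring 3) \<Longrightarrow> (\<And>i. i < n \<Longrightarrow> f i \<in> P) \<Longrightarrow> Idl\<^bsub>polyring 3\<^esub> (f ` {..<n}) \<subseteq> P"
  by (rule R.genideal_minimal) (auto simp: primeideal_def)

lemma f_chain:
  assumes "primeideal P (polyring 3)" "\<And>i. i < n \<Longrightarrow> f i \<in> P"
  shows "\<exists>C. prime_chain (polyring 3) 2 C \<and> C 2 = P"
proof -
  have "ideal_height (polyring 3) (Idl\<^bsub>polyring 3\<^esub> (f ` {..<n})) = enat 2"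
    by (simp add: ht2' numeral_eq_enat)
  from ideal_height_chain[OF this assms(1) Idl_f_subset[OF assms]] show ?thesis .
qed

lemma f_nonzero: "\<exists>i<n. f i \<noteq> 0"
proof (rule ccontr)
  assume "\<not> ?thesis"
  moreover have "primeideal {p \<in> PR 3. psubst p pvar = (0::'k mpoly)} (polyring 3)"
    by (rule psubst_kernel_primeideal)
  moreover have "{p \<in> PR 3. psubst p pvar = (0::'k mpoly)} = {0}" by auto
  ultimately obtain C where C: "prime_chain (polyring 3) 2 C" "C 2 = {0 :: 'k mpoly}"
    using f_chain[of "{0}"] by auto
  have "alg_indep 3 pvar {0 :: 'k mpoly}" by (simp add: alg_indep_def)
  with C show False
    using prime_chain_bound_PR[of 2 C 3 pvar] by (auto intro: PR_pvar)
qed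

text \<open>Bordering turns signed sums of minors into determinants (\<open>det_bord\<close>): a
  column of \<open>\<phi>\<close> as border gives the syzygies, a column of constants encodes a
  linear relation.\<close>

definition bord :: "(nat \<Rightarrow> 'k mpoly) \<Rightarrow> 'k mpoly mat" where
  "bord v = mat n n (\<lambda>(i, j). if j < n - 1 then ent i j else v i)"

lemma bord_carrier [simp]: "bord v \<in> carrier_mat n n" by (simp add: bord_def)

lemma cofactor_bord: "i < n \<Longrightarrow> cofactor (bord v) i (n - 1) = sg (n - 1) * (sg i * f i)"
proof -
  assume i: "i < n"
  have "mat_delete (bord v) i (n - 1) = delrow n i ent"
    using i by (auto simp: mat_delete_def bord_def delrow_def skip_def)
  then show ?thesis by (simp add: cofactor_def f_eq[OF i] power_add mult_ac)
qed

lemma det_bord: "det (bord v) = sg (n - 1) * (\<Sum>i<n. v i * (sg i * f i))"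
proof -
  have "det (bord v) = (\<Sum>i<n. bord v $$ (i, n - 1) * cofactor (bord v) i (n - 1))"
    using n_ge_2 by (intro laplace_expansion_column) auto
  also have "\<dots> = (\<Sum>i<n. v i * (sg (n - 1) * (sg i * f i)))"
  proof (rule sum.cong)
    fix i assume "i \<in> {..<n}"
    moreover from this have "bord v $$ (i, n - 1) = v i" by (simp add: bord_def)
    ultimately show "bord v $$ (i, n - 1) * cofactor (bord v) i (n - 1) = v i * (sg (n - 1) * (sg i * f i))"
      by (simp add: cofactor_bord)
  qed simp
  finally show ?thesis by (simp add: sum_distrib_left mult_ac)
qed

lemma syzygy: "j < n - 1 \<Longrightarrow> (\<Sum>i<n. sg i * f i * ent i j) = 0"
proof -
  assume j: "j < n - 1"
  have "det (bord (\<lambda>i. ent i j)) = 0"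
  proof (rule det_identical_columns[OF bord_carrier, of j "n - 1"])
    show "col (bord (\<lambda>i. ent i j)) j = col (bord (\<lambda>i. ent i j)) (n - 1)"
      using j by (intro eq_vecI) (auto simp: bord_def)
  qed (use j in auto)
  then show ?thesis by (simp add: det_bord mult_ac)
qed

lemma cofactor_bord_form:
  assumes i: "i < n" and j: "j < n - 1" and v: "\<And>i. i < n \<Longrightarrow> v i \<in> PR 3 \<and> form_of_degree 0 (v i)"
  shows "cofactor (bord v) i j \<in> PR 3" "form_of_degree (n - 2) (cofactor (bord v) i j)"
proof -
  \<comment> \<open>Deleting a column \<open>j < n - 1\<close> moves the constant border to position
    \<open>n - 2\<close>; the other \<open>n - 2\<close> columns are linear.\<close>
  let ?e = "\<lambda>c. if c = n - 2 then 0 else 1"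
  let ?D = "mat_delete (bord v) i j"
  have D: "?D \<in> carrier_mat (n - 1) (n - 1)" by (rule mat_delete_carrier) simp
  have "?D $$ (r, c) \<in> PR 3 \<and> form_of_degree (?e c) (?D $$ (r, c))"
    if rc: "r < n - 1" "c < n - 1" for r c
  proof -
    have "?D $$ (r, c) = bord v $$ (skip i r, skip j c)"
      using rc by (simp add: mat_delete_def bord_def skip_def)
    moreover have "skip i r < n" "skip j c < n" "skip j c < n - 1 \<longleftrightarrow> c \<noteq> n - 2"
      using rc i j by (auto simp: skip_def)
    ultimately show ?thesis using linear[of "skip i r" "skip j c"] v[of "skip i r"]
      by (auto simp: bord_def)
  qed
  note * = form_sum_degrees_det[OF D, of 3 ?e, OF this]
  have "(\<Sum>c<n - 1. ?e c) = (\<Sum>c\<in>{..<n - 1} - {n - 2}. 1)"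
    using n_ge_2 by (subst sum.remove[of _ "n - 2"]) auto
  also have "\<dots> = n - 2" using n_ge_2 by simp
  finally have "form_of_degree (n - 2) (det ?D)" using *(2) by simp
  with * show "cofactor (bord v) i j \<in> PR 3" "form_of_degree (n - 2) (cofactor (bord v) i j)"
    by (simp_all add: cofactor_def PR_mult form_sg_mult)
qed

text \<open>A linear relation between the minors makes the bordered square matrix singular; the columns
  of its adjugate are proportional syzygies of degree \<open>n - 2\<close>, too small to be multiples of the
  minors, which have no common factor.\<close>

lemma f_independent:
  assumes c: "(\<Sum>i<n. PConst (c i) * f i) = 0" and k: "k < n"
  shows "c k = 0"
proof -
  \<comment> \<open>The sign cancels the one in \<open>det_bord\<close>, so that
    \<open>det (bord v)\<close> is up to sign the given relation.\<close>
  define v where "v i = sg i * PConst (c i)" for i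
  let ?A = "bord v"
  let ?F = "\<lambda>i. sg i * f i"
  define W where "W i j = cofactor ?A i j" for i j
  have v: "v i \<in> PR 3 \<and> form_of_degree 0 (v i)" for i
    by (simp add: v_def PR_mult form_sg_mult)
  have "det ?A = 0" using c by (simp add: det_bord v_def mult_ac)
  \<comment> \<open>With zero determinant the matrix annihilates its adjugate; the contribution of
    the border column, whose cofactors are the minors, is moved to the right.\<close>
  have row: "(\<Sum>j<n - 1. ent r j * W i j) = - (v r * (sg (n - 1) * ?F i))" if "r < n" "i < n" for r i
  proof -
    have "(?A * adj_mat ?A) $$ (r, i) = 0"
      using adj_mat(2)[OF bord_carrier, of v] \<open>det ?A = 0\<close> that by simp
    moreover have "(?A * adj_mat ?A) $$ (r, i) = (\<Sum>j<n. bord v $$ (r, j) * W i j)"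
      using that by (simp add: adj_mat_def scalar_prod_def W_def atLeast0LessThan bord_def)
    moreover have "{..<n} = insert (n - 1) {..<n - 1}" using n_ge_2 by auto
    ultimately have "v r * W i (n - 1) + (\<Sum>j<n - 1. bord v $$ (r, j) * W i j) = 0"
      using that by (simp add: bord_def)
    moreover have "(\<Sum>j<n - 1. bord v $$ (r, j) * W i j) = (\<Sum>j<n - 1. ent r j * W i j)"
      using that by (intro sum.cong) (auto simp: bord_def)
    ultimately show ?thesis
      using that by (simp add: W_def cofactor_bord eq_neg_iff_add_eq_0 add.commute)
  qed
  obtain i0 where i0: "i0 < n" "f i0 \<noteq> 0" using f_nonzero by blast
  \<comment> \<open>By \<open>row\<close> both sides have the same image under the matrix, whose
    columns are independent because \<open>f i0\<close> is nonzero.\<close>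
  have proportional: "?F i' * W i j = ?F i * W i' j" if "i < n" "i' < n" "j < n - 1" for i i' j
  proof -
    have "?F i' * W i j - ?F i * W i' j = 0"
    proof (rule det_delrow_right_kernel[of n i0 ent "\<lambda>j. ?F i' * W i j - ?F i * W i' j"])
      show "det (delrow n i0 ent) \<noteq> 0" using i0 f_eq by simp
      fix r assume r: "r < n"
      have e: "(\<Sum>j<n - 1. ent r j * (?F i' * W i j - ?F i * W i' j))
          = ?F i' * (\<Sum>j<n - 1. ent r j * W i j) - ?F i * (\<Sum>j<n - 1. ent r j * W i' j)"
        by (simp add: sum_distrib_left sum_subtractf right_diff_distrib mult_ac)
      show "(\<Sum>j<n - 1. ent r j * (?F i' * W i j - ?F i * W i' j)) = 0"
        unfolding e row[OF r that(1)] row[OF r that(2)] by (simp add: mult_ac)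
    qed (use i0 that in auto)
    then show ?thesis by simp
  qed
  \<comment> \<open>Proportionality makes \<open>?F i0\<close> divide \<open>f i * W i0 j\<close>
    for every \<open>i\<close>, hence \<open>W i0 j\<close> itself, and the degrees
    \<open>n - 1\<close> and \<open>n - 2\<close> leave only zero.\<close>
  have W0: "W i0 j = 0" if j: "j < n - 1" for j
  proof -
    have "\<exists>v\<in>PR 3. W i0 j = ?F i0 * v"
    proof (rule height_two_dvd[of "{..<n}" f, OF _ ht2'])
      show "?F i0 \<in> PR 3" "?F i0 \<noteq> 0" using i0 f_PR by (auto intro: PR_mult)
      show "W i0 j \<in> PR 3" unfolding W_def using cofactor_bord_form(1)[OF i0(1) j] v by blast
      fix i assume "i \<in> {..<n}"
      then have i: "i < n" by simp
      have "f i * W i0 j = sg i * (?F i * W i0 j)" by (simp add: mult.assoc)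
      also have "\<dots> = sg i * (?F i0 * W i j)" unfolding proportional[OF i0(1) i j] ..
      also have "\<dots> = ?F i0 * (sg i * W i j)" by (simp only: mult_ac)
      finally show "\<exists>v\<in>PR 3. f i * W i0 j = ?F i0 * v"
        unfolding W_def using cofactor_bord_form(1)[OF i j, of v] v by (auto intro!: PR_mult)
    qed (use f_PR in auto)
    then obtain w where "W i0 j = ?F i0 * w" by auto
    moreover have "form_of_degree (n - 2) (W i0 j)"
      unfolding W_def using cofactor_bord_form(2)[OF i0(1) j] v by blast
    moreover have "form_of_degree (n - 1) (?F i0)" using f_form[OF i0(1)] by (rule form_sg_mult)
    ultimately show ?thesis using n_ge_2 by (intro form_dvd_degree[of "n - 2" _ "n - 1" "?F i0" w]) auto
  qed
  have "v k * (sg (n - 1) * ?F i0) = 0"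
    using row[OF k i0(1)] by (simp add: W0)
  then show ?thesis using i0 by (simp add: v_def)
qed

lemma f_ne_0: "i < n \<Longrightarrow> f i \<noteq> 0"
proof
  assume i: "i < n" "f i = 0"
  have "(\<Sum>r<n. PConst (if r = i then 1 else 0) * f r) = (\<Sum>r<n. if r = i then f r else 0)"
    by (intro sum.cong) auto
  also have "\<dots> = 0" using i by (auto intro: sum.neutral)
  finally show False using f_independent[of "\<lambda>r. if r = i then 1 else 0" i] i by simp
qed

lemma f_not_proportional:
  assumes i: "i < n" "i' < n" "i \<noteq> i'"
  shows "f i \<noteq> PConst c * f i'"
proof
  assume e: "f i = PConst c * f i'"
  let ?c = "\<lambda>r. if r = i then 1 else if r = i' then - c else 0"
  have "(\<Sum>r<n. PConst (?c r) * f r)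
      = (\<Sum>r<n. (if r = i then f r else 0) + (if r = i' then PConst (- c) * f r else 0))"
    using i by (intro sum.cong) auto
  also have "\<dots> = f i + PConst (- c) * f i'"
    using i by (simp add: sum.distrib)
  also have "\<dots> = 0" by (simp add: e single_uminus)
  finally show False using f_independent[of ?c i] i by simp
qed

end

section \<open>The Jacobian dual matrix\<close>

lemma sum_lessThan_3: "(\<Sum>l<3. g l) = g 0 + g 1 + g (2::nat)"
  by (simp add: numeral_3_eq_3 numeral_2_eq_2 One_nat_def)

lemma less_3_iff: "l < 3 \<longleftrightarrow> l = 0 \<or> l = 1 \<or> l = (2::nat)"
  by auto

text \<open>Indices beyond two repeat the last component, so statements on degree and membership
  hold without a bound on \<open>l\<close>.\<close>

definition cross :: "(nat \<Rightarrow> 'a::comm_ring_1) \<Rightarrow> (nat \<Rightarrow> 'a) \<Rightarrow> nat \<Rightarrow> 'a" where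
  "cross u v l = (if l = 0 then u 1 * v 2 - u 2 * v 1
     else if l = 1 then u 2 * v 0 - u 0 * v 2 else u 0 * v 1 - u 1 * v 0)"

lemma cross_simps: "cross u v 0 = u 1 * v 2 - u 2 * v 1" "cross u v 1 = u 2 * v 0 - u 0 * v 2"
  "cross u v 2 = u 0 * v 1 - u 1 * v 0"
  by (simp_all add: cross_def)

lemma cross_orthogonal: "(\<Sum>l<3. cross u v l * u l) = 0" "(\<Sum>l<3. cross u v l * v l) = 0"
  by (simp_all add: sum_lessThan_3 cross_simps algebra_simps)

lemma cross_eq_0D:
  assumes "\<And>l. l < 3 \<Longrightarrow> cross u v l = 0" "i < 3" "j < 3"
  shows "u i * v j = u j * v i"
  using assms(1)[of 0] assms(1)[of 1] assms(1)[of 2] assms(2,3)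
  by (auto simp: less_3_iff cross_simps)

text \<open>The components of \<open>x \<times> (u \<times> v) = (x \<bullet> v) u - (x \<bullet> u)
  v\<close>, where both scalar products vanish.\<close>

lemma proportional_cross:
  fixes x :: "nat \<Rightarrow> 'a::comm_ring_1"
  assumes u: "(\<Sum>l<3. x l * u l) = 0" and v: "(\<Sum>l<3. x l * v l) = 0" and "i < 3" "j < 3"
  shows "x i * cross u v j = x j * cross u v i"
proof -
  have "x 0 * cross u v 1 - x 1 * cross u v 0
      = (\<Sum>l<3. x l * v l) * u 2 - (\<Sum>l<3. x l * u l) * v 2"
    "x 1 * cross u v 2 - x 2 * cross u v 1
      = (\<Sum>l<3. x l * v l) * u 0 - (\<Sum>l<3. x l * u l) * v 0"
    "x 2 * cross u v 0 - x 0 * cross u v 2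
      = (\<Sum>l<3. x l * v l) * u 1 - (\<Sum>l<3. x l * u l) * v 1"
    by (simp_all add: sum_lessThan_3 cross_simps algebra_simps)
  then have "x 0 * cross u v 1 = x 1 * cross u v 0" "x 1 * cross u v 2 = x 2 * cross u v 1"
    "x 2 * cross u v 0 = x 0 * cross u v 2"
    by (simp_all add: u v)
  then show ?thesis using assms(3,4) by (auto simp: less_3_iff)
qed

context hb
begin

text \<open>The minors of \<open>max_minor\<close> carry no signs; the factor \<open>(- 1) ^ i\<close> makes them a syzygy.\<close>

definition cf :: "nat \<Rightarrow> nat \<Rightarrow> nat \<Rightarrow> 'k" where
  "cf l i j = (- 1) ^ i * coef (ent i j) (Poly_Mapping.single l 1)"

text \<open>\<open>dual pvar\<close> is the matrix \<open>B\<close> of the overview and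
  \<open>dual F\<close> its value at \<open>F\<close>. General arguments are allowed because the
  images of the minors under \<open>sq\<close> are inserted as well.\<close>

definition dual :: "(nat \<Rightarrow> 'k mpoly) \<Rightarrow> nat \<Rightarrow> nat \<Rightarrow> 'k mpoly" where
  "dual F l j = (\<Sum>i<n. PConst (cf l i j) * F i)"

lemma psubst_ent:
  assumes "i < n" "j < n - 1"
  shows "psubst (ent i j) X = (\<Sum>l<3. PConst (coef (ent i j) (Poly_Mapping.single l 1)) * X l)"
proof -
  have "ent i j = (\<Sum>l<3. PConst (coef (ent i j) (Poly_Mapping.single l 1)) * pvar l)"
    using linear[OF assms] by (intro linear_form_eq) auto
  then have "psubst (ent i j) X
      = psubst (\<Sum>l<3. PConst (coef (ent i j) (Poly_Mapping.single l 1)) * pvar l) X" by simp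
  then show ?thesis by (simp add: psubst.hom_sum psubst.hom_mult)
qed

text \<open>One bilinear form, sorted by rows of the matrix or by coordinates of \<open>X\<close>.
  As \<open>F\<close> and \<open>X\<close> vary independently, a point \<open>Y\<close> can be
  tested against two different vectors of minors.\<close>

lemma dual_pairing:
  assumes "j < n - 1"
  shows "(\<Sum>i<n. sg i * F i * psubst (ent i j) X) = (\<Sum>l<3. X l * dual F l j)"
proof -
  have "(\<Sum>i<n. sg i * F i * psubst (ent i j) X)
      = (\<Sum>i<n. \<Sum>l<3. X l * (PConst (cf l i j) * F i))"
    using assms
    by (intro sum.cong) (auto simp: psubst_ent sum_distrib_left cf_def mult_ac sg_PConst
        simp flip: mult_single[of 0 _ 0, simplified])
  also have "\<dots> = (\<Sum>l<3. X l * dual F l j)"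
    unfolding dual_def sum_distrib_left by (rule sum.swap)
  finally show ?thesis .
qed

lemma psubst_dual: "psubst (dual F l j) g = dual (\<lambda>i. psubst (F i) g) l j"
  by (simp add: dual_def psubst.hom_sum psubst.hom_mult)

lemma dual_f_syzygy: "j < n - 1 \<Longrightarrow> (\<Sum>l<3. pvar l * dual f l j) = 0"
  using dual_pairing[of j f pvar] syzygy[of j] by simp

lemma dual_f_PR: "dual f l j \<in> PR 3" and dual_f_form: "form_of_degree (n - 1) (dual f l j)"
  unfolding dual_def by (auto intro!: PR_sum PR_mult f_PR form_sum form_PConst_mult f_form)

text \<open>The coefficient of \<open>f i\<close> in the combination is, up to sign, the entry
  \<open>ent i j\<close> at \<open>p\<close>; independence of the minors kills it.\<close>

lemma dual_f_combination:
  assumes "(\<Sum>l<3. PConst (p l) * dual f l j) = 0" "i < n" "j < n - 1"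
  shows "psubst (ent i j) (\<lambda>l. PConst (p l) * pvar 0) = 0"
proof -
  let ?c = "\<lambda>i. \<Sum>l<3. p l * cf l i j"
  have "(\<Sum>i<n. PConst (?c i) * f i) = (\<Sum>i<n. \<Sum>l<3. PConst (p l) * (PConst (cf l i j) * f i))"
    by (simp add: sum_lessThan_3 single_add distrib_right mult_single flip: mult.assoc)
  also have "\<dots> = (\<Sum>l<3. PConst (p l) * dual f l j)"
    unfolding dual_def sum_distrib_left by (rule sum.swap)
  finally have "?c i = 0" using assms by (intro f_independent[of ?c]) auto
  let ?a = "\<lambda>l. coef (ent i j) (Poly_Mapping.single l 1)"
  have "?c i = (- 1) ^ i * (\<Sum>l<3. ?a l * p l)"
    unfolding sum_distrib_left cf_def by (intro sum.cong) (auto simp: mult_ac)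
  with \<open>?c i = 0\<close> have "(\<Sum>l<3. ?a l * p l) = 0" by simp
  moreover have "psubst (ent i j) (\<lambda>l. PConst (p l) * pvar 0) = PConst (\<Sum>l<3. ?a l * p l) * pvar 0"
    unfolding psubst_ent[OF assms(2,3)]
    by (simp add: sum_lessThan_3 single_add distrib_right mult_single flip: mult.assoc)
  ultimately show ?thesis by simp
qed

lemma dual_f_nonzero: "\<exists>l<3. \<exists>j<n - 1. dual f l j \<noteq> 0"
proof (rule ccontr)
  assume "\<not> ?thesis"
  then have "psubst (ent i j) (\<lambda>l. PConst 1 * pvar 0) = 0" if "i < n" "j < n - 1" for i j
    using dual_f_combination[of "\<lambda>_. 1" j i] that by simp
  then show False using no_common_zero[of 0 "\<lambda>_. 1"] by auto
qed

text \<open>At \<open>Y\<close> the matrix has two left kernel vectors, \<open>F\<close> and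
  \<open>F'\<close> with signs. Their combination that is zero at \<open>i\<close> stays nonzero by
  \<open>ind\<close>, so the minor omitting row \<open>i\<close> vanishes.\<close>

lemma minors_vanish:
  assumes F: "\<And>j. j < n - 1 \<Longrightarrow> (\<Sum>l<3. Y l * dual F l j) = 0"
    and F': "\<And>j. j < n - 1 \<Longrightarrow> (\<Sum>l<3. Y l * dual F' l j) = 0"
    and ind: "\<And>i i'. i < n \<Longrightarrow> i' < n \<Longrightarrow> i \<noteq> i' \<Longrightarrow> F i * F' i' \<noteq> F i' * F' i"
    and i: "i < n"
  shows "psubst (f i) Y = 0"
proof -
  let ?M = "\<lambda>r c. psubst (ent r c) Y"
  let ?u = "\<lambda>r. sg r * (F' i * F r - F i * F' r)"
  obtain i' where i': "i' < n" "i' \<noteq> i"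
    using n_ge_2 that[of "if i = 0 then 1 else 0"] by (auto split: if_splits)
  have "det (delrow n i ?M) = 0"
  proof (rule det_delrow_left_kernel[of n ?u ?M i i'])
    fix c assume c: "c < n - 1"
    have "(\<Sum>r<n. ?u r * ?M r c)
        = F' i * (\<Sum>r<n. sg r * F r * ?M r c) - F i * (\<Sum>r<n. sg r * F' r * ?M r c)"
      by (simp add: sum_distrib_left right_diff_distrib left_diff_distrib sum_subtractf mult_ac)
    then show "(\<Sum>r<n. ?u r * ?M r c) = 0"
      using F[OF c] F'[OF c] by (simp add: dual_pairing[OF c])
  next
    show "?u i' \<noteq> 0" using ind[OF i i'(1)] i'(2) by (auto simp: mult.commute)
  qed (use i i' in \<open>auto simp: mult.commute\<close>)
  then show ?thesis by (simp add: psubst_f_eq[OF i])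
qed

text \<open>The base locus is finite, so a base point with coordinates in a polynomial ring does not vary.\<close>

lemma base_point_constant:
  assumes Y: "\<And>l. l < 3 \<Longrightarrow> form_of_degree e (Y l)" "0 < e" and l0: "l0 < 3" "Y l0 \<noteq> 0"
    and f0: "\<And>i. i < n \<Longrightarrow> psubst (f i) Y = 0" and l: "l < 3"
  shows "\<exists>c. Y l = PConst c * Y l0"
proof -
  let ?P = "{q \<in> PR 3. psubst q Y = 0}" and ?w = "\<lambda>i::nat. if i = 0 then pvar l else pvar l0 :: 'k mpoly"
  have P: "primeideal ?P (polyring 3)" by (rule psubst_kernel_primeideal)
  have "\<exists>C. prime_chain (polyring 3) 2 C \<and> C 2 = ?P"
    by (rule f_chain[OF P]) (simp add: f0 f_PR)
  then obtain C where C: "prime_chain (polyring 3) 2 C" "C 2 = ?P"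
    by (elim exE conjE)
  \<comment> \<open>A chain of length two ends in \<open>?P\<close>, so at most one element is
    independent modulo \<open>?P\<close> and the two coordinates satisfy a relation.\<close>
  have "\<not> alg_indep 2 ?w ?P"
  proof
    assume "alg_indep 2 ?w ?P"
    with C have "2 + 2 \<le> (3::nat)"
      by (intro prime_chain_bound_PR[OF C(1), of 2 ?w]) (simp_all add: PR_pvar l l0)
    then show False by simp
  qed
  then obtain Q where Q: "Q \<in> PR 2" "Q \<noteq> 0" "psubst (psubst Q ?w) Y = 0"
    by (auto simp: alg_indep_def)
  have "psubst (psubst Q ?w) Y = psubst Q (\<lambda>i. if i = 0 then Y l else Y l0)"
    unfolding psubst_psubst[OF Q(1)] by (rule psubst_cong[OF Q(1)]) simp
  with Q Y l l0 show ?thesis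
    using forms_dependent_proportional[of e "Y l" "Y l0" Q] by simp
qed

text \<open>If the matrix \<open>dual f\<close> had rank one, spanned by a column \<open>a(x)\<close>, then all the lines
  \<open>a(x) \<bullet> X = 0\<close> would be contracted; the intersection \<open>a(x) \<times> a(x')\<close> of two of them would be a
  base point, hence fixed, and the matrix would vanish there. The second generic
  point \<open>x'\<close> is obtained by squaring the variables.\<close>

lemma dual_f_rank:
  "\<exists>j1<n - 1. \<exists>j2<n - 1. \<exists>l<3. cross (\<lambda>l. dual f l j1) (\<lambda>l. dual f l j2) l \<noteq> 0"
proof (rule ccontr)
  assume neg: "\<not> ?thesis"
  obtain l0 j0 where l0: "l0 < 3" "j0 < n - 1" "dual f l0 j0 \<noteq> 0" using dual_f_nonzero by blast
  define a where "a l = dual f l j0" for l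
  define a' where "a' l = sq (a l)" for l
  define Y where "Y = cross a a'"
  \<comment> \<open>Vanishing of all cross products says that every column is proportional to
    \<open>a\<close>.\<close>
  have rank: "a l * dual f m j = a m * dual f l j" if "l < 3" "m < 3" "j < n - 1" for l m j
    unfolding a_def by (rule cross_eq_0D[of "\<lambda>l. dual f l j0" "\<lambda>l. dual f l j"])
      (use neg that l0 in auto)
  have al0: "a l0 \<noteq> 0" using l0 by (simp add: a_def)
  \<comment> \<open>Degree \<open>n - 1\<close> comes from \<open>a\<close>, and twice that from
    \<open>a'\<close>.\<close>
  have form: "form_of_degree (3 * (n - 1)) (Y l)" for l
  proof -
    have a: "form_of_degree (n - 1) (a l)" for l by (simp add: a_def dual_f_form)
    have "form_of_degree ((n - 1) * 2) (a' l)" for l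
      unfolding a'_def
      by (rule form_psubst[OF a, of _ 3]) (use form_power[OF form_pvar, of 2] in \<open>auto simp: a_def dual_f_PR\<close>)
    note * = form_mult[OF a this]
    have "form_of_degree (n - 1 + (n - 1) * 2) (Y l)"
      unfolding Y_def cross_def using * by (auto intro!: form_diff)
    moreover have "n - 1 + (n - 1) * 2 = 3 * (n - 1)" by simp
    ultimately show ?thesis by simp
  qed
  have Ya: "(\<Sum>l<3. Y l * a l) = 0" "(\<Sum>l<3. Y l * a' l) = 0"
    unfolding Y_def by (rule cross_orthogonal)+
  \<comment> \<open>\<open>Y\<close> is orthogonal to \<open>a\<close> and to \<open>a'\<close>;
    cancelling \<open>a l0\<close> or \<open>a' l0\<close> carries this to every column, at both
    generic points.\<close>
  have kill: "(\<Sum>l<3. Y l * dual f l j) = 0" "(\<Sum>l<3. Y l * dual (\<lambda>i. sq (f i)) l j) = 0"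
    if j: "j < n - 1" for j
  proof -
    have "a l0 * (\<Sum>l<3. Y l * dual f l j) = (\<Sum>l<3. Y l * a l) * dual f l0 j"
      unfolding sum_distrib_left sum_distrib_right
    proof (rule sum.cong)
      fix l :: nat assume "l \<in> {..<3}"
      then show "a l0 * (Y l * dual f l j) = Y l * a l * dual f l0 j"
        using rank[of l0 l j] l0 j by (simp add: mult_ac)
    qed simp
    with al0 Ya show "(\<Sum>l<3. Y l * dual f l j) = 0" by simp
    have "a' l0 * (\<Sum>l<3. Y l * sq (dual f l j)) = (\<Sum>l<3. Y l * a' l) * sq (dual f l0 j)"
      unfolding sum_distrib_left sum_distrib_right
    proof (rule sum.cong)
      fix l :: nat assume "l \<in> {..<3}"
      then have "sq (a l0 * dual f l j) = sq (a l * dual f l0 j)" using rank[of l0 l j] l0 j by simp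
      then show "a' l0 * (Y l * sq (dual f l j)) = Y l * a' l * sq (dual f l0 j)"
        by (simp add: a'_def psubst.hom_mult mult_ac)
    qed simp
    with al0 Ya have "(\<Sum>l<3. Y l * sq (dual f l j)) = 0" by (simp add: a'_def)
    then show "(\<Sum>l<3. Y l * dual (\<lambda>i. sq (f i)) l j) = 0" by (simp add: psubst_dual)
  qed
  have f0: "psubst (f i) Y = 0" if "i < n" for i
  proof (rule minors_vanish[OF kill _ that])
    fix r s assume "r < n" "s < n" "r \<noteq> s"
    then show "f r * sq (f s) \<noteq> f s * sq (f r)"
      using proportional_of_sq[of "f r" "f s"] f_ne_0 f_not_proportional by metis
  qed
  \<comment> \<open>If \<open>a\<close> and \<open>a'\<close> were parallel, \<open>a\<close> would
    be a constant vector times \<open>a l0\<close>, and the syzygy on this column would become a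
    linear relation between the variables.\<close>
  have "\<exists>l<3. Y l \<noteq> 0"
  proof (rule ccontr)
    assume "\<not> ?thesis"
    then have "a l * a' l0 = a l0 * a' l" if "l < 3" for l
      using cross_eq_0D[of a a' l l0] that l0 by (simp add: Y_def)
    then have "\<exists>c. a l = PConst c * a l0" if "l < 3" for l
      using proportional_of_sq[of "a l" "a l0"] that al0 by (simp add: a'_def)
    then obtain c where c: "\<And>l. l < 3 \<Longrightarrow> a l = PConst (c l) * a l0" by metis
    have "0 = (\<Sum>l<3. pvar l * a l)" using dual_f_syzygy[OF l0(2)] by (simp add: a_def)
    also have "\<dots> = (\<Sum>l<3. PConst (c l) * pvar l) * a l0"
      unfolding sum_distrib_right by (intro sum.cong) (auto simp: c mult_ac)
    finally have "(\<Sum>l<3. PConst (c l) * pvar l) = 0" using al0 by auto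
    then have "coef (\<Sum>l<3. PConst (c l) * pvar l) (Poly_Mapping.single l0 1) = 0" by simp
    moreover have "coef (\<Sum>l<3. PConst (c l) * pvar l) (Poly_Mapping.single l0 1)
        = (\<Sum>l<3. if l = l0 then c l else 0)"
      unfolding lookup_sum
    proof (rule sum.cong)
      fix l
      have "Poly_Mapping.single l (1::nat) = Poly_Mapping.single l0 1 \<longleftrightarrow> l = l0"
        by (metis lookup_single_eq lookup_single_not_eq zero_neq_one)
      then show "coef (PConst (c l) * pvar l) (Poly_Mapping.single l0 1) = (if l = l0 then c l else 0)"
        by (simp add: coef_PConst_mult pvar_def lookup_single when_def)
    qed simp
    ultimately have "c l0 = 0" using l0 by simp
    with c[OF l0(1)] al0 show False by simp
  qed
  then obtain l1 where l1: "l1 < 3" "Y l1 \<noteq> 0" by blast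
  have "\<exists>c. Y l = PConst c * Y l1" if "l < 3" for l
    using n_ge_2 by (intro base_point_constant[OF form _ l1 f0 that]) auto
  then obtain p where p: "\<And>l. l < 3 \<Longrightarrow> Y l = PConst (p l) * Y l1" by metis
  have "(\<Sum>l<3. PConst (p l) * dual f l j) = 0" if "j < n - 1" for j
  proof -
    have "Y l1 * (\<Sum>l<3. PConst (p l) * dual f l j) = (\<Sum>l<3. Y l * dual f l j)"
      unfolding sum_distrib_left by (intro sum.cong) (auto simp: p mult_ac)
    with kill(1)[OF that] l1 show ?thesis by simp
  qed
  then have "psubst (ent i j) (\<lambda>l. PConst (p l) * pvar 0) = 0" if "i < n" "j < n - 1" for i j
    using dual_f_combination that by blast
  moreover have "p l1 \<noteq> 0" using p[OF l1(1)] l1(2) by auto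
  ultimately show False using no_common_zero[OF l1(1), of p] by blast
qed

end

section \<open>The inverse map\<close>

text \<open>Division by a variable with the quotient kept inside \<open>PR n\<close>; for
  \<open>i\<close> outside the range the quotient is zero.\<close>

lemma PR_split_var:
  assumes "p \<in> PR n"
  shows "\<exists>r\<in>PR n. p = psubst p (pvar(i := 0)) + pvar i * r"
proof (cases "i < n")
  case True
  show ?thesis
    using assms
  proof (induction p rule: PR_induct)
    case (const c)
    show ?case by (intro bexI[of _ 0]) auto
  next
    case (var l)
    show ?case
    proof (cases "l = i")
      case True
      then show ?thesis by (intro bexI[of _ 1]) auto
    qed (intro bexI[of _ 0], auto)
  next
    case (add p q)
    then obtain r s where rs: "r \<in> PR n" "p = psubst p (pvar(i := 0)) + pvar i * r"
      "s \<in> PR n" "q = psubst q (pvar(i := 0)) + pvar i * s" by blast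
    have "p + q = (psubst p (pvar(i := 0)) + pvar i * r) + (psubst q (pvar(i := 0)) + pvar i * s)"
      using rs(2,4) by (rule arg_cong2)
    also have "\<dots> = psubst (p + q) (pvar(i := 0)) + pvar i * (r + s)"
      by (simp add: psubst.hom_add distrib_left add_ac)
    finally show ?case using PR_add[OF rs(1,3)] by blast
  next
    case (mult p q)
    then obtain r s where rs: "r \<in> PR n" "p = psubst p (pvar(i := 0)) + pvar i * r"
      "s \<in> PR n" "q = psubst q (pvar(i := 0)) + pvar i * s" by blast
    let ?t = "r * q + psubst p (pvar(i := 0)) * s"
    have "p * q = (psubst p (pvar(i := 0)) + pvar i * r) * q" using rs(2) by (rule arg_cong)
    also have "\<dots> = psubst p (pvar(i := 0)) * q + pvar i * (r * q)"
      by (simp add: algebra_simps)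
    also have "psubst p (pvar(i := 0)) * q
        = psubst p (pvar(i := 0)) * (psubst q (pvar(i := 0)) + pvar i * s)"
      using rs(4) by (rule arg_cong)
    also have "\<dots> + pvar i * (r * q) = psubst (p * q) (pvar(i := 0)) + pvar i * ?t"
      by (simp add: psubst.hom_mult distrib_left mult_ac)
    finally have "p * q = psubst (p * q) (pvar(i := 0)) + pvar i * ?t" .
    moreover have "psubst p (pvar(i := 0)) \<in> PR n"
      using mult(1) by (rule psubst_PR) (auto intro: PR_pvar)
    then have "?t \<in> PR n" using rs mult by (auto intro!: PR_add PR_mult)
    ultimately show ?case by blast
  qed
next
  case False
  then have "psubst p (pvar(i := 0)) = psubst p pvar"
    using assms by (intro psubst_cong) auto
  then show ?thesis by (intro bexI[of _ 0]) auto
qed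

lemma pvar_nonzero [simp]: "pvar i \<noteq> (0 :: ('k::field) mpoly)"
proof
  assume "pvar i = (0 :: 'k mpoly)"
  then have "coef (pvar i :: 'k mpoly) (Poly_Mapping.single i 1) = 0" by simp
  then show False by (simp add: pvar_def)
qed

lemma pvar_dvd:
  fixes p q :: "('k::field) mpoly"
  assumes "pvar i * p = pvar j * q" "i \<noteq> j" "q \<in> PR n"
  shows "\<exists>r\<in>PR n. q = pvar i * r"
proof -
  obtain r where r: "r \<in> PR n" "q = psubst q (pvar(i := 0)) + pvar i * r"
    using PR_split_var[OF assms(3)] by blast
  have "psubst (pvar i * p) (pvar(i := 0)) = psubst (pvar j * q) (pvar(i := 0))"
    using assms(1) by simp
  then have "psubst q (pvar(i := 0)) = 0" using assms(2) by (simp add: psubst.hom_mult)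
  with r show ?thesis by auto
qed

text \<open>The relation between the components 0 and 1 shows that \<open>pvar 0\<close> divides
  \<open>u 0\<close>; the quotient serves for the other components after cancelling
  \<open>pvar 0\<close>.\<close>

lemma proportional_to_variables:
  fixes u :: "nat \<Rightarrow> ('k::field) mpoly"
  assumes u: "\<And>l. l < 3 \<Longrightarrow> u l \<in> PR 3"
    and uv: "\<And>i j. i < 3 \<Longrightarrow> j < 3 \<Longrightarrow> pvar i * u j = pvar j * u i"
  shows "\<exists>D\<in>PR 3. \<forall>l<3. u l = pvar l * D"
proof -
  obtain D where D: "D \<in> PR 3" "u 0 = pvar 0 * D"
    using pvar_dvd[OF uv[of 0 1], of 3] u[of 0] by auto
  have "u l = pvar l * D" if "l < 3" for l
  proof -
    have "pvar 0 * u l = pvar 0 * (pvar l * D)" using uv[of 0 l] that D by (simp add: mult_ac)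
    then show ?thesis by simp
  qed
  with D show ?thesis by blast
qed

context hb
begin

abbreviation J :: "'k mpoly set" where "J \<equiv> image_ideal {0} n f"

lemma J_iff: "q \<in> J \<longleftrightarrow> q \<in> PR n \<and> psubst q f = 0"
  by (auto simp: image_ideal_def)

lemma f_represents: "represents_rational_map 3 {0} n f"
  unfolding represents_rational_map_def using f_PR f_form f_nonzero by auto

text \<open>\<open>D\<close> multiplies each variable into the algebra generated by the minors, and
  it is the factor by which the quadrics \<open>h\<close> fail to undo \<open>f\<close>
  exactly.\<close>

definition conductor :: "(nat \<Rightarrow> 'k mpoly) \<Rightarrow> 'k mpoly \<Rightarrow> bool" where
  "conductor h D \<longleftrightarrow> (\<forall>l<3. h l \<in> PR n \<and> form_of_degree 2 (h l) \<and> psubst (h l) f = pvar l * D)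
     \<and> D \<in> PR 3 \<and> D \<noteq> 0"

text \<open>The quadrics are the signed 2 by 2 minors of two independent columns of the Jacobian
  dual. The second property is kept because \<open>depth_zero\<close> reads membership in the square
  of the ideal from it.\<close>

lemma exists_conductor:
  obtains h D j1 j2 where "conductor h D"
    "\<And>l. psubst (h l) f = cross (\<lambda>l. dual f l j1) (\<lambda>l. dual f l j2) l"
proof -
  obtain j1 j2 l0 where j: "j1 < n - 1" "j2 < n - 1" "l0 < 3"
    and nz: "cross (\<lambda>l. dual f l j1) (\<lambda>l. dual f l j2) l0 \<noteq> 0" using dual_f_rank by blast
  let ?u = "cross (\<lambda>l. dual f l j1) (\<lambda>l. dual f l j2)"
  define h where "h = cross (\<lambda>l. dual pvar l j1) (\<lambda>l. dual pvar l j2)"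
  have hu: "psubst (h l) f = ?u l" for l
    by (simp add: h_def cross_def psubst.hom_minus psubst.hom_mult psubst_dual)
  have dual: "dual pvar l j \<in> PR n" "form_of_degree 1 (dual pvar l j)" for l j
    unfolding dual_def by (auto intro!: PR_sum PR_mult PR_pvar form_sum form_PConst_mult)
  have "form_of_degree 2 (dual pvar l j * dual pvar l' j')" for l l' j j'
    using form_mult[OF dual(2) dual(2)] by simp
  then have h: "h l \<in> PR n" "form_of_degree 2 (h l)" for l
    unfolding h_def cross_def by (auto intro!: PR_diff PR_mult form_diff dual)
  have "\<exists>D\<in>PR 3. \<forall>l<3. ?u l = pvar l * D"
    using j by (intro proportional_to_variables proportional_cross dual_f_syzygy)
      (auto simp: cross_def intro!: PR_diff PR_mult dual_f_PR)
  then obtain D where D: "D \<in> PR 3" "\<And>l. l < 3 \<Longrightarrow> ?u l = pvar l * D" by blast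
  have "D \<noteq> 0" using D(2)[OF j(3)] nz by auto
  with D h hu have "conductor h D" by (simp add: conductor_def)
  with hu show thesis using that by blast
qed

lemma conductor_represents:
  assumes "conductor h D"
  shows "represents_rational_map n J 3 h"
proof -
  have "psubst (h 0) f \<noteq> 0" using assms by (simp add: conductor_def)
  then have "h 0 \<notin> J" by (simp add: J_iff)
  then show ?thesis
    using assms unfolding represents_rational_map_def conductor_def
    by (metis zero_less_numeral)
qed

text \<open>Both composites are the identity up to a nonzero factor, \<open>D\<close> on the plane
  and \<open>D ^ (n - 1)\<close> on the image. By definition of \<open>J\<close>, identities on the
  image are checked after inserting \<open>f\<close>.\<close>

lemma conductor_inverse:
  assumes c: "conductor h D"
  shows "inverse_onto_image 3 {0} n f h"
  unfolding inverse_onto_image_def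
proof (intro conjI)
  have h: "h l \<in> PR n" "form_of_degree 2 (h l)" "psubst (h l) f = pvar l * D" if "l < 3" for l
    using c that by (auto simp: conductor_def)
  have D: "D \<noteq> 0" using c by (simp add: conductor_def)
  show "represents_rational_map 3 {0} n f" by (rule f_represents)
  show "represents_rational_map n J 3 h" by (rule conductor_represents[OF c])
  show "\<forall>p\<in>{0}. psubst p h \<in> J" by (simp add: J_iff)
  have hf: "psubst (h l) f \<in> PR 3" "form_of_degree (2 * (n - 1)) (psubst (h l) f)" if "l < 3" for l
    by (rule psubst_PR[OF h(1)[OF that] f_PR], assumption,
        rule form_psubst[OF h(2)[OF that] h(1)[OF that] f_form], assumption)
  show "same_rational_map 3 {0} 3 (comp_tuple h f) pvar"
    unfolding same_rational_map_def represents_rational_map_def comp_tuple_def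
  proof (intro conjI allI impI)
    show "\<exists>d. \<forall>i<3. psubst (h i) f \<in> PR 3 \<and> form_of_degree d (psubst (h i) f)"
      using hf by blast
    show "\<exists>i<3. psubst (h i) f \<notin> {0}" using h(3)[of 0] D by (auto intro!: exI[of _ 0])
    show "\<exists>d. \<forall>i<3. pvar i \<in> PR 3 \<and> form_of_degree d (pvar i)"
      by (intro exI[of _ 1]) (simp add: PR_pvar)
    show "\<exists>i<3. pvar i \<notin> {0}" by (auto intro!: exI[of _ 0])
    show "psubst (h i) f * pvar j - psubst (h j) f * pvar i \<in> {0}" if "i < 3" "j < 3" for i j
      using that by (simp add: h(3) mult_ac)
  qed
  have fh: "psubst (f i) h \<in> PR n" "form_of_degree ((n - 1) * 2) (psubst (f i) h)" if "i < n" for i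
    using f_PR[OF that] f_form[OF that] h by (auto intro: psubst_PR form_psubst)
  \<comment> \<open>\<open>f i\<close> is homogeneous of degree \<open>n - 1\<close>, so scaling its
    arguments by \<open>D\<close> pulls out this power.\<close>
  have fhf: "psubst (psubst (f i) h) f = D ^ (n - 1) * f i" if i: "i < n" for i
  proof -
    have "psubst (psubst (f i) h) f = psubst (f i) (\<lambda>l. pvar l * D)"
      unfolding psubst_psubst[OF f_PR[OF i]] by (rule psubst_cong[OF f_PR[OF i]]) (rule h(3))
    also have "\<dots> = (\<Sum>m\<in>supp (f i). D ^ (n - 1) * (PConst (coef (f i) m) * mon_eval pvar m))"
      unfolding psubst_eq_sum
    proof (rule sum.cong)
      fix m assume m: "m \<in> supp (f i)"
      have "mon_eval (\<lambda>l. pvar l * D) m = mon_eval pvar m * D ^ tdeg m"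
        by (simp add: mon_eval_def power_mult_distrib prod.distrib tdeg_def power_sum)
      moreover have "tdeg m = n - 1" using f_form[OF i] m by (simp add: form_iff)
      ultimately show "PConst (coef (f i) m) * mon_eval (\<lambda>l. pvar l * D) m
          = D ^ (n - 1) * (PConst (coef (f i) m) * mon_eval pvar m)" by (simp add: mult_ac)
    qed simp
    also have "\<dots> = D ^ (n - 1) * psubst (f i) pvar"
      by (simp only: psubst_eq_sum sum_distrib_left)
    finally show ?thesis by simp
  qed
  have n0: "0 < n" using n_ge_2 by simp
  show "same_rational_map n J n (comp_tuple f h) pvar"
    unfolding same_rational_map_def represents_rational_map_def comp_tuple_def
  proof (intro conjI allI impI)
    show "\<exists>d. \<forall>i<n. psubst (f i) h \<in> PR n \<and> form_of_degree d (psubst (f i) h)"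
      using fh by blast
    show "\<exists>i<n. psubst (f i) h \<notin> J"
      using n0 D f_ne_0 fhf by (intro exI[of _ 0]) (simp add: J_iff)
    show "\<exists>d. \<forall>i<n. pvar i \<in> PR n \<and> form_of_degree d (pvar i)"
      by (intro exI[of _ 1]) (simp add: PR_pvar)
    show "\<exists>i<n. pvar i \<notin> J"
      using n0 f_ne_0 by (intro exI[of _ 0]) (simp add: J_iff)
    show "psubst (f i) h * pvar j - psubst (f j) h * pvar i \<in> J" if "i < n" "j < n" for i j
      using that fh fhf
      by (auto simp: J_iff psubst.hom_minus psubst.hom_mult mult_ac intro!: PR_diff PR_mult PR_pvar)
  qed
qed

text \<open>After inserting the minors both tuples become proportional to the variables, so the
  expressions \<open>G i * h j - G j * h i\<close> vanish on the image. Thus every inverse, not just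
  some, is represented by quadrics.\<close>

lemma inverse_degree_two:
  assumes c: "conductor h D" and G: "inverse_onto_image 3 {0} n f G"
  shows "same_rational_map n J 3 G h"
proof -
  have GJ: "represents_rational_map n J 3 G" using G by (simp add: inverse_onto_image_def)
  then have "G i \<in> PR n" if "i < 3" for i using that by (auto simp: represents_rational_map_def)
  moreover have "psubst (G i) f * (pvar j * D) = psubst (G j) f * (pvar i * D)" if "i < 3" "j < 3" for i j
  proof -
    have "psubst (G i) f * pvar j = psubst (G j) f * pvar i"
      using G that by (auto simp: inverse_onto_image_def same_rational_map_def comp_tuple_def)
    then show ?thesis unfolding mult.assoc[symmetric] by (rule arg_cong)
  qed
  ultimately have "G i * h j - G j * h i \<in> J" if "i < 3" "j < 3" for i j
    using c that
    by (auto simp: J_iff conductor_def psubst.hom_minus psubst.hom_mult intro!: PR_diff PR_mult)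
  then show ?thesis
    using GJ conductor_represents[OF c] by (simp add: same_rational_map_def)
qed

section \<open>Powers of the ideal of minors\<close>

abbreviation I :: "'k mpoly set" where "I \<equiv> minors_ideal 3 (n - 1) \<phi>"
definition Ipow :: "nat \<Rightarrow> 'k mpoly set" where "Ipow i = I [^]\<^bsub>ideals_set (polyring 3)\<^esub> i"

lemma I_ideal: "ideal I (polyring 3)"
  unfolding minors_ideal_eq using f_PR by (intro R.genideal_ideal) auto

lemma f_in_I: "i < n \<Longrightarrow> f i \<in> I"
  unfolding minors_ideal_eq using f_PR R.genideal_self[of "f ` {..<n}"] by auto

lemma Ipow_0: "Ipow 0 = PR 3" and Ipow_Suc: "Ipow (Suc i) = ideal_prod (polyring 3) (Ipow i) I"
  unfolding Ipow_def nat_pow_def ideals_set_def by simp_all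

lemma Ipow_ideal: "ideal (Ipow i) (polyring 3)"
proof (induction i)
  case 0
  show ?case unfolding Ipow_0 by (rule R.oneideal)
next
  case (Suc i)
  then show ?case unfolding Ipow_Suc by (intro R.ideal_prod_is_ideal I_ideal)
qed

lemma ideal_ops:
  assumes "ideal P (polyring 3)"
  shows "P \<subseteq> PR 3" "0 \<in> P" "a \<in> P \<Longrightarrow> b \<in> P \<Longrightarrow> a + b \<in> P" "a \<in> P \<Longrightarrow> s \<in> PR 3 \<Longrightarrow> s * a \<in> P"
    "a \<in> P \<Longrightarrow> s \<in> PR 3 \<Longrightarrow> a * s \<in> P" "a \<in> P \<Longrightarrow> b \<in> P \<Longrightarrow> a - b \<in> P"
proof -
  interpret ideal P "polyring 3" by fact
  show "P \<subseteq> PR 3" using a_subset by simp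
  show "0 \<in> P" using additive_subgroup.zero_closed[OF additive_subgroup_axioms] by simp
  show add: "a + b \<in> P" if "a \<in> P" "b \<in> P" for a b
    using additive_subgroup.a_closed[OF additive_subgroup_axioms that] by simp
  show mult: "s * a \<in> P" if "a \<in> P" "s \<in> PR 3" for a s using I_l_closed[OF that] by simp
  show "a * s \<in> P" if "a \<in> P" "s \<in> PR 3" using I_r_closed[OF that] by simp
  show "a - b \<in> P" if "a \<in> P" "b \<in> P"
    using add[OF that(1) mult[OF that(2), of "- 1"]] by (simp add: PR_uminus)
qed

lemma ideal_sum: "ideal P (polyring 3) \<Longrightarrow> (\<And>x. x \<in> A \<Longrightarrow> g x \<in> P) \<Longrightarrow> sum g A \<in> P"
  by (induction A rule: infinite_finite_induct) (auto intro: ideal_ops)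

lemma degree_ge_ideal: "ideal {p :: 'k mpoly. p \<in> PR 3 \<and> (\<forall>m\<in>supp p. e \<le> tdeg m)} (polyring 3)"
proof (rule PR_idealI)
  show "a + b \<in> {p \<in> PR 3. \<forall>m\<in>supp p. e \<le> tdeg m}"
    if "a \<in> {p \<in> PR 3. \<forall>m\<in>supp p. e \<le> tdeg m}" "b \<in> {p \<in> PR 3. \<forall>m\<in>supp p. e \<le> tdeg m}"
    for a b :: "'k mpoly"
    using that keys_add[of a b] by (auto intro: PR_add)
  show "s * a \<in> {p \<in> PR 3. \<forall>m\<in>supp p. e \<le> tdeg m}"
    if "s \<in> PR 3" "a \<in> {p \<in> PR 3. \<forall>m\<in>supp p. e \<le> tdeg m}" for s a :: "'k mpoly"
    using that keys_mult[of s a] by (fastforce simp: tdeg_add intro: PR_mult trans_le_add2)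
qed auto

lemma Ipow_degree_ge: "p \<in> Ipow i \<Longrightarrow> m \<in> supp p \<Longrightarrow> i * (n - 1) \<le> tdeg m"
proof (induction i arbitrary: p m)
  case (Suc i)
  have I: "n - 1 \<le> tdeg m" if "p \<in> I" "m \<in> supp p" for p m
  proof -
    have "I \<subseteq> {p \<in> PR 3. \<forall>m\<in>supp p. n - 1 \<le> tdeg m}"
      unfolding minors_ideal_eq using f_PR f_form
      by (intro R.genideal_minimal degree_ge_ideal) (auto simp: form_iff)
    with that show ?thesis by blast
  qed
  have "p \<in> ideal_prod (polyring 3) (Ipow i) I" using Suc.prems(1) unfolding Ipow_Suc .
  then have "\<forall>m\<in>supp p. Suc i * (n - 1) \<le> tdeg m"
  proof (induction p rule: ideal_prod.induct)
    case (prod a b)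
    then show ?case using keys_mult[of a b] Suc.IH[of a] I[of b]
      by (fastforce simp: tdeg_add intro: add_mono)
  next
    case (sum a b)
    then show ?case using keys_add[of a b] by (simp, blast)
  qed
  with Suc.prems(2) show ?case by blast
qed simp

lemma Ipow_1: "a \<in> I \<Longrightarrow> a \<in> Ipow (Suc 0)"
  using ideal_prod.prod[of 1 "Ipow 0" a I "polyring 3"] unfolding Ipow_Suc Ipow_0 by simp

lemma Ipow_2_mult: "a \<in> I \<Longrightarrow> b \<in> I \<Longrightarrow> a * b \<in> Ipow 2"
  using ideal_prod.prod[OF Ipow_1[of a], of b I "polyring 3"]
  unfolding numeral_2_eq_2 Ipow_Suc[of "Suc 0"] by simp

lemma irrelevant_ideal_ideal: "ideal (irrelevant_ideal 3 :: 'k mpoly set) (polyring 3)"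
  unfolding irrelevant_ideal_def by (intro R.genideal_ideal) (auto intro: PR_pvar)

lemma irrelevant_ideal_iff: "a \<in> irrelevant_ideal 3 \<longleftrightarrow> a \<in> PR 3 \<and> coef a 0 = (0::'k)"
proof
  have "irrelevant_ideal 3 \<subseteq> {p :: 'k mpoly. p \<in> PR 3 \<and> (\<forall>m\<in>supp p. 1 \<le> tdeg m)}"
    unfolding irrelevant_ideal_def
    by (intro R.genideal_minimal degree_ge_ideal) (auto simp: pvar_def intro: PR_pvar[unfolded pvar_def])
  moreover assume "a \<in> irrelevant_ideal 3"
  ultimately have "a \<in> {p \<in> PR 3. \<forall>m\<in>supp p. 1 \<le> tdeg m}" by blast
  then show "a \<in> PR 3 \<and> coef a 0 = 0" by (auto simp: in_keys_iff dest: bspec[of _ _ 0])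
next
  have v: "(pvar i :: 'k mpoly) \<in> irrelevant_ideal 3" if "i < 3" for i
  proof -
    have "pvar ` {..<3} \<subseteq> (PR 3 :: 'k mpoly set)" by (auto intro: PR_pvar)
    then show ?thesis
      unfolding irrelevant_ideal_def using R.genideal_self[of "pvar ` {..<3}"] that by auto
  qed
  have "a - PConst (coef a 0) \<in> irrelevant_ideal 3" if "a \<in> PR 3"
    using that
  proof (induction a rule: PR_induct)
    case (const c)
    show ?case using ideal_ops[OF irrelevant_ideal_ideal] by simp
  next
    case (var i)
    then show ?case using v ideal_ops(2)[OF irrelevant_ideal_ideal]
      by (simp add: pvar_def lookup_single when_def)
  next
    case (add p q)
    from ideal_ops(3)[OF irrelevant_ideal_ideal add(3,4)]
    show ?case by (simp add: lookup_add single_add algebra_simps)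
  next
    case (mult p q)
    have "p * q - PConst (coef (p * q) 0)
        = (p - PConst (coef p 0)) * q + PConst (coef p 0) * (q - PConst (coef q 0))"
      by (simp add: coef_mult_0 algebra_simps mult_single)
    then show ?case
      using ideal_ops[OF irrelevant_ideal_ideal] mult by (simp add: ideal_ops)
  qed
  moreover assume "a \<in> PR 3 \<and> coef a 0 = 0"
  ultimately show "a \<in> irrelevant_ideal 3" by simp
qed

text \<open>The element \<open>D\<close> of degree \<open>2 (n - 1) - 1\<close> is a socle element modulo the square of the
  ideal.\<close>

lemma depth_zero:
  "ring_depth (polyring 3 Quot Ipow 2) ((\<lambda>a. Ipow 2 +>\<^bsub>polyring 3\<^esub> a) ` irrelevant_ideal 3) = 0"
proof -
  obtain h D j1 j2 where c: "conductor h D"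
    and u: "\<And>l. psubst (h l) f = cross (\<lambda>l. dual f l j1) (\<lambda>l. dual f l j2) l"
    using exists_conductor by blast
  interpret I2: ideal "Ipow 2" "polyring 3" by (rule Ipow_ideal)
  let ?A = "polyring 3 Quot Ipow 2"
  interpret A: cring ?A by (rule I2.quotient_is_cring[OF cring_polyring])
  have D: "D \<in> PR 3" "D \<noteq> 0" using c by (auto simp: conductor_def)
  have "pvar 0 * D \<noteq> 0" using D by simp
  \<comment> \<open>\<open>pvar 0 * D\<close> has degree \<open>2 * (n - 1)\<close>, so
    \<open>D\<close> sits one degree below everything in the square.\<close>
  have "D \<notin> Ipow 2"
  proof
    assume "D \<in> Ipow 2"
    from Ipow_degree_ge[OF this lm_in[OF D(2)]] have "2 * (n - 1) \<le> tdeg (lm D)" .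
    moreover have "lm (pvar 0 * D) = lm (pvar 0 :: 'k mpoly) + lm D" using D by (intro lm_mult) auto
    then have "tdeg (lm (pvar 0 * D)) = tdeg (lm (pvar 0 :: 'k mpoly)) + tdeg (lm D)"
      by (simp add: tdeg_add)
    moreover have "tdeg (lm (pvar 0 :: 'k mpoly)) = 1"
      using form_pvar[where 'a = 'k, of 0] lm_in[of "pvar 0 :: 'k mpoly"] by (simp add: form_iff)
    moreover have "form_of_degree (2 * (n - 1)) (psubst (h 0) f)"
      using c f_form by (intro form_psubst[of _ _ n]) (auto simp: conductor_def)
    then have "form_of_degree (2 * (n - 1)) (pvar 0 * D)" using c by (simp add: conductor_def)
    then have "tdeg (lm (pvar 0 * D)) = 2 * (n - 1)"
      using lm_in[OF \<open>pvar 0 * D \<noteq> 0\<close>] by (simp add: form_iff)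
    ultimately show False by simp
  qed
  have dualI: "dual f l j \<in> I" for l j
    unfolding dual_def by (intro ideal_sum[OF I_ideal] ideal_ops(4)[OF I_ideal] f_in_I) auto
  \<comment> \<open>The cross product of two columns is quadratic in the entries of
    \<open>dual f\<close>, which lie in \<open>I\<close>.\<close>
  have xD: "pvar l * D \<in> Ipow 2" if "l < 3" for l
  proof -
    have "psubst (h l) f \<in> Ipow 2"
      unfolding u cross_def by (auto intro!: ideal_ops(6)[OF Ipow_ideal] Ipow_2_mult dualI)
    then show ?thesis using c that by (simp add: conductor_def)
  qed
  have "irrelevant_ideal 3 \<subseteq> {a \<in> PR 3. a * D \<in> Ipow 2}"
    unfolding irrelevant_ideal_def
  proof (rule R.genideal_minimal)
    show "ideal {a \<in> PR 3. a * D \<in> Ipow 2} (polyring 3)"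
      using ideal_ops[OF Ipow_ideal[of 2]]
      by (intro PR_idealI) (auto simp: distrib_right mult.assoc intro: PR_add PR_mult)
  qed (use xD in \<open>auto intro: PR_pvar\<close>)
  then have mD: "a * D \<in> Ipow 2" if "a \<in> irrelevant_ideal 3" for a using that by blast
  \<comment> \<open>The first entry of a nonempty sequence would annihilate the nonzero class of
    \<open>D\<close>. At index zero the ideal of preceding entries is the zero ideal, so regularity
    fails there.\<close>
  have "xs = []" if xs: "set xs \<subseteq> (\<lambda>a. Ipow 2 +>\<^bsub>polyring 3\<^esub> a) ` irrelevant_ideal 3" "regular_seq ?A xs" for xs
  proof (rule ccontr)
    assume "xs \<noteq> []"
    then have "xs ! 0 \<in> set xs" by simp
    then obtain a where a: "a \<in> irrelevant_ideal 3" "xs ! 0 = Ipow 2 +>\<^bsub>polyring 3\<^esub> a" using xs(1) by blast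
    then have aR: "a \<in> PR 3" by (simp add: irrelevant_ideal_iff)
    let ?D = "Ipow 2 +>\<^bsub>polyring 3\<^esub> D"
    have DA: "?D \<in> carrier ?A"
      using D by (auto simp: FactRing_def A_RCOSETS_def' )
    have "xs ! 0 \<otimes>\<^bsub>?A\<^esub> ?D = Ipow 2 +>\<^bsub>polyring 3\<^esub> (a * D)"
      using I2.rcoset_mult_add[of a D] aR D by (simp add: a FactRing_def)
    also have "\<dots> = \<zero>\<^bsub>?A\<^esub>"
      using mD[OF a(1)] I2.a_rcos_const by (simp add: FactRing_def)
    also have "\<dots> \<in> Idl\<^bsub>?A\<^esub> {}"
      using A.genideal_ideal[of "{}"] by (simp add: ideal_def additive_subgroup.zero_closed)
    finally have "?D \<in> Idl\<^bsub>?A\<^esub> {}"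
      using xs(2) DA \<open>xs \<noteq> []\<close> unfolding regular_seq_def by fastforce
    moreover have "Idl\<^bsub>?A\<^esub> {} \<subseteq> {\<zero>\<^bsub>?A\<^esub>}" by (intro A.genideal_minimal A.zeroideal) simp
    ultimately have "?D = Ipow 2" by (auto simp: FactRing_def)
    then have "D \<in> Ipow 2" using I2.rcos_const_imp_mem[of D] D by simp
    with \<open>D \<notin> Ipow 2\<close> show False ..
  qed
  then have "{enat (length xs) |xs. set xs \<subseteq> (\<lambda>a. Ipow 2 +>\<^bsub>polyring 3\<^esub> a) ` irrelevant_ideal 3 \<and> regular_seq ?A xs} \<subseteq> {0}"
    by (auto simp: zero_enat_def)
  then have "Sup {enat (length xs) |xs. set xs \<subseteq> (\<lambda>a. Ipow 2 +>\<^bsub>polyring 3\<^esub> a) ` irrelevant_ideal 3 \<and> regular_seq ?A xs} \<le> 0"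
    by (intro Sup_least) auto
  then show ?thesis unfolding ring_depth_def by simp
qed

end

section \<open>The special fiber as a ring of polynomials\<close>

lemma finsum_polyring:
  assumes "finite A" "\<And>x. x \<in> A \<Longrightarrow> g x \<in> PR r"
  shows "finsum (polyring r) g A = sum g A"
proof -
  interpret R: cring "polyring r" by (rule cring_polyring)
  show ?thesis using assms
    by (induction A rule: finite_induct) (simp_all add: R.finsum_insert)
qed

lemma a_inv_polyring:
  assumes "x \<in> PR r"
  shows "\<ominus>\<^bsub>polyring r\<^esub> x = - x"
proof -
  interpret R: cring "polyring r" by (rule cring_polyring)
  show ?thesis using R.minus_equality[of "- x" x] assms by (simp add: PR_uminus)
qed

context hb
begin

section \<open>The Rees algebra and its lowest parts\<close>

sublocale UP: UP_cring "polyring 3 :: 'k mpoly ring" "UP (polyring 3 :: 'k mpoly ring)"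
  by unfold_locales

abbreviation P :: "('k mpoly, nat \<Rightarrow> 'k mpoly) up_ring" where "P \<equiv> UP (polyring 3)"
abbreviation Rees :: "('k mpoly, nat \<Rightarrow> 'k mpoly) up_ring" where "Rees \<equiv> rees_algebra (polyring 3) I"

lemma P_coeff: "p \<in> carrier P \<Longrightarrow> up_ring.coeff P p i = p i"
  by (simp add: UP_def)

lemma P_PR: "p \<in> carrier P \<Longrightarrow> p i \<in> PR 3"
  using UP.coeff_closed[of p i] by (simp add: P_coeff)

lemma P_mult:
  assumes "p \<in> carrier P" "q \<in> carrier P"
  shows "(p \<otimes>\<^bsub>P\<^esub> q) k = (\<Sum>i\<le>k. p i * q (k - i))"
proof -
  have "(p \<otimes>\<^bsub>P\<^esub> q) k = (\<Oplus>\<^bsub>polyring 3\<^esub>i\<in>{..k}. p i * q (k - i))"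
    using UP.coeff_mult[OF assms, of k] assms UP.UP_mult_closed[OF assms] by (simp add: P_coeff)
  also have "\<dots> = (\<Sum>i\<le>k. p i * q (k - i))"
    using assms by (intro finsum_polyring) (auto intro: PR_mult P_PR)
  finally show ?thesis .
qed

lemma P_add: "p \<in> carrier P \<Longrightarrow> q \<in> carrier P \<Longrightarrow> (p \<oplus>\<^bsub>P\<^esub> q) k = p k + q k"
  using UP.coeff_add[of p q k] by (simp add: P_coeff)

lemma P_one: "\<one>\<^bsub>P\<^esub> k = (if k = 0 then 1 else 0)"
  by (simp add: UP_def)

lemma P_monom: "a \<in> PR 3 \<Longrightarrow> up_ring.monom P a i k = (if k = i then a else 0)"
  by (simp add: UP_def)

lemma Rees_simps: "carrier Rees = {p \<in> carrier P. \<forall>i. p i \<in> Ipow i}"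
  "monoid.mult Rees = monoid.mult P" "one Rees = one P" "zero Rees = zero P" "add Rees = add P"
  by (simp_all add: rees_algebra_def Ipow_def)

lemma Ipow_mult: "a \<in> Ipow i \<Longrightarrow> b \<in> Ipow j \<Longrightarrow> a * b \<in> Ipow (i + j)"
proof (induction j arbitrary: b)
  case 0
  then show ?case using ideal_ops(5)[OF Ipow_ideal, of a i b] by (simp add: Ipow_0)
next
  case (Suc j)
  have "b \<in> ideal_prod (polyring 3) (Ipow j) I" using Suc.prems(2) unfolding Ipow_Suc .
  then have "a * b \<in> ideal_prod (polyring 3) (Ipow (i + j)) I"
  proof (induction b rule: ideal_prod.induct)
    case (prod c e)
    then show ?case
      using ideal_prod.prod[OF Suc.IH[OF Suc.prems(1)], of c e I "polyring 3"] by (simp add: mult.assoc)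
  next
    case (sum c e)
    then show ?case
      using ideal_prod.sum[of "a * c" "polyring 3" "Ipow (i + j)" I "a * e"] by (simp add: distrib_left)
  qed
  then show ?case unfolding add_Suc_right Ipow_Suc .
qed

lemma cring_Rees: "cring Rees"
proof -
  have "subring (carrier Rees) P"
  proof (rule ring.subringI[OF UP.UP_ring])
    show "carrier Rees \<subseteq> carrier P" by (auto simp: Rees_simps)
    have "\<one>\<^bsub>P\<^esub> i \<in> Ipow i" for i
      using ideal_ops(2)[OF Ipow_ideal[of i]] Ipow_0 by (simp add: P_one)
    then show "\<one>\<^bsub>P\<^esub> \<in> carrier Rees" by (simp add: Rees_simps)
    show "\<ominus>\<^bsub>P\<^esub> p \<in> carrier Rees" if "p \<in> carrier Rees" for p
    proof -
      have p: "p \<in> carrier P" "\<And>i. p i \<in> Ipow i" using that by (auto simp: Rees_simps)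
      have "(\<ominus>\<^bsub>P\<^esub> p) i = - p i" for i
        using UP.coeff_a_inv[OF p(1), of i] p(1) by (simp add: P_coeff a_inv_polyring P_PR)
      moreover have "- p i \<in> Ipow i" for i
        using ideal_ops(6)[OF Ipow_ideal ideal_ops(2)[OF Ipow_ideal] p(2)[of i]] by simp
      ultimately show ?thesis using p(1) by (simp add: Rees_simps)
    qed
    show "p \<otimes>\<^bsub>P\<^esub> q \<in> carrier Rees" if "p \<in> carrier Rees" "q \<in> carrier Rees" for p q
    proof -
      have pq: "p \<in> carrier P" "q \<in> carrier P" "\<And>i. p i \<in> Ipow i" "\<And>i. q i \<in> Ipow i"
        using that by (auto simp: Rees_simps)
      have "p i * q (k - i) \<in> Ipow k" if "i \<le> k" for i k
        using Ipow_mult[OF pq(3)[of i] pq(4)[of "k - i"]] that by simp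
      then have "(p \<otimes>\<^bsub>P\<^esub> q) k \<in> Ipow k" for k
        unfolding P_mult[OF pq(1,2)] by (intro ideal_sum[OF Ipow_ideal]) auto
      with pq show ?thesis by (simp add: Rees_simps)
    qed
    show "p \<oplus>\<^bsub>P\<^esub> q \<in> carrier Rees" if "p \<in> carrier Rees" "q \<in> carrier Rees" for p q
      using that ideal_ops(3)[OF Ipow_ideal] by (simp add: Rees_simps P_add)
  qed
  then have "subcring (carrier Rees) P" by (rule cring.subcringI'[OF UP.UP_cring])
  then have "cring (P\<lparr>carrier := carrier Rees\<rparr>)"
    using ring.subcring_iff[OF UP.UP_ring, of "carrier Rees"] by (auto simp: Rees_simps)
  then show ?thesis by (simp add: rees_algebra_def)
qed

text \<open>\<open>I\<close> is generated in degree \<open>n - 1\<close>, so modulo the maximal ideal only the part of degree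
  \<open>i (n - 1)\<close> of the coefficient of \<open>t^i\<close> survives.\<close>

definition lowest :: "(nat \<Rightarrow> 'k mpoly) \<Rightarrow> 'k mpoly poly" where
  "lowest p = Abs_poly (\<lambda>i. dpart (i * (n - 1)) (p i))"

text \<open>Setting \<open>t = 1\<close> loses nothing: the part coming from \<open>t^i\<close> is
  homogeneous of degree \<open>i * (n - 1)\<close>, and these degrees are distinct.\<close>

definition fiber_map :: "(nat \<Rightarrow> 'k mpoly) \<Rightarrow> 'k mpoly" where
  "fiber_map p = poly (lowest p) 1"

lemma coeff_lowest:
  assumes "p \<in> carrier P"
  shows "Polynomial.coeff (lowest p) i = dpart (i * (n - 1)) (p i)"
proof -
  obtain N where "bound 0 N p" using assms by (auto simp: UP_def up_def)
  then have "dpart (i * (n - 1)) (p i) = 0" if "N < i" for i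
    using that by (simp add: bound_def)
  from coeff_Abs_poly[of N "\<lambda>i. dpart (i * (n - 1)) (p i)", OF this] show ?thesis
    by (simp add: lowest_def)
qed

lemma fiber_map_add:
  assumes "p \<in> carrier P" "q \<in> carrier P"
  shows "fiber_map (p \<oplus>\<^bsub>P\<^esub> q) = fiber_map p + fiber_map q"
proof -
  have "lowest (p \<oplus>\<^bsub>P\<^esub> q) = lowest p + lowest q"
    using assms UP.UP_a_closed[OF assms]
    by (intro poly_eqI) (simp add: coeff_lowest P_add dpart_add)
  then show ?thesis by (simp add: fiber_map_def)
qed

text \<open>In the Rees algebra the coefficient of \<open>t^i\<close> has no terms below degree
  \<open>i * (n - 1)\<close>, so lowest parts multiply.\<close>

lemma fiber_map_mult:
  assumes p: "p \<in> carrier Rees" and q: "q \<in> carrier Rees"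
  shows "fiber_map (p \<otimes>\<^bsub>P\<^esub> q) = fiber_map p * fiber_map q"
proof -
  have pq: "p \<in> carrier P" "q \<in> carrier P" "\<And>i. p i \<in> Ipow i" "\<And>i. q i \<in> Ipow i"
    using p q by (auto simp: Rees_simps)
  have "lowest (p \<otimes>\<^bsub>P\<^esub> q) = lowest p * lowest q"
  proof (rule poly_eqI)
    fix k
    have "dpart (k * (n - 1)) (p i * q (k - i))
        = dpart (i * (n - 1)) (p i) * dpart ((k - i) * (n - 1)) (q (k - i))" if "i \<le> k" for i
    proof -
      have "i * (n - 1) + (k - i) * (n - 1) = k * (n - 1)"
        using that by (simp flip: distrib_right)
      then show ?thesis
        using dpart_mult[of "p i" "i * (n - 1)" "q (k - i)" "(k - i) * (n - 1)"]
          Ipow_degree_ge[OF pq(3)] Ipow_degree_ge[OF pq(4)] by simp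
    qed
    then show "Polynomial.coeff (lowest (p \<otimes>\<^bsub>P\<^esub> q)) k = Polynomial.coeff (lowest p * lowest q) k"
      using pq by (simp add: coeff_lowest UP.UP_mult_closed P_mult dpart_sum Polynomial.coeff_mult)
  qed
  then show ?thesis by (simp add: fiber_map_def)
qed

lemma fiber_map_one: "fiber_map \<one>\<^bsub>P\<^esub> = 1"
proof -
  have "lowest \<one>\<^bsub>P\<^esub> = 1"
    by (intro poly_eqI)
      (auto simp: coeff_lowest UP.UP_one_closed P_one dpart_form[OF form_one] Polynomial.coeff_1)
  then show ?thesis by (simp add: fiber_map_def)
qed

lemma fiber_map_PR: "p \<in> carrier P \<Longrightarrow> fiber_map p \<in> PR 3"
  unfolding fiber_map_def poly_altdef
  by (intro PR_sum PR_mult PR_power) (simp_all add: coeff_lowest dpart_PR P_PR)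

lemma fiber_map_monom: "a \<in> PR 3 \<Longrightarrow> fiber_map (up_ring.monom P a i) = dpart (i * (n - 1)) a"
proof -
  assume a: "a \<in> PR 3"
  have "lowest (up_ring.monom P a i) = Polynomial.monom (dpart (i * (n - 1)) a) i"
    using a by (intro poly_eqI) (simp add: coeff_lowest UP.monom_closed P_monom)
  then show ?thesis by (simp add: fiber_map_def poly_monom)
qed

lemma fiber_map_eq_0D:
  assumes p: "p \<in> carrier P" and "fiber_map p = 0"
  shows "dpart (j * (n - 1)) (p j) = 0"
proof -
  let ?c = "Polynomial.coeff (lowest p)"
  have "0 = dpart (j * (n - 1)) (\<Sum>i\<le>Polynomial.degree (lowest p). ?c i)"
    using assms(2) by (simp add: fiber_map_def poly_altdef)
  also have "\<dots> = (\<Sum>i\<le>Polynomial.degree (lowest p). if i = j then ?c j else 0)"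
    unfolding dpart_sum
  proof (rule sum.cong)
    fix i
    have "i * (n - 1) = j * (n - 1) \<longleftrightarrow> i = j" using n_ge_2 by simp
    then show "dpart (j * (n - 1)) (?c i) = (if i = j then ?c j else 0)"
      using dpart_form[OF form_dpart, of "j * (n - 1)" "i * (n - 1)" "p i"] p
      by (auto simp: coeff_lowest)
  qed simp
  also have "\<dots> = ?c j" by (auto simp: coeff_eq_0)
  finally show ?thesis using p by (simp add: coeff_lowest)
qed

section \<open>The kernel of the map from the Rees algebra\<close>

abbreviation \<mm> :: "'k mpoly set" where "\<mm> \<equiv> irrelevant_ideal 3"
abbreviation mI :: "nat \<Rightarrow> 'k mpoly set" where "mI i \<equiv> ideal_prod (polyring 3) \<mm> (Ipow i)"

lemma mI_ideal: "ideal (mI i) (polyring 3)"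
  by (intro R.ideal_prod_is_ideal irrelevant_ideal_ideal Ipow_ideal)

lemma mI_Ipow_mult: "u \<in> mI i \<Longrightarrow> v \<in> Ipow j \<Longrightarrow> u * v \<in> mI (i + j)"
proof (induction u rule: ideal_prod.induct)
  case (prod a b)
  then show ?case
    using ideal_prod.prod[of a \<mm> "b * v" "Ipow (i + j)" "polyring 3"] Ipow_mult[of b i v j]
    by (simp add: mult.assoc)
next
  case (sum a b)
  then show ?case
    using ideal_ops(3)[OF mI_ideal, of "a * v" "i + j" "b * v"] by (simp add: distrib_right)
qed

lemma m_diff_const: "s \<in> PR 3 \<Longrightarrow> s - PConst (coef s 0) \<in> \<mm>"
  by (simp add: irrelevant_ideal_iff PR_diff lookup_minus)

text \<open>Modulo \<open>\<mm>\<close> times the power, an element is its lowest part. That this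
  part lies in the power too is included so that the property passes to products.\<close>

definition low_ok :: "nat \<Rightarrow> 'k mpoly \<Rightarrow> bool" where
  "low_ok i q \<longleftrightarrow> q \<in> Ipow i \<and> dpart (i * (n - 1)) q \<in> Ipow i \<and> q - dpart (i * (n - 1)) q \<in> mI i"

lemma low_ok_add: "low_ok i a \<Longrightarrow> low_ok i b \<Longrightarrow> low_ok i (a + b)"
  using ideal_ops(3)[OF mI_ideal, of "a - dpart (i * (n - 1)) a" i "b - dpart (i * (n - 1)) b"]
  by (auto simp: low_ok_def dpart_add algebra_simps intro: ideal_ops(3)[OF Ipow_ideal])

lemma low_ok_mult:
  assumes a: "low_ok i a" and b: "low_ok j b"
  shows "low_ok (i + j) (a * b)"
proof -
  let ?a = "dpart (i * (n - 1)) a" and ?b = "dpart (j * (n - 1)) b"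
  have e: "dpart ((i + j) * (n - 1)) (a * b) = ?a * ?b"
    unfolding distrib_right using a b
    by (intro dpart_mult Ipow_degree_ge) (auto simp: low_ok_def)
  have "(a - ?a) * b \<in> mI (i + j)" "(b - ?b) * ?a \<in> mI (j + i)"
    using a b by (auto simp: low_ok_def intro: mI_Ipow_mult)
  then have "(a - ?a) * b + (b - ?b) * ?a \<in> mI (i + j)"
    by (intro ideal_ops(3)[OF mI_ideal]) (simp_all add: add.commute)
  moreover have "(a - ?a) * b + (b - ?b) * ?a = a * b - ?a * ?b" by (simp add: algebra_simps)
  ultimately show ?thesis
    using a b by (simp add: low_ok_def e Ipow_mult)
qed

lemma low_ok_0: "s \<in> PR 3 \<Longrightarrow> low_ok 0 s"
  using ideal_prod.prod[OF m_diff_const[of s], of 1 "Ipow 0" "polyring 3"]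
  by (simp add: low_ok_def dpart_0 Ipow_0)

lemma low_ok_I: "b \<in> I \<Longrightarrow> low_ok (Suc 0) b"
proof -
  have "ideal {b. low_ok (Suc 0) b} (polyring 3)"
  proof (rule PR_idealI)
    show "{b. low_ok (Suc 0) b} \<subseteq> PR 3" using ideal_ops(1)[OF Ipow_ideal] by (auto simp: low_ok_def)
    show "0 \<in> {b. low_ok (Suc 0) b}"
      using ideal_ops(2)[OF Ipow_ideal] ideal_ops(2)[OF mI_ideal] by (simp add: low_ok_def)
    show "s * a \<in> {b. low_ok (Suc 0) b}" if "s \<in> PR 3" "a \<in> {b. low_ok (Suc 0) b}" for s a
      using low_ok_mult[OF low_ok_0[OF that(1)], of "Suc 0" a] that(2) by simp
  qed (simp add: low_ok_add)
  moreover have "low_ok (Suc 0) (f i)" if "i < n" for i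
  proof -
    have "dpart (Suc 0 * (n - 1)) (f i) = f i" using dpart_form[OF f_form[OF that]] by simp
    then show ?thesis
      using Ipow_1[OF f_in_I[OF that]] ideal_ops(2)[OF mI_ideal] by (simp add: low_ok_def)
  qed
  ultimately have "I \<subseteq> {b. low_ok (Suc 0) b}"
    unfolding minors_ideal_eq by (intro R.genideal_minimal) auto
  then show "low_ok (Suc 0) b" if "b \<in> I" using that by auto
qed

lemma low_ok_Ipow: "q \<in> Ipow i \<Longrightarrow> low_ok i q"
proof (induction i arbitrary: q)
  case 0
  then show ?case by (intro low_ok_0) (simp add: Ipow_0)
next
  case (Suc i)
  have "q \<in> ideal_prod (polyring 3) (Ipow i) I" using Suc.prems unfolding Ipow_Suc .
  then show ?case
  proof (induction q rule: ideal_prod.induct)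
    case (prod a b)
    then show ?case using low_ok_mult[OF Suc.IH low_ok_I, of a b] by simp
  next
    case (sum a b)
    then show ?case by (simp add: low_ok_add)
  qed
qed

abbreviation mRees :: "(nat \<Rightarrow> 'k mpoly) set" where
  "mRees \<equiv> Idl\<^bsub>Rees\<^esub> ((\<lambda>a. up_ring.monom P a 0) ` \<mm>)"

lemma monom_Rees: "a \<in> Ipow i \<Longrightarrow> up_ring.monom P a i \<in> carrier Rees"
  using ideal_ops(1)[OF Ipow_ideal[of i]] ideal_ops(2)[OF Ipow_ideal]
  by (auto simp: Rees_simps P_monom subset_iff)

lemma m_monom_Rees: "(\<lambda>a. up_ring.monom P a 0) ` \<mm> \<subseteq> carrier Rees"
  using monom_Rees[of _ 0] by (auto simp: Ipow_0 irrelevant_ideal_iff)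

lemma ring_hom_fiber_map: "ring_hom_ring Rees (polyring 3) fiber_map"
proof -
  interpret Rees: cring Rees by (rule cring_Rees)
  show ?thesis
  proof (rule ring_hom_ringI[OF Rees.ring_axioms R.ring_axioms])
    fix p q assume "p \<in> carrier Rees" "q \<in> carrier Rees"
    then show "fiber_map (p \<otimes>\<^bsub>Rees\<^esub> q) = fiber_map p \<otimes>\<^bsub>polyring 3\<^esub> fiber_map q"
      "fiber_map (p \<oplus>\<^bsub>Rees\<^esub> q) = fiber_map p \<oplus>\<^bsub>polyring 3\<^esub> fiber_map q"
      by (simp_all add: Rees_simps fiber_map_mult fiber_map_add)
  qed (simp_all add: Rees_simps fiber_map_PR fiber_map_one)
qed

text \<open>The lowest parts of a kernel element vanish, so \<open>low_ok_Ipow\<close> puts its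
  coefficient of \<open>t^i\<close> into \<open>mI i\<close>; summing its monomials in
  \<open>t\<close> then recovers it inside \<open>mRees\<close>.\<close>

lemma kernel_fiber_map: "a_kernel Rees (polyring 3) fiber_map = mRees"
proof -
  interpret Rees: cring Rees by (rule cring_Rees)
  note h = ring_hom_fiber_map
  have K: "ideal mRees Rees" by (rule Rees.genideal_ideal[OF m_monom_Rees])
  have k: "a_kernel Rees (polyring 3) fiber_map = {p \<in> carrier Rees. fiber_map p = 0}"
    by (simp add: a_kernel_def')
  have "mRees \<subseteq> a_kernel Rees (polyring 3) fiber_map"
  proof (rule Rees.genideal_minimal[OF ring_hom_ring.kernel_is_ideal[OF h]])
    show "(\<lambda>a. up_ring.monom P a 0) ` \<mm> \<subseteq> a_kernel Rees (polyring 3) fiber_map"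
      using m_monom_Rees unfolding k by (auto simp: fiber_map_monom irrelevant_ideal_iff dpart_0)
  qed
  moreover have "p \<in> mRees" if p: "p \<in> carrier Rees" "fiber_map p = 0" for p
  proof -
    have pP: "p \<in> carrier P" "\<And>i. p i \<in> Ipow i" using p by (auto simp: Rees_simps)
    have pm: "p i \<in> mI i" for i
      using low_ok_Ipow[OF pP(2)[of i]] fiber_map_eq_0D[OF pP(1) p(2), of i] by (simp add: low_ok_def)
    have add: "a \<oplus>\<^bsub>P\<^esub> b \<in> mRees" if "a \<in> mRees" "b \<in> mRees" for a b
      using additive_subgroup.a_closed[OF ideal.axioms(1)[OF K] that] by (simp add: Rees_simps)
    have mon: "up_ring.monom P u i \<in> mRees" if "u \<in> mI i" for u i
      using that
    proof (induction u rule: ideal_prod.induct)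
      case (prod a b)
      have "up_ring.monom P a 0 \<in> mRees"
        using Rees.genideal_self[OF m_monom_Rees] prod(1) by auto
      then have "up_ring.monom P a 0 \<otimes>\<^bsub>P\<^esub> up_ring.monom P b i \<in> mRees"
        using ideal.I_r_closed[OF K _ monom_Rees[OF prod(2)]] by (simp add: Rees_simps)
      moreover have "a \<in> PR 3" "b \<in> PR 3"
        using prod ideal_ops(1)[OF Ipow_ideal] by (auto simp: irrelevant_ideal_iff)
      ultimately show ?case using UP.monom_mult[of a b 0 i] by simp
    next
      case (sum a b)
      then have "a \<in> PR 3" "b \<in> PR 3" using ideal_ops(1)[OF mI_ideal] by auto
      with sum show ?case using UP.monom_add[of a b i] add by simp
    qed
    have "(\<Oplus>\<^bsub>P\<^esub>i\<in>{..N}. up_ring.monom P (up_ring.coeff P p i) i) \<in> mRees" for N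
    proof (induction N)
      case 0
      show ?case using mon[OF pm[of 0]] pP P_PR[OF pP(1)] by (simp add: P_coeff)
    next
      case (Suc N)
      then show ?case using mon[OF pm[of "Suc N"]] pP P_PR[OF pP(1)] add
        by (simp add: P_coeff Pi_def)
    qed
    from this[of "deg (polyring 3) p"] show ?thesis unfolding UP.up_repr[OF pP(1)] .
  qed
  ultimately show ?thesis unfolding k by blast
qed

text \<open>The algebra generated by the minors, by \<open>f_fiber_ring\<close> and
  \<open>fiber_ring_least\<close>.\<close>

definition fiber_ring :: "'k mpoly set" where "fiber_ring = fiber_map ` carrier Rees"

lemma PConst_fiber_ring: "PConst c \<in> fiber_ring"
proof -
  have "up_ring.monom P (PConst c) 0 \<in> carrier Rees" by (rule monom_Rees) (simp add: Ipow_0)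
  moreover have "fiber_map (up_ring.monom P (PConst c) 0) = PConst c"
    by (simp add: fiber_map_monom dpart_0)
  ultimately show ?thesis unfolding fiber_ring_def by (metis imageI)
qed

lemma f_fiber_ring: "i < n \<Longrightarrow> f i \<in> fiber_ring"
proof -
  assume i: "i < n"
  have "up_ring.monom P (f i) (Suc 0) \<in> carrier Rees" by (intro monom_Rees Ipow_1 f_in_I i)
  moreover have "fiber_map (up_ring.monom P (f i) (Suc 0)) = f i"
    using dpart_form[OF f_form[OF i]] by (simp add: fiber_map_monom f_PR[OF i])
  ultimately show ?thesis unfolding fiber_ring_def by (metis imageI)
qed

lemma subalg_fiber_ring: "subalg 3 fiber_ring"
proof -
  interpret h: ring_hom_ring Rees "polyring 3" fiber_map by (rule ring_hom_fiber_map)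
  have "a + b \<in> fiber_ring \<and> a * b \<in> fiber_ring" if ab: "a \<in> fiber_ring" "b \<in> fiber_ring" for a b
  proof -
    obtain p q where pq: "p \<in> carrier Rees" "q \<in> carrier Rees" "a = fiber_map p" "b = fiber_map q"
      using ab unfolding fiber_ring_def by blast
    have "a + b = fiber_map (p \<oplus>\<^bsub>Rees\<^esub> q)" "a * b = fiber_map (p \<otimes>\<^bsub>Rees\<^esub> q)"
      using h.hom_add[OF pq(1,2)] h.hom_mult[OF pq(1,2)] by (simp_all add: pq)
    moreover have "p \<oplus>\<^bsub>Rees\<^esub> q \<in> carrier Rees" "p \<otimes>\<^bsub>Rees\<^esub> q \<in> carrier Rees"
      using pq h.R.a_closed h.R.m_closed by auto
    ultimately show ?thesis unfolding fiber_ring_def by blast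
  qed
  moreover have "fiber_ring \<subseteq> PR 3" by (auto simp: fiber_ring_def Rees_simps fiber_map_PR)
  ultimately show ?thesis using PConst_fiber_ring by (auto simp: subalg_def)
qed

lemma special_fiber_iso:
  "(\<lambda>X. the_elem (fiber_map ` X)) \<in> ring_iso (special_fiber (polyring 3) \<mm> I) ((polyring 3)\<lparr>carrier := fiber_ring\<rparr>)"
  using ring_hom_ring.FactRing_iso_set_aux[OF ring_hom_fiber_map]
  by (simp add: kernel_fiber_map special_fiber_def fiber_ring_def)

text \<open>The lowest part of an element of the \<open>i\<close>-th power is a combination, with
  constant coefficients, of products of \<open>i\<close> minors.\<close>

lemma fiber_ring_least:
  assumes T: "\<And>c. PConst c \<in> T" "\<And>a b. a \<in> T \<Longrightarrow> b \<in> T \<Longrightarrow> a + b \<in> T" "\<And>a b. a \<in> T \<Longrightarrow> b \<in> T \<Longrightarrow> a * b \<in> T"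
    and f: "\<And>i. i < n \<Longrightarrow> f i \<in> T"
  shows "fiber_ring \<subseteq> T"
proof -
  have I: "dpart (n - 1) b \<in> T" if "b \<in> I" for b
  proof -
    let ?X = "{b \<in> PR 3. (\<forall>m\<in>supp b. n - 1 \<le> tdeg m) \<and> dpart (n - 1) b \<in> T}"
    have "ideal ?X (polyring 3)"
    proof (rule PR_idealI)
      show "0 \<in> ?X" using T(1)[of 0] by simp
      show "a + b \<in> ?X" if "a \<in> ?X" "b \<in> ?X" for a b
        using that T(2) ideal_ops(3)[OF degree_ge_ideal, of a "n - 1" b] by (simp add: dpart_add)
      show "s * a \<in> ?X" if "s \<in> PR 3" "a \<in> ?X" for s a
        using that T(1,3) ideal_ops(4)[OF degree_ge_ideal, of a "n - 1" s]
          dpart_mult[of s 0 a "n - 1"] by (simp add: dpart_0)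
    qed auto
    moreover have "f i \<in> ?X" if "i < n" for i
      using f_PR[OF that] f_form[OF that] f[OF that] dpart_form[OF f_form[OF that], of "n - 1"]
      by (auto simp: form_iff)
    ultimately have "I \<subseteq> ?X" unfolding minors_ideal_eq by (intro R.genideal_minimal) auto
    with that show ?thesis by auto
  qed
  have Ipow: "dpart (i * (n - 1)) q \<in> T" if "q \<in> Ipow i" for i q
    using that
  proof (induction i arbitrary: q)
    case 0
    then show ?case using T(1) by (simp add: dpart_0)
  next
    case (Suc i)
    have "q \<in> ideal_prod (polyring 3) (Ipow i) I" using Suc.prems unfolding Ipow_Suc .
    then show ?case
    proof (induction q rule: ideal_prod.induct)
      case (prod a b)
      have "dpart (i * (n - 1) + (n - 1)) (a * b) = dpart (i * (n - 1)) a * dpart (n - 1) b"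
        using Ipow_degree_ge[OF prod(1)] Ipow_degree_ge[OF Ipow_1[OF prod(2)]]
        by (intro dpart_mult) auto
      then show ?case using T(3) Suc.IH[OF prod(1)] I[OF prod(2)] by (simp add: add.commute)
    next
      case (sum a b)
      then show ?case using T(2) by (simp add: dpart_add)
    qed
  qed
  have "fiber_map p \<in> T" if p: "p \<in> carrier Rees" for p
  proof -
    have sum: "sum g A \<in> T" if "\<And>i. i \<in> A \<Longrightarrow> g i \<in> T" for g :: "nat \<Rightarrow> 'k mpoly" and A
      using that T(1)[of 0] by (induction A rule: infinite_finite_induct) (auto intro: T(2))
    show ?thesis
      using p Ipow unfolding fiber_map_def poly_altdef
      by (intro sum) (auto simp: coeff_lowest Rees_simps)
  qed
  then show ?thesis by (auto simp: fiber_ring_def)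
qed

end

section \<open>The dimension of the special fiber\<close>

lemma prime_chain_vimage:
  assumes A: "cring A" and B: "ring B" and h: "h \<in> Ring.ring_hom A B" "h ` carrier A = carrier B"
    and C: "prime_chain B r C"
  shows "prime_chain A r (\<lambda>i. {x \<in> carrier A. h x \<in> C i})"
proof -
  have hom: "ring_hom_ring A B h"
    using A B h(1) by (intro ring_hom_ringI2) (simp_all add: cring_def)
  have "{x \<in> carrier A. h x \<in> C i} \<subset> {x \<in> carrier A. h x \<in> C (Suc i)}" if "i < r" for i
  proof -
    have "C i \<subset> C (Suc i)" "primeideal (C (Suc i)) B" using C that by (auto simp: prime_chain_def)
    then obtain y where y: "y \<in> C (Suc i)" "y \<notin> C i" "C i \<subseteq> C (Suc i)" by auto
    then have "y \<in> carrier B"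
      using additive_subgroup.a_subset[of "C (Suc i)" B] \<open>primeideal (C (Suc i)) B\<close>
      by (auto simp: primeideal_def ideal_def)
    then obtain x where "x \<in> carrier A" "y = h x" using h(2) by blast
    with y show ?thesis by auto
  qed
  then show ?thesis
    using C ring_hom_ring.primeideal_vimage[OF hom A] by (auto simp: prime_chain_def)
qed

lemma krull_dim_iso:
  assumes A: "cring A" and B: "cring B" and h: "h \<in> ring_iso A B"
  shows "krull_dim A = krull_dim B"
proof -
  have rA: "ring A" and rB: "ring B" using A B by (simp_all add: cring_def)
  have h': "inv_into (carrier A) h \<in> ring_iso B A" by (rule ring_iso_set_sym[OF rA h])
  have surj: "g ` carrier R1 = carrier R2" "g \<in> Ring.ring_hom R1 R2" if "g \<in> ring_iso R1 R2"
    for g and R1 :: "('x, 'y) ring_scheme" and R2 :: "('z, 'w) ring_scheme"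
    using that by (auto simp: ring_iso_def bij_betw_def)
  have "(\<exists>C. prime_chain A r C) \<longleftrightarrow> (\<exists>C. prime_chain B r C)" for r
    using prime_chain_vimage[OF A rB surj(2,1)[OF h], of r]
      prime_chain_vimage[OF B rA surj(2,1)[OF h'], of r] by blast
  then show ?thesis by (simp add: krull_dim_def)
qed

section \<open>Restriction to a monomial curve\<close>

definition curve :: "nat \<Rightarrow> nat \<Rightarrow> ('k::field) mpoly" where
  "curve N i = (if i = 0 then pvar 0 else if i = 1 then pvar 0 * pvar 1 else pvar 0 * pvar 1 ^ N)"

text \<open>A Kronecker substitution: the power of \<open>pvar 0\<close> records the total degree,
  that of \<open>pvar 1\<close> the exponents of the other two variables as digits to base
  \<open>N\<close>.\<close>

definition curve_mon :: "nat \<Rightarrow> (nat \<Rightarrow>\<^sub>0 nat) \<Rightarrow> nat \<Rightarrow>\<^sub>0 nat" where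
  "curve_mon N m = Poly_Mapping.single 0 (tdeg m) + Poly_Mapping.single 1 (coef m 1 + N * coef m 2)"

lemma coef_curve_mon: "coef (curve_mon N m) 0 = tdeg m" "coef (curve_mon N m) 1 = coef m 1 + N * coef m 2"
  by (simp_all add: curve_mon_def lookup_add lookup_single)

lemma tdeg_3: "supp m \<subseteq> {..<3} \<Longrightarrow> tdeg m = coef m 0 + coef m 1 + coef m 2"
  using tdeg_superset[of "{..<3}" m] by (simp add: sum_lessThan_3)

lemma psubst_curve:
  fixes p :: "('k::field) mpoly"
  assumes "p \<in> PR 3"
  shows "psubst p (curve N) = (\<Sum>m\<in>supp p. Poly_Mapping.single (curve_mon N m) (coef p m))"
  unfolding psubst_eq_sum
proof (rule sum.cong)
  fix m assume "m \<in> supp p"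
  then have m: "supp m \<subseteq> {..<3}" using assms by (auto simp: PR_iff)
  have "mon_eval (curve N :: nat \<Rightarrow> 'k mpoly) m = pvar 0 ^ tdeg m * pvar 1 ^ (coef m 1 + N * coef m 2)"
    using m by (simp add: mon_eval_superset[of "{..<3}"] tdeg_3 numeral_3_eq_3 One_nat_def
        numeral_2_eq_2 curve_def power_mult_distrib power_add power_mult mult_ac)
  also have "\<dots> = mon_eval pvar (curve_mon N m)"
    by (simp add: curve_mon_def mon_eval_add mon_eval_single)
  finally show "PConst (coef p m) * mon_eval (curve N) m = Poly_Mapping.single (curve_mon N m) (coef p m)"
    by (simp only: single_eq_PConst_mult_mon_eval[of "curve_mon N m"])
qed simp

lemma coef_psubst_curve:
  "p \<in> PR 3 \<Longrightarrow> coef (psubst p (curve N)) k = (\<Sum>m\<in>supp p. if curve_mon N m = k then coef p m else 0)"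
  by (simp add: psubst_curve lookup_sum lookup_single when_def)

lemma supp_psubst_curve: "p \<in> PR 3 \<Longrightarrow> supp (psubst p (curve N)) \<subseteq> curve_mon N ` supp p"
proof
  fix k assume p: "p \<in> PR 3" and "k \<in> supp (psubst p (curve N))"
  then have "(\<Sum>m\<in>supp p. if curve_mon N m = k then coef p m else 0) \<noteq> 0"
    by (simp add: in_keys_iff coef_psubst_curve)
  then obtain m where "m \<in> supp p" "(if curve_mon N m = k then coef p m else 0) \<noteq> 0"
    by (elim sum.not_neutral_contains_not_neutral)
  then show "k \<in> curve_mon N ` supp p" by (auto split: if_splits)
qed

lemma psubst_curve_nonzero:
  assumes p: "p \<in> PR 3" "p \<noteq> 0" and N: "\<And>m. m \<in> supp p \<Longrightarrow> coef m 1 < N"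
  shows "psubst p (curve N) \<noteq> 0"
proof -
  have inj: "m = m'" if m: "m \<in> supp p" "m' \<in> supp p" "curve_mon N m = curve_mon N m'" for m m'
  proof -
    have s: "supp m \<subseteq> {..<3}" "supp m' \<subseteq> {..<3}" using m p by (auto simp: PR_iff)
    have e1: "coef m 1 + N * coef m 2 = coef m' 1 + N * coef m' 2"
      using m(3) by (metis coef_curve_mon(2))
    have "(coef m 1 + N * coef m 2) div N = coef m 2" "(coef m' 1 + N * coef m' 2) div N = coef m' 2"
      using N[OF m(1)] N[OF m(2)] by simp_all
    with e1 have c2: "coef m 2 = coef m' 2" by simp
    with e1 have c1: "coef m 1 = coef m' 1" by simp
    have "tdeg m = tdeg m'" using m(3) by (metis coef_curve_mon(1))
    with c1 c2 have c0: "coef m 0 = coef m' 0" by (simp add: tdeg_3 s)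
    show ?thesis
    proof (rule poly_mapping_eqI)
      fix i
      consider "i = 0" | "i = 1" | "i = 2" | "i \<notin> {..<3::nat}" by fastforce
      then show "coef m i = coef m' i"
      proof cases
        case 4
        with s have "i \<notin> supp m" "i \<notin> supp m'" by blast+
        then show ?thesis by (simp add: in_keys_iff)
      qed (use c0 c1 c2 in simp_all)
    qed
  qed
  obtain m where m: "m \<in> supp p" using p(2) by (metis ex_in_conv keys_eq_empty)
  have "coef (psubst p (curve N)) (curve_mon N m) = (\<Sum>m'\<in>supp p. if m' = m then coef p m' else 0)"
    unfolding coef_psubst_curve[OF p(1)] by (intro sum.cong) (auto dest: inj[OF _ m])
  also have "\<dots> \<noteq> 0" using m by (simp add: in_keys_iff)
  finally show ?thesis by auto
qed

lemma coef_pvar_mult: "coef (pvar i * p) (Poly_Mapping.single i 1 + m) = coef p m"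
proof -
  have "pvar i * p = (\<Sum>m'\<in>supp p. Poly_Mapping.single (Poly_Mapping.single i 1 + m') (coef p m'))"
    by (subst (1) poly_mapping_eq_sum_single[of p]) (simp add: sum_distrib_left pvar_def mult_single)
  then have "coef (pvar i * p) (Poly_Mapping.single i 1 + m)
      = (\<Sum>m'\<in>supp p. if m' = m then coef p m' else 0)"
    by (simp add: lookup_sum lookup_single when_def)
  then show ?thesis by (simp add: in_keys_iff)
qed

lemma supp_pvar_power_mult: "m \<in> supp p \<Longrightarrow> Poly_Mapping.single i e + m \<in> supp (pvar i ^ e * p)"
proof (induction e)
  case (Suc e)
  have "Poly_Mapping.single i (Suc e) + m = Poly_Mapping.single i 1 + (Poly_Mapping.single i e + m)"
    by (simp add: One_nat_def flip: single_add add.assoc)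
  with Suc show ?case by (simp add: in_keys_iff coef_pvar_mult mult.assoc)
qed simp

lemma coef_psubst_curve_0: "p \<in> PR 3 \<Longrightarrow> coef (psubst p (curve N)) 0 = coef p 0"
proof -
  assume p: "p \<in> PR 3"
  have "curve_mon N m = 0 \<longleftrightarrow> m = 0" if "m \<in> supp p" for m
  proof
    assume "curve_mon N m = 0"
    then have "tdeg m = 0" using coef_curve_mon(1)[of N m] by simp
    then show "m = 0" by (simp add: tdeg_eq_0_iff)
  qed (simp add: curve_mon_def)
  then have "coef (psubst p (curve N)) 0 = (\<Sum>m\<in>supp p. if m = 0 then coef p m else 0)"
    unfolding coef_psubst_curve[OF p] by (intro sum.cong) auto
  then show ?thesis by (simp add: in_keys_iff)
qed

context hb
begin

text \<open>The curve \<open>(s, s t, s t^N)\<close> avoids the zero set of \<open>D\<close>. Its kernel is a prime of height one of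
  the fiber ring; the images of the minors have a limit point as \<open>t\<close> tends to infinity, which is
  rational over any field and gives the next prime of the chain.\<close>

lemma fiber_ring_chain: "\<exists>C. prime_chain ((polyring 3)\<lparr>carrier := fiber_ring\<rparr>) 3 C"
proof -
  let ?A = "(polyring 3)\<lparr>carrier := fiber_ring\<rparr>"
  note S = subalg_fiber_ring
  have SR: "fiber_ring \<subseteq> PR 3" using S by (simp add: subalg_def)
  obtain h D where c: "conductor h D" using exists_conductor by blast
  have h: "h l \<in> PR n" "form_of_degree 2 (h l)" "psubst (h l) f = pvar l * D" if "l < 3" for l
    using c that by (auto simp: conductor_def)
  have D: "D \<in> PR 3" "D \<noteq> 0" using c by (auto simp: conductor_def)
  have X: "pvar l * D \<in> fiber_ring" if "l < 3" for l
    using subalg_psubst[OF S h(1)[OF that], of f] f_fiber_ring h(3)[OF that] by simp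
  obtain B where B: "supp D \<subseteq> mon_box 3 B" using PR_mon_box[OF D(1)] by blast
  \<comment> \<open>Larger than every exponent in \<open>D\<close>, so that \<open>D\<close> does
    not vanish along the curve.\<close>
  define N where "N = Suc B"
  define T where "T p = psubst p (curve N)" for p :: "'k mpoly"
  have T_add: "T (p + q) = T p + T q" and T_mult: "T (p * q) = T p * T q" for p q
    by (simp_all add: T_def psubst.hom_add psubst.hom_mult)
  have "coef m 1 < N" if "m \<in> supp D" for m
    using that B by (auto simp: mon_box_def N_def le_imp_less_Suc)
  then have TD: "T D \<noteq> 0" unfolding T_def by (intro psubst_curve_nonzero D)
  have Tx: "T (pvar 0 * D) = pvar 0 * T D" "T (pvar 1 * D) = pvar 0 * pvar 1 * T D"
    "T (pvar 2 * D) = pvar 0 * (pvar 1 ^ N * T D)"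
    by (simp_all add: T_def psubst.hom_mult curve_def mult_ac)
  \<comment> \<open>If all minors vanished along the curve, so would \<open>h 0\<close> evaluated at
    them, since a quadric has no constant term; but that value is \<open>pvar 0 * D\<close>.\<close>
  have Tf: "\<exists>i<n. T (f i) \<noteq> 0"
  proof (rule ccontr)
    assume "\<not> ?thesis"
    then have "T (psubst (h 0) f) = psubst (h 0) (\<lambda>_. 0)"
      unfolding T_def using h(1)[of 0] by (subst psubst_psubst) (auto intro: psubst_cong)
    also have "\<dots> = 0"
    proof -
      have "mon_eval (\<lambda>_. 0 :: 'k mpoly) m = 0" if "m \<in> supp (h 0)" for m
      proof -
        have "tdeg m = 2" using h(2)[of 0] that by (simp add: form_iff)
        then have "m \<noteq> 0" by auto
        then obtain i where "i \<in> supp m" by (metis ex_in_conv keys_eq_empty)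
        then show ?thesis unfolding mon_eval_def by (intro prod_zero) (auto simp: in_keys_iff intro!: bexI[of _ i])
      qed
      then show ?thesis by (simp add: psubst_eq_sum)
    qed
    finally show False using TD Tx h(3)[of 0] by simp
  qed
  define E where "E = (\<Union>i<n. (\<lambda>m. coef m 1) ` supp (T (f i)))"
  have E: "finite E" "E \<noteq> {}" using Tf by (auto simp: E_def)
  define e where "e = Max E"
  \<comment> \<open>Along the curve a minor has degree \<open>n - 1\<close> in \<open>pvar 0\<close>
    and at most \<open>e\<close> in \<open>pvar 1\<close>. So its terms have nonnegative weight, and
    weight zero exactly at the power \<open>e\<close>: the part of weight zero is the limit
    point.\<close>
  define L where "L m = int e * int (coef m 0) - int (n - 1) * int (coef m 1)" for m :: "nat \<Rightarrow>\<^sub>0 nat"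
  interpret L: weight L by unfold_locales (simp add: L_def lookup_add algebra_simps)
  have T0: "coef m 0 = n - 1" if i: "i < n" and m: "m \<in> supp (T (f i))" for i m
  proof -
    obtain m' where "m' \<in> supp (f i)" "m = curve_mon N m'"
      using m supp_psubst_curve[OF f_PR[OF i], of N] by (auto simp: T_def)
    then show ?thesis using f_form[OF i] by (simp add: coef_curve_mon form_iff)
  qed
  have "e \<in> E" unfolding e_def by (rule Max_in[OF E])
  then obtain i1 m1 where i1: "i1 < n" "m1 \<in> supp (T (f i1))" "coef m1 1 = e" by (auto simp: E_def)
  have L1: "L m1 = 0" using T0[OF i1(1,2)] i1(3) by (simp add: L_def)
  have Lge: "0 \<le> L m" if "p \<in> fiber_ring" "m \<in> supp (T p)" for p m
  proof -
    have "fiber_ring \<subseteq> {p. \<forall>m\<in>supp (T p). 0 \<le> L m}"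
    proof (rule fiber_ring_least)
      show "PConst k \<in> {p. \<forall>m\<in>supp (T p). 0 \<le> L m}" for k by (simp add: T_def)
      show "a + b \<in> {p. \<forall>m\<in>supp (T p). 0 \<le> L m}"
        if "a \<in> {p. \<forall>m\<in>supp (T p). 0 \<le> L m}" "b \<in> {p. \<forall>m\<in>supp (T p). 0 \<le> L m}" for a b
        using that keys_add[of "T a" "T b"] by (auto simp: T_add)
      show "a * b \<in> {p. \<forall>m\<in>supp (T p). 0 \<le> L m}"
        if "a \<in> {p. \<forall>m\<in>supp (T p). 0 \<le> L m}" "b \<in> {p. \<forall>m\<in>supp (T p). 0 \<le> L m}" for a b
        using that L.supp_mult_ge[of "T a" 0 "T b" 0] by (auto simp: T_mult)
      show "f i \<in> {p. \<forall>m\<in>supp (T p). 0 \<le> L m}" if "i < n" for i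
      proof -
        have "0 \<le> L m" if m: "m \<in> supp (T (f i))" for m
        proof -
          have "coef m 1 \<le> e" unfolding e_def using E(1) m \<open>i < n\<close> by (intro Max_ge) (auto simp: E_def)
          then have "int (coef m 1) * int (n - 1) \<le> int e * int (n - 1)" by (intro mult_right_mono) auto
          then show ?thesis using T0[OF \<open>i < n\<close> m] by (simp add: L_def mult.commute)
        qed
        then show ?thesis by simp
      qed
    qed
    with that show ?thesis by auto
  qed
  \<comment> \<open>In the affine cone over the image these define the whole cone, the cone over the
    curve, the line of the limit point and the vertex.\<close>
  define P0 where "P0 = {s \<in> fiber_ring. s = 0}"
  define P1 where "P1 = {s \<in> fiber_ring. T s = 0}"
  define P2 where "P2 = {s \<in> fiber_ring. wpart L 0 (T s) = 0}"
  define P3 where "P3 = {s \<in> fiber_ring. coef s 0 = 0}"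
  have T1: "T 0 = 0" "T 1 = 1" by (simp_all add: T_def)
  have wmult: "wpart L 0 (T (a * b)) = wpart L 0 (T a) * wpart L 0 (T b)"
    if "a \<in> fiber_ring" "b \<in> fiber_ring" for a b
    using L.wpart_mult[of "T a" 0 "T b" 0] Lge that by (simp add: T_mult)
  have w1: "wpart L 0 (1 :: 'k mpoly) = 1" by (rule wpart_id) simp
  have prime: "primeideal P0 ?A" "primeideal P1 ?A" "primeideal P2 ?A" "primeideal P3 ?A"
    unfolding P0_def P1_def P2_def P3_def
    using kernel_primeideal[OF S, where h = "\<lambda>s. s"] kernel_primeideal[OF S, where h = T]
      kernel_primeideal[OF S, where h = "\<lambda>s. wpart L 0 (T s)"]
      kernel_primeideal[OF S, where h = "\<lambda>s. coef s 0"]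
    by (simp_all add: T1 T_add wpart_add wmult w1 lookup_add) (simp_all add: T_mult coef_mult_0)
  have "P0 \<subset> P1"
  proof
    \<comment> \<open>The homogeneous equation \<open>X0^(N - 1) X2 = X1^N\<close> of the curve in
      the elements \<open>pvar l * D\<close> of the fiber ring, with
      \<open>B = N - 1\<close>.\<close>
    let ?x = "(pvar 0 * D) ^ B * (pvar 2 * D) - (pvar 1 * D) ^ Suc B"
    have "?x \<in> fiber_ring"
      using subalg_closed[OF S] subalgD(6)[OF S] X by (simp del: power_Suc)
    moreover have "T ?x = T (pvar 0 * D) ^ B * T (pvar 2 * D) - T (pvar 1 * D) ^ Suc B"
      by (simp add: T_def psubst.hom_minus psubst.hom_mult psubst.hom_power)
    then have "T ?x = 0" unfolding Tx N_def by (simp add: power_mult_distrib mult_ac)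
    ultimately have "?x \<in> P1" by (simp add: P1_def)
    moreover have "?x \<noteq> 0"
    proof
      assume "?x = 0"
      then have "D ^ Suc B * (pvar 0 ^ B * pvar 2) = D ^ Suc B * pvar 1 ^ Suc B"
        by (simp add: power_mult_distrib mult_ac)
      then have "pvar 0 ^ B * pvar 2 = (pvar 1 ^ Suc B :: 'k mpoly)" using D by simp
      then have "psubst (pvar 0 ^ B * pvar 2 :: 'k mpoly) (pvar(1 := 0)) = psubst (pvar 1 ^ Suc B) (pvar(1 := 0))"
        by simp
      then show False by (simp add: psubst.hom_mult psubst.hom_power)
    qed
    ultimately show "P0 \<noteq> P1" by (auto simp: P0_def)
  qed (auto simp: P0_def P1_def T1)
  moreover have "P1 \<subset> P2"
  proof
    \<comment> \<open>Along the curve \<open>pvar 2 * D\<close> is \<open>pvar 1 ^ N\<close> times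
      \<open>pvar 0 * D\<close> and still has nonnegative weights. As \<open>pvar 1 ^ N\<close> has
      negative weight, those of \<open>pvar 0 * D\<close> are positive.\<close>
    have "L m \<noteq> 0" if "m \<in> supp (T (pvar 0 * D))" for m
    proof -
      have "Poly_Mapping.single 1 N + m \<in> supp (pvar 1 ^ N * T (pvar 0 * D))"
        using that by (rule supp_pvar_power_mult)
      moreover have "pvar 1 ^ N * T (pvar 0 * D) = T (pvar 2 * D)"
        unfolding Tx by (simp only: mult_ac)
      ultimately have "0 \<le> L (Poly_Mapping.single 1 N + m)" using Lge[OF X[of 2]] by simp
      moreover have "L (Poly_Mapping.single 1 N + m) = L m - int (n - 1) * int N"
        by (simp add: L_def lookup_add lookup_single algebra_simps)
      moreover have "0 < int (n - 1) * int N" using n_ge_2 by (simp add: N_def)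
      ultimately show ?thesis by linarith
    qed
    then have "wpart L 0 (T (pvar 0 * D)) = 0" by (rule wpart_eq_0)
    then have "pvar 0 * D \<in> P2" using X[of 0] by (simp add: P2_def)
    moreover have "pvar 0 * D \<notin> P1" using TD by (simp add: P1_def Tx)
    ultimately show "P1 \<noteq> P2" by auto
  qed (auto simp: P1_def P2_def)
  moreover have "P2 \<subset> P3"
  proof
    have "coef (wpart L 0 (T (f i1))) m1 \<noteq> 0" using i1 L1 by (simp add: coef_wpart in_keys_iff)
    then have "f i1 \<notin> P2" by (auto simp: P2_def)
    moreover have "0 \<notin> supp (f i1)" using f_form[OF i1(1)] n_ge_2 by (auto simp: form_iff)
    then have "f i1 \<in> P3" using f_fiber_ring[OF i1(1)] by (simp add: P3_def in_keys_iff)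
    ultimately show "P2 \<noteq> P3" by auto
    show "P2 \<subseteq> P3"
    proof
      fix s assume s: "s \<in> P2"
      \<comment> \<open>The constant monomial has weight zero, and restriction to the curve
        preserves the constant term.\<close>
      then have "coef (wpart L 0 (T s)) 0 = 0" by (simp add: P2_def)
      then have "coef (T s) 0 = 0" by (simp add: coef_wpart)
      with s SR show "s \<in> P3" by (auto simp: P2_def P3_def T_def coef_psubst_curve_0)
    qed
  qed
  ultimately have "prime_chain ?A 3 (\<lambda>i. if i = 0 then P0 else if i = 1 then P1 else if i = 2 then P2 else P3)"
    using prime by (auto simp: prime_chain_def less_3_iff)
  then show ?thesis by blast
qed

lemma krull_dim_fiber_ring: "krull_dim ((polyring 3)\<lparr>carrier := fiber_ring\<rparr>) = 3"
proof (rule antisym)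
  let ?A = "(polyring 3)\<lparr>carrier := fiber_ring\<rparr>"
  show "krull_dim ?A \<le> 3"
    unfolding krull_dim_def
  proof (rule Sup_least)
    fix x assume "x \<in> {enat r | r. \<exists>C. prime_chain ?A r C}"
    then obtain r C where x: "x = enat r" and C: "prime_chain ?A r C" by blast
    then have Cr: "primeideal (C r) ?A" by (simp add: prime_chain_def)
    interpret Cr: primeideal "C r" ?A by fact
    \<comment> \<open>The bound is applied with no elements given: a proper ideal contains no
      nonzero constant.\<close>
    have "alg_indep 0 pvar (C r)"
      unfolding alg_indep_def
    proof (intro ballI impI)
      fix Q :: "'k mpoly" assume Q: "Q \<in> PR 0" "psubst Q pvar \<in> C r"
      have "supp Q \<subseteq> {0}" using Q(1) by (auto simp: PR_iff)
      then have e: "Q = PConst (coef Q 0)"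
        by (intro poly_mapping_eqI) (auto simp: lookup_single when_def in_keys_iff)
      show "Q = 0"
      proof (rule ccontr)
        assume "Q \<noteq> 0"
        with e have "coef Q 0 \<noteq> 0" by auto
        have "PConst (inverse (coef Q 0)) * Q \<in> C r"
          using Cr.I_l_closed[of Q "PConst (inverse (coef Q 0))"] Q(2) PConst_fiber_ring by simp
        moreover have "PConst (inverse (coef Q 0)) * Q = 1"
          using \<open>coef Q 0 \<noteq> 0\<close> by (subst (2) e) (simp add: mult_single)
        ultimately show False using Cr.one_imp_carrier Cr.I_notcarr by simp
      qed
    qed
    then have "0 + r \<le> 3" by (intro prime_chain_bound[OF subalg_fiber_ring C]) auto
    then show "x \<le> 3" by (simp add: x numeral_eq_enat)
  qed
  show "3 \<le> krull_dim ?A"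
    unfolding krull_dim_def by (rule Sup_upper) (use fiber_ring_chain in \<open>auto simp: numeral_eq_enat\<close>)
qed

lemma analytic_spread_eq: "analytic_spread (polyring 3) \<mm> I = 3"
proof -
  interpret Rees: cring Rees by (rule cring_Rees)
  have "cring (special_fiber (polyring 3) \<mm> I)"
    unfolding special_fiber_def
    by (intro ideal.quotient_is_cring[OF Rees.genideal_ideal[OF m_monom_Rees]] cring_Rees)
  then show ?thesis
    using krull_dim_iso[OF _ cring_subalg[OF subalg_fiber_ring] special_fiber_iso]
    by (simp add: analytic_spread_def krull_dim_fiber_ring)
qed

end

theorem theorem2p4:
  fixes n :: nat and \<phi> :: "('k::field) mpoly mat"
    and R :: "'k mpoly ring" and \<mm> I :: "'k mpoly set"
  defines "R \<equiv> polyring 3" and "\<mm> \<equiv> irrelevant_ideal 3" and "I \<equiv> minors_ideal 3 (n - 1) \<phi>"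
  assumes dims: "\<phi> \<in> carrier_mat n (n - 1)"
    and linear: "\<And>i j. i < n \<Longrightarrow> j < n - 1 \<Longrightarrow>
                   \<phi> $$ (i, j) \<in> carrier R \<and> form_of_degree 1 (\<phi> $$ (i, j))"
    and ht1: "ideal_height R (minors_ideal 3 1 \<phi>) = 3"
    and ht2: "ideal_height R (minors_ideal 3 (n - 1) \<phi>) = 2"
  shows "birational_onto_image 3 {0} n (max_minor \<phi>) \<and> analytic_spread R \<mm> I = 3
    \<and> (\<forall>G. inverse_onto_image 3 {0} n (max_minor \<phi>) G \<longrightarrow>
         (\<exists>h. (\<forall>i<3. form_of_degree 2 (h i)) \<and>
              same_rational_map n (image_ideal {0} n (max_minor \<phi>)) 3 G h))
    \<and> ring_depth (R Quot (I [^]\<^bsub>ideals_set R\<^esub> (2::nat)))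
        ((\<lambda>a. (I [^]\<^bsub>ideals_set R\<^esub> (2::nat)) +>\<^bsub>R\<^esub> a) ` \<mm>) = 0"
proof -
  interpret hb n \<phi>
    using dims linear ht1 ht2 by unfold_locales (auto simp: R_def)
  obtain h D where c: "conductor h D" using exists_conductor by blast
  then have h2: "\<forall>i<3. form_of_degree 2 (h i)" by (simp add: conductor_def)
  show ?thesis
    unfolding R_def \<mm>_def I_def
  proof (intro conjI allI impI)
    show "birational_onto_image 3 {0} n (max_minor \<phi>)"
      using conductor_inverse[OF c] by (auto simp: birational_onto_image_def)
    show "\<exists>h. (\<forall>i<3. form_of_degree 2 (h i)) \<and> same_rational_map n (image_ideal {0} n (max_minor \<phi>)) 3 G h"
      if "inverse_onto_image 3 {0} n (max_minor \<phi>) G" for G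
      using inverse_degree_two[OF c that] h2 by blast
  qed (rule analytic_spread_eq depth_zero[unfolded Ipow_def])+
qed

end
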